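(* Assume that for every $i\in\{1,\dots,L\}$, $\mathbf{K}_i\mathbf{\Sigma}_{\mathbf{s}}\mathbf{K}_i^H\succ 0$ or $\mathbf{\Sigma}_i\succ 0$. Then the objective sequence $\{\mathsf{MSE}^{(j)}\}_{j=0}^\infty$ generated by the layered-BCD algorithm (described in the context) is monotonically decreasing. The solution sequence $\big\{\{\mathbf{F}_i^{(j)}\}_{i=1}^L,\mathbf{G}^{(j)}\big\}_{j=1}^\infty$ generated by the layered-BCD algorithm has limit points, and each limit point is a stationary point of the problem $(\mathsf{P}0)$.
   Context: Setting. Positive integers $L,M,K$ and $N_i,J_i$ ($i=1,\dots,L$) are given, together with complex matrices $\mathbf{K}_i\in\mathbb{C}^{J_i\times K}$, $\mathbf{H}_i\in\mathbb{C}^{M\times N_i}$, covariance matrices (Hermitian positive semidefinite) $\mathbf{\Sigma}_{\mathbf{s}}\in\mathbb{C}^{K\times K}$ and $\mathbf{\Sigma}_i\in\mathbb{C}^{J_i\times J_i}$, a noise variance $\sigma_0^2>0$ and power budgets $P_i>0$. For $\mathbf{F}_i\in\mathbb{C}^{N_i\times J_i}$ (beamformers) and $\mathbf{G}\in\mathbb{C}^{M\times K}$ (receiver) put $\mathbf{S}=\sum_{i=1}^L\mathbf{H}_i\mathbf{F}_i\mathbf{K}_i$ and $$\mathsf{MSE}\big(\{\mathbf{F}_i\}_{i=1}^L,\mathbf{G}\big)=\mathrm{Tr}\Big\{\mathbf{G}^H\mathbf{S}\mathbf{\Sigma}_{\mathbf{s}}\mathbf{S}^H\mathbf{G}-\mathbf{G}^H\mathbf{S}\mathbf{\Sigma}_{\mathbf{s}}-\mathbf{\Sigma}_{\mathbf{s}}\mathbf{S}^H\mathbf{G}+\sum_{i=1}^L\mathbf{G}^H\mathbf{H}_i\mathbf{F}_i\mathbf{\Sigma}_i\mathbf{F}_i^H\mathbf{H}_i^H\mathbf{G}+\sigma_0^2\mathbf{G}^H\mathbf{G}+\mathbf{\Sigma}_{\mathbf{s}}\Big\}.$$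 Problem $(\mathsf{P}0)$: minimize $\mathsf{MSE}\big(\{\mathbf{F}_i\}_{i=1}^L,\mathbf{G}\big)$ over all $\mathbf{F}_i\in\mathbb{C}^{N_i\times J_i}$, $\mathbf{G}\in\mathbb{C}^{M\times K}$ subject to $\mathrm{Tr}\{\mathbf{F}_i(\mathbf{K}_i\mathbf{\Sigma}_{\mathbf{s}}\mathbf{K}_i^H+\mathbf{\Sigma}_i)\mathbf{F}_i^H\}\le P_i$ for $i=1,\dots,L$. A tuple $\{\mathbf{F}_i\}$ satisfying these constraints is called feasible. Receiver update: $$\mathbf{G}^\star(\{\mathbf{F}_i\})=\Big[\mathbf{S}\mathbf{\Sigma}_{\mathbf{s}}\mathbf{S}^H+\sigma_0^2\mathbf{I}_M+\sum_{i=1}^L\mathbf{H}_i\mathbf{F}_i\mathbf{\Sigma}_i\mathbf{F}_i^H\mathbf{H}_i^H\Big]^{-1}\mathbf{S}\mathbf{\Sigma}_{\mathbf{s}},$$ the minimizer of $\mathsf{MSE}$ over $\mathbf{G}$ for given $\{\mathbf{F}_i\}$. Single-beamformer update: given $\mathbf{G}$ and $\{\mathbf{F}_j\}_{j\ne i}$, $\mathbf{F}_i$ is replaced by the following minimizer of $\mathsf{MSE}$ over $\mathbf{F}_i$ subject to $\mathrm{Tr}\{\mathbf{F}_i(\mathbf{K}_i\mathbf{\Sigma}_{\mathbf{s}}\mathbf{K}_i^H+\mathbf{\Sigma}_i)\mathbf{F}_i^H\}\le P_i$. Put $\mathbf{f}_j=\mathrm{vec}(\mathbf{F}_j)$, $\mathbf{g}=\mathrm{vec}(\mathbf{G})$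 (column stacking), $\mathbf{A}_{ij}=(\mathbf{K}_j\mathbf{\Sigma}_{\mathbf{s}}\mathbf{K}_i^H)^T\otimes(\mathbf{H}_i^H\mathbf{G}\mathbf{G}^H\mathbf{H}_j)$, $\mathbf{B}_i=(\mathbf{K}_i\mathbf{\Sigma}_{\mathbf{s}})^T\otimes\mathbf{H}_i$, $\mathbf{C}_i=\mathbf{\Sigma}_i^*\otimes(\mathbf{H}_i^H\mathbf{G}\mathbf{G}^H\mathbf{H}_i)$ ($^*$ = entrywise conjugate), $\mathbf{E}_i=(\mathbf{K}_i\mathbf{\Sigma}_{\mathbf{s}}\mathbf{K}_i^H+\mathbf{\Sigma}_i)^T\otimes\mathbf{I}_{N_i}$ (positive definite under the theorem's assumption), $\mathbf{q}_i=\sum_{j\ne i}\mathbf{A}_{ij}\mathbf{f}_j$, $\mathbf{b}_i=\mathbf{E}_i^{-1/2}(\mathbf{B}_i^H\mathbf{g}-\mathbf{q}_i)$, $\mathbf{M}_i=\mathbf{E}_i^{-1/2}(\mathbf{A}_{ii}+\mathbf{C}_i)\mathbf{E}_i^{-1/2}=\mathbf{U}_i\mathbf{\Lambda}_i\mathbf{U}_i^H$ (unitary eigendecomposition with eigenvalues $\lambda_{i,1}\ge\dots\ge\lambda_{i,r_i}>0=\lambda_{i,r_i+1}=\dots=\lambda_{i,J_iN_i}$), $\mathbf{p}_i=\mathbf{U}_i^H\mathbf{b}_i$ with $k$-th entry $p_{i,k}$. If $p_{i,k}=0$ for all $k>r_i$ and $\sum_{k=1}^{r_i}|p_{i,k}|^2/\lambda_{i,k}^2\le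 P_i$, the new $\mathbf{f}_i$ is $\mathbf{E}_i^{-1/2}\mathbf{M}_i^\dagger\mathbf{b}_i$ ($^\dagger$ = Moore–Penrose pseudoinverse); otherwise it is $(\mathbf{A}_{ii}+\mathbf{C}_i+\mu_i^\star\mathbf{E}_i)^{-1}(\mathbf{B}_i^H\mathbf{g}-\mathbf{q}_i)$, where $\mu_i^\star>0$ is the unique positive solution of $\sum_{k=1}^{J_iN_i}|p_{i,k}|^2/(\lambda_{i,k}+\mu)^2=P_i$. Layered-BCD (block coordinate descent) algorithm. Initialization: randomly generate a feasible $\{\mathbf{F}_i^{(0)}\}_{i=1}^L$ and set $\mathbf{G}^{(0)}=\mathbf{G}^\star(\{\mathbf{F}_i^{(0)}\})$. Outer loop, repeated until the decrease of $\mathsf{MSE}$ is sufficiently small or a predefined number of iterations is reached: (a) inner loop: with $\mathbf{G}$ fixed at its current value, repeat, until the decrease of $\mathsf{MSE}$ is sufficiently small, a pass in which for $i=1,2,\dots,L$ in order, given $\mathbf{G}$ and the current $\{\mathbf{F}_j\}_{j\ne i}$, $\mathbf{F}_i$ is replaced by its single-beamformer update; (b) given the resulting $\{\mathbf{F}_i\}_{i=1}^L$, update $\mathbf{G}$ to $\mathbf{G}^\star(\{\mathbf{F}_i\})$. The superscript $(j)$ denotes the values after the $j$-th outer-loop iteration, and $\mathsf{MSE}^{(j)}=\mathsf{MSE}\big(\{\mathbf{F}_i^{(j)}\}_{i=1}^L,\mathbf{G}^{(j)}\big)$; the infinite sequences in the claim are those obtained when the outer loop is continued without stopping. Stationary point.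 For a problem $\min\{f(\mathbf{x})\mid\mathbf{x}\in\mathcal{X}\}$ with $f$ continuously differentiable and $\mathcal{X}$ closed and nonempty, $\mathbf{x}_0\in\mathcal{X}$ is a stationary point iff $\nabla f(\mathbf{x}_0)(\mathbf{x}-\mathbf{x}_0)\ge 0$ for all $\mathbf{x}\in\mathcal{X}$, where $\nabla f(\mathbf{x}_0)$ is the gradient of $f$ at $\mathbf{x}_0$ (complex variables being identified with their real and imaginary parts). A limit point of a sequence is the limit of some convergent subsequence. $\mathbf{X}\succ 0$ means Hermitian positive definite. *)

theory Defs
  imports
    "HOL-Analysis.Analysis"
    "Jordan_Normal_Form.Schur_Decomposition"
    "Jordan_Normal_Form.Gauss_Jordan_Elimination"
begin

unbundle no vec_syntax

text \<open>Matrices are those of \<open>Jordan_Normal_Form\<close>, since the block sizes depend on the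
  block index and therefore cannot be types.\<close>

section \<open>Matrix operations\<close>

definition mtrace :: "complex mat \<Rightarrow> complex" where
  "mtrace A = (\<Sum>k<dim_row A. A $$ (k, k))"

definition msum :: "nat \<Rightarrow> nat \<Rightarrow> (nat \<Rightarrow> complex mat) \<Rightarrow> nat set \<Rightarrow> complex mat" where
  "msum nr nc X I = Matrix.mat nr nc (\<lambda>(r, c). \<Sum>i\<in>I. X i $$ (r, c))"

definition hermitian_mat :: "nat \<Rightarrow> complex mat \<Rightarrow> bool" where
  "hermitian_mat n A \<longleftrightarrow> A \<in> carrier_mat n n \<and> mat_adjoint A = A"

text \<open>In \<open>Jordan_Normal_Form\<close> the second argument of \<open>\<bullet>c\<close> is the conjugated one, so
  \<open>(A *\<^sub>v v) \<bullet>c v\<close> is the quadratic form of \<open>A\<close> at \<open>v\<close>; it is real for Hermitian \<open>A\<close>.\<close>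

definition psd_mat :: "nat \<Rightarrow> complex mat \<Rightarrow> bool" where
  "psd_mat n A \<longleftrightarrow> hermitian_mat n A \<and> (\<forall>v\<in>carrier_vec n. 0 \<le> Re ((A *\<^sub>v v) \<bullet>c v))"

definition pd_mat :: "nat \<Rightarrow> complex mat \<Rightarrow> bool" where
  "pd_mat n A \<longleftrightarrow> hermitian_mat n A \<and>
     (\<forall>v\<in>carrier_vec n. v \<noteq> 0\<^sub>v n \<longrightarrow> 0 < Re ((A *\<^sub>v v) \<bullet>c v))"

text \<open>The value is unspecified for singular matrices.\<close>

definition minv :: "complex mat \<Rightarrow> complex mat" where
  "minv A = the (mat_inverse A)"

definition msqrt :: "complex mat \<Rightarrow> complex mat" where
  "msqrt A = (THE R. psd_mat (dim_row A) R \<and> R * R = A)"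

definition minv_sqrt :: "complex mat \<Rightarrow> complex mat" where
  "minv_sqrt A = minv (msqrt A)"

definition is_pseudo_inverse :: "complex mat \<Rightarrow> complex mat \<Rightarrow> bool" where
  "is_pseudo_inverse A X \<longleftrightarrow> X \<in> carrier_mat (dim_col A) (dim_row A) \<and>
     A * X * A = A \<and> X * A * X = X \<and>
     mat_adjoint (A * X) = A * X \<and> mat_adjoint (X * A) = X * A"

definition pseudo_inverse :: "complex mat \<Rightarrow> complex mat" where
  "pseudo_inverse A = (THE X. is_pseudo_inverse A X)"

definition kron :: "complex mat \<Rightarrow> complex mat \<Rightarrow> complex mat" where
  "kron A B = Matrix.mat (dim_row A * dim_row B) (dim_col A * dim_col B)
     (\<lambda>(r, c). A $$ (r div dim_row B, c div dim_col B) * B $$ (r mod dim_row B, c mod dim_col B))"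

text \<open>Column stacking.\<close>

definition vec_of_mat :: "complex mat \<Rightarrow> complex vec" where
  "vec_of_mat A = Matrix.vec (dim_row A * dim_col A) (\<lambda>k. A $$ (k mod dim_row A, k div dim_row A))"

text \<open>\<open>A = U diag(lam) U\<^sup>H\<close> with \<open>U\<close> unitary, the eigenvalues in descending order, and
  exactly the first \<open>r\<close> of them positive. Eigenvalues are indexed from \<open>0\<close>.\<close>

definition psd_eigendecomposition ::
    "nat \<Rightarrow> complex mat \<Rightarrow> complex mat \<Rightarrow> (nat \<Rightarrow> real) \<Rightarrow> nat \<Rightarrow> bool" where
  "psd_eigendecomposition n A U lam r \<longleftrightarrow>
     U \<in> carrier_mat n n \<and> mat_adjoint U * U = 1\<^sub>m n \<and> U * mat_adjoint U = 1\<^sub>m n \<and>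
     A = U * mat_diag n (\<lambda>k. complex_of_real (lam k)) * mat_adjoint U \<and>
     r \<le> n \<and> (\<forall>k l. k \<le> l \<longrightarrow> l < n \<longrightarrow> lam l \<le> lam k) \<and>
     (\<forall>k<r. 0 < lam k) \<and> (\<forall>k. r \<le> k \<longrightarrow> k < n \<longrightarrow> lam k = 0)"

section \<open>The optimization problem\<close>

text \<open>The blocks are indexed by \<open>i \<in> {1..nL p}\<close>; values of block-indexed functions outside this
  range are irrelevant. The field \<open>noise\<close> is the variance \<open>\<sigma>\<^sub>0\<^sup>2\<close>.\<close>

record bf_problem =
  nL :: nat
  nM :: nat
  nK :: nat
  nN :: "nat \<Rightarrow> nat"
  nJ :: "nat \<Rightarrow> nat"
  Kmat :: "nat \<Rightarrow> complex mat"
  Hmat :: "nat \<Rightarrow> complex mat"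
  Sigs :: "complex mat"
  Sig :: "nat \<Rightarrow> complex mat"
  noise :: real
  budget :: "nat \<Rightarrow> real"

definition valid_problem :: "bf_problem \<Rightarrow> bool" where
  "valid_problem p \<longleftrightarrow>
     0 < nL p \<and> 0 < nM p \<and> 0 < nK p \<and> psd_mat (nK p) (Sigs p) \<and> 0 < noise p \<and>
     (\<forall>i\<in>{1..nL p}. 0 < nN p i \<and> 0 < nJ p i \<and>
        Kmat p i \<in> carrier_mat (nJ p i) (nK p) \<and> Hmat p i \<in> carrier_mat (nM p) (nN p i) \<and>
        psd_mat (nJ p i) (Sig p i) \<and> 0 < budget p i)"

definition Smat :: "bf_problem \<Rightarrow> (nat \<Rightarrow> complex mat) \<Rightarrow> complex mat" where
  "Smat p F = msum (nM p) (nK p) (\<lambda>i. Hmat p i * F i * Kmat p i) {1..nL p}"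

text \<open>The trace is real (it is the trace of a Hermitian matrix), so taking the real part below only
  changes the type; likewise for the power constraint.\<close>

definition MSE :: "bf_problem \<Rightarrow> (nat \<Rightarrow> complex mat) \<Rightarrow> complex mat \<Rightarrow> real" where
  "MSE p F G = Re (mtrace (
     mat_adjoint G * Smat p F * Sigs p * mat_adjoint (Smat p F) * G
     - mat_adjoint G * Smat p F * Sigs p
     - Sigs p * mat_adjoint (Smat p F) * G
     + msum (nK p) (nK p)
         (\<lambda>i. mat_adjoint G * Hmat p i * F i * Sig p i * mat_adjoint (F i) * mat_adjoint (Hmat p i) * G)
         {1..nL p}
     + complex_of_real (noise p) \<cdot>\<^sub>m (mat_adjoint G * G)
     + Sigs p))"

definition tx_cov :: "bf_problem \<Rightarrow> nat \<Rightarrow> complex mat" where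
  "tx_cov p i = Kmat p i * Sigs p * mat_adjoint (Kmat p i) + Sig p i"

definition feasible :: "bf_problem \<Rightarrow> (nat \<Rightarrow> complex mat) \<Rightarrow> bool" where
  "feasible p F \<longleftrightarrow> (\<forall>i\<in>{1..nL p}. F i \<in> carrier_mat (nN p i) (nJ p i) \<and>
     Re (mtrace (F i * tx_cov p i * mat_adjoint (F i))) \<le> budget p i)"

section \<open>Stationary points\<close>

definition add_entry :: "complex mat \<Rightarrow> nat \<Rightarrow> nat \<Rightarrow> complex \<Rightarrow> complex mat" where
  "add_entry X r c z = Matrix.mat (dim_row X) (dim_col X)
     (\<lambda>(a, b). X $$ (a, b) + (if a = r \<and> b = c then z else 0))"

text \<open>The gradient of \<open>f\<close> at \<open>X\<close>, applied to \<open>D\<close>: the vector of partial derivatives with respect to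
  the real and imaginary parts of all entries of \<open>X\<close>, multiplied with the corresponding real
  coordinates of \<open>D\<close>.\<close>

definition grad_app :: "(complex mat \<Rightarrow> real) \<Rightarrow> complex mat \<Rightarrow> complex mat \<Rightarrow> real" where
  "grad_app f X D = (\<Sum>r<dim_row X. \<Sum>c<dim_col X.
     deriv (\<lambda>t::real. f (add_entry X r c (complex_of_real t))) 0 * Re (D $$ (r, c)) +
     deriv (\<lambda>t::real. f (add_entry X r c (\<i> * complex_of_real t))) 0 * Im (D $$ (r, c)))"

text \<open>The gradient with respect to all variables jointly is the concatenation of the gradients with
  respect to the blocks \<open>F 1, \<dots>, F L, G\<close>.\<close>

definition stationary_P0 :: "bf_problem \<Rightarrow> (nat \<Rightarrow> complex mat) \<Rightarrow> complex mat \<Rightarrow> bool" where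
  "stationary_P0 p F G \<longleftrightarrow>
     feasible p F \<and> G \<in> carrier_mat (nM p) (nK p) \<and>
     (\<forall>F' G'. feasible p F' \<longrightarrow> G' \<in> carrier_mat (nM p) (nK p) \<longrightarrow>
        0 \<le> (\<Sum>i\<in>{1..nL p}. grad_app (\<lambda>Y. MSE p (F(i := Y)) G) (F i) (F' i - F i))
             + grad_app (\<lambda>Y. MSE p F Y) G (G' - G))"

section \<open>The layered block coordinate descent algorithm\<close>

definition Gstar :: "bf_problem \<Rightarrow> (nat \<Rightarrow> complex mat) \<Rightarrow> complex mat" where
  "Gstar p F =
     minv (Smat p F * Sigs p * mat_adjoint (Smat p F)
           + complex_of_real (noise p) \<cdot>\<^sub>m 1\<^sub>m (nM p)
           + msum (nM p) (nM p)
               (\<lambda>i. Hmat p i * F i * Sig p i * mat_adjoint (F i) * mat_adjoint (Hmat p i)) {1..nL p})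
     * (Smat p F * Sigs p)"

definition Amat :: "bf_problem \<Rightarrow> complex mat \<Rightarrow> nat \<Rightarrow> nat \<Rightarrow> complex mat" where
  "Amat p G i j = kron (transpose_mat (Kmat p j * Sigs p * mat_adjoint (Kmat p i)))
                       (mat_adjoint (Hmat p i) * G * mat_adjoint G * Hmat p j)"

definition Bmat :: "bf_problem \<Rightarrow> nat \<Rightarrow> complex mat" where
  "Bmat p i = kron (transpose_mat (Kmat p i * Sigs p)) (Hmat p i)"

definition Cmat :: "bf_problem \<Rightarrow> complex mat \<Rightarrow> nat \<Rightarrow> complex mat" where
  "Cmat p G i = kron (map_mat cnj (Sig p i))
                     (mat_adjoint (Hmat p i) * G * mat_adjoint G * Hmat p i)"

definition Emat :: "bf_problem \<Rightarrow> nat \<Rightarrow> complex mat" where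
  "Emat p i = kron (transpose_mat (tx_cov p i)) (1\<^sub>m (nN p i))"

definition qvec :: "bf_problem \<Rightarrow> complex mat \<Rightarrow> (nat \<Rightarrow> complex mat) \<Rightarrow> nat \<Rightarrow> complex vec" where
  "qvec p G F i = finsum_vec TYPE(complex) (nJ p i * nN p i)
     (\<lambda>j. Amat p G i j *\<^sub>v vec_of_mat (F j)) ({1..nL p} - {i})"

definition rhs_vec :: "bf_problem \<Rightarrow> complex mat \<Rightarrow> (nat \<Rightarrow> complex mat) \<Rightarrow> nat \<Rightarrow> complex vec" where
  "rhs_vec p G F i = mat_adjoint (Bmat p i) *\<^sub>v vec_of_mat G - qvec p G F i"

definition bvec :: "bf_problem \<Rightarrow> complex mat \<Rightarrow> (nat \<Rightarrow> complex mat) \<Rightarrow> nat \<Rightarrow> complex vec" where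
  "bvec p G F i = minv_sqrt (Emat p i) *\<^sub>v rhs_vec p G F i"

definition Mmat :: "bf_problem \<Rightarrow> complex mat \<Rightarrow> nat \<Rightarrow> complex mat" where
  "Mmat p G i = minv_sqrt (Emat p i) * (Amat p G i i + Cmat p G i) * minv_sqrt (Emat p i)"

text \<open>The new value \<open>Fi\<close> of the \<open>i\<close>-th beamformer, given the receiver \<open>G\<close> and the other
  beamformers in \<open>F\<close> (\<open>F i\<close> is not used). Any admissible eigendecomposition may be chosen.\<close>

definition beamformer_update ::
    "bf_problem \<Rightarrow> complex mat \<Rightarrow> (nat \<Rightarrow> complex mat) \<Rightarrow> nat \<Rightarrow> complex mat \<Rightarrow> bool" where
  "beamformer_update p G F i Fi \<longleftrightarrow>
     Fi \<in> carrier_mat (nN p i) (nJ p i) \<and>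
     (\<exists>U lam r. psd_eigendecomposition (nJ p i * nN p i) (Mmat p G i) U lam r \<and>
       (let n = nJ p i * nN p i;
            pv = mat_adjoint U *\<^sub>v bvec p G F i
        in if (\<forall>k. r \<le> k \<longrightarrow> k < n \<longrightarrow> pv $ k = 0) \<and>
              (\<Sum>k<r. (cmod (pv $ k))\<^sup>2 / (lam k)\<^sup>2) \<le> budget p i
           then vec_of_mat Fi
                  = minv_sqrt (Emat p i) *\<^sub>v (pseudo_inverse (Mmat p G i) *\<^sub>v bvec p G F i)
           else (let mu = (THE mu::real. 0 < mu \<and>
                             (\<Sum>k<n. (cmod (pv $ k))\<^sup>2 / (lam k + mu)\<^sup>2) = budget p i)
                 in vec_of_mat Fi
                      = minv (Amat p G i i + Cmat p G i + complex_of_real mu \<cdot>\<^sub>m Emat p i)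
                          *\<^sub>v rhs_vec p G F i)))"

text \<open>One pass: the blocks \<open>1, \<dots>, L\<close> are updated in this order; \<open>X i\<close> is the tuple after the update
  of block \<open>i\<close>.\<close>

definition inner_pass ::
    "bf_problem \<Rightarrow> complex mat \<Rightarrow> (nat \<Rightarrow> complex mat) \<Rightarrow> (nat \<Rightarrow> complex mat) \<Rightarrow> bool" where
  "inner_pass p G F F' \<longleftrightarrow>
     (\<exists>X. X 0 = F \<and> X (nL p) = F' \<and>
        (\<forall>i\<in>{1..nL p}. \<exists>Fi. beamformer_update p G (X (i - 1)) i Fi \<and> X i = (X (i - 1))(i := Fi)))"

text \<open>The inner loop (repeat a pass until the decrease of the objective is small). The stopping test
  \<open>small\<close> receives the objective before and after the pass, so that absolute and relative
  tolerances are both covered.\<close>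

inductive inner_loop ::
    "bf_problem \<Rightarrow> (real \<Rightarrow> real \<Rightarrow> bool) \<Rightarrow> complex mat \<Rightarrow>
     (nat \<Rightarrow> complex mat) \<Rightarrow> (nat \<Rightarrow> complex mat) \<Rightarrow> bool"
  for p :: bf_problem and small :: "real \<Rightarrow> real \<Rightarrow> bool" and G :: "complex mat" where
  stop: "inner_pass p G F F' \<Longrightarrow> small (MSE p F G) (MSE p F' G) \<Longrightarrow> inner_loop p small G F F'"
| again: "inner_pass p G F F' \<Longrightarrow> \<not> small (MSE p F G) (MSE p F' G) \<Longrightarrow>
          inner_loop p small G F' F'' \<Longrightarrow> inner_loop p small G F F''"

text \<open>\<open>F j i\<close> and \<open>G j\<close> are the \<open>i\<close>-th beamformer and the receiver after \<open>j\<close> outer iterations, the outer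
  loop being continued forever; \<open>small j\<close> is the inner stopping test used in outer iteration \<open>j\<close>.\<close>

definition layered_BCD ::
    "bf_problem \<Rightarrow> (nat \<Rightarrow> real \<Rightarrow> real \<Rightarrow> bool) \<Rightarrow>
     (nat \<Rightarrow> nat \<Rightarrow> complex mat) \<Rightarrow> (nat \<Rightarrow> complex mat) \<Rightarrow> bool" where
  "layered_BCD p small F G \<longleftrightarrow>
     feasible p (F 0) \<and> G 0 = Gstar p (F 0) \<and>
     (\<forall>j. inner_loop p (small (Suc j)) (G j) (F j) (F (Suc j)) \<and> G (Suc j) = Gstar p (F (Suc j)))"

section \<open>Limit points\<close>

definition mat_tendsto :: "nat \<Rightarrow> nat \<Rightarrow> (nat \<Rightarrow> complex mat) \<Rightarrow> complex mat \<Rightarrow> bool" where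
  "mat_tendsto nr nc X A \<longleftrightarrow> A \<in> carrier_mat nr nc \<and>
     (\<forall>r<nr. \<forall>c<nc. (\<lambda>n. X n $$ (r, c)) \<longlonglongrightarrow> A $$ (r, c))"

definition is_limit_point ::
    "bf_problem \<Rightarrow> (nat \<Rightarrow> nat \<Rightarrow> complex mat) \<Rightarrow> (nat \<Rightarrow> complex mat) \<Rightarrow>
     (nat \<Rightarrow> complex mat) \<Rightarrow> complex mat \<Rightarrow> bool" where
  "is_limit_point p F G Fl Gl \<longleftrightarrow>
     (\<exists>s::nat \<Rightarrow> nat. strict_mono s \<and>
        (\<forall>i\<in>{1..nL p}. mat_tendsto (nN p i) (nJ p i) (\<lambda>n. F (s n) i) (Fl i)) \<and>
        mat_tendsto (nM p) (nK p) (\<lambda>n. G (s n)) Gl)"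

end

theory Submission
  imports Defs
begin

text \<open>
For a fixed receiver the objective is a convex quadratic function of all beamformers jointly. The
closed-form update of one block satisfies the Karush-Kuhn-Tucker conditions of its subproblem, so it
minimizes over that block and decreases the objective at least by the quadratic form of the
objective at the step taken. The minimizer need not be unique, hence the steps themselves need not
tend to zero. But their quadratic form does, since the objective values converge, and by the
Cauchy-Schwarz inequality for that positive semidefinite form the partial gradients at the start of
a pass and at its intermediate points have a vanishing difference. So each block satisfies its
variational inequality up to an error that vanishes along the iteration, which passes to limit
points; the normal equation of the receiver is a closed condition. The power constraints bound the
beamformers because the transmit covariances are positive definite, and the noise term of the
objective bounds the receiver.
\<close>

section \<open>Complex matrices\<close>

text \<open>The inequality delivered by a block update is anchored in the wrong place twice: its
  gradient is taken at an intermediate point of the pass, and its test direction starts at the new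
  block. Neither the intermediate points nor the new blocks need converge along a subsequence on
  which the outer iterates do. So everything is moved back to the start of the pass. Changing the
  direction costs at most the decrease \<open>d\<close>; each of at most \<open>nL p\<close> block
  changes moves the partial derivative by at most \<open>4 * sqrt (d * q)\<close>, where
  \<open>q\<close> is the quadratic form at the test direction. The first pass of an inner loop
  starts at the outer iterate \<open>(F j, G j)\<close>, where the receiver is optimal as well.
  Later passes and the receiver update only lower the objective further, so \<open>d\<close> may be
  taken as the decrease of the whole outer iteration, whatever the stopping test does. All
  inequalities then refer to one point, and since each constraint involves a single block, they add
  up to joint stationarity. Definiteness of \<open>tx_cov\<close> also makes \<open>Emat\<close>
  definite, so that the inverse square root in the update is a genuine one.\<close>

lemma mat_adjoint_dim [simp]: "dim_row (mat_adjoint A) = dim_col A" "dim_col (mat_adjoint A) = dim_row A"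
  by (auto simp: mat_adjoint_def)

lemma mat_adjoint_index [simp]:
  "i < dim_col A \<Longrightarrow> j < dim_row A \<Longrightarrow> mat_adjoint (A :: complex mat) $$ (i, j) = cnj (A $$ (j, i))"
  by (auto simp: mat_adjoint_def mat_of_rows_def)

lemma mat_adjoint_carrier [simp]: "mat_adjoint A \<in> carrier_mat n m \<longleftrightarrow> A \<in> carrier_mat m n"
  by (metis carrier_matD carrier_matI mat_adjoint_dim)

lemma mat_adjoint_adjoint [simp]: "mat_adjoint (mat_adjoint (A :: complex mat)) = A"
  by (rule eq_matI) auto

lemma mat_mult_index:
  "i < dim_row A \<Longrightarrow> j < dim_col B \<Longrightarrow> dim_col A = dim_row B \<Longrightarrow>
   (A * B) $$ (i, j) = (\<Sum>k<dim_row B. A $$ (i, k) * B $$ (k, j))"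
  by (auto simp: scalar_prod_def atLeast0LessThan)

lemma mat_adjoint_mult:
  "dim_col A = dim_row B \<Longrightarrow> mat_adjoint (A * B :: complex mat) = mat_adjoint B * mat_adjoint A"
  by (rule eq_matI) (auto simp: mat_mult_index simp del: index_mult_mat(1) intro!: sum.cong)

lemma mat_adjoint_add:
  "dim_row A = dim_row B \<Longrightarrow> dim_col A = dim_col B \<Longrightarrow>
   mat_adjoint (A + B :: complex mat) = mat_adjoint A + mat_adjoint B"
  by (rule eq_matI) auto

lemma mat_adjoint_minus:
  "dim_row A = dim_row B \<Longrightarrow> dim_col A = dim_col B \<Longrightarrow>
   mat_adjoint (A - B :: complex mat) = mat_adjoint A - mat_adjoint B"
  by (rule eq_matI) auto

lemma mat_adjoint_smult: "mat_adjoint (c \<cdot>\<^sub>m A :: complex mat) = cnj c \<cdot>\<^sub>m mat_adjoint A"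
  by (rule eq_matI) auto

lemma mat_adjoint_one [simp]: "mat_adjoint (1\<^sub>m n :: complex mat) = 1\<^sub>m n"
  by (rule eq_matI) auto

text \<open>The library versions have the dimensions as extra variables in carrier premises, which the
  simplifier cannot instantiate.\<close>

lemma mat_assoc:
  "dim_col A = dim_row B \<Longrightarrow> dim_col B = dim_row C \<Longrightarrow> (A * B) * C = A * (B * (C :: complex mat))"
  by (rule assoc_mult_mat[of A "dim_row A" "dim_col A" B "dim_col B" C "dim_col C"]) auto

lemma mat_distrib_left:
  "dim_col A = dim_row B \<Longrightarrow> dim_row B = dim_row C \<Longrightarrow> dim_col B = dim_col C \<Longrightarrow>
   A * (B + C) = A * B + A * (C :: complex mat)"
  by (rule mult_add_distrib_mat[of A "dim_row A" "dim_col A" B "dim_col B" C]) auto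

lemma mat_distrib_right:
  "dim_col A = dim_row C \<Longrightarrow> dim_row A = dim_row B \<Longrightarrow> dim_col A = dim_col B \<Longrightarrow>
   (A + B) * C = A * C + B * (C :: complex mat)"
  by (rule add_mult_distrib_mat[of A "dim_row A" "dim_col A" B C "dim_col C"]) auto

lemma mat_minus_distrib_left:
  "dim_col A = dim_row B \<Longrightarrow> dim_row B = dim_row C \<Longrightarrow> dim_col B = dim_col C \<Longrightarrow>
   A * (B - C) = A * B - A * (C :: complex mat)"
  by (rule mult_minus_distrib_mat[of A "dim_row A" "dim_col A" B "dim_col B" C]) auto

lemma mat_minus_distrib_right:
  "dim_col A = dim_row C \<Longrightarrow> dim_row A = dim_row B \<Longrightarrow> dim_col A = dim_col B \<Longrightarrow>
   (A - B) * C = A * C - B * (C :: complex mat)"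
  by (rule minus_mult_distrib_mat[of A "dim_row A" "dim_col A" B C "dim_col C"]) auto

lemma mat_mult_smult: "dim_col A = dim_row B \<Longrightarrow> A * (c \<cdot>\<^sub>m B) = c \<cdot>\<^sub>m (A * (B :: complex mat))"
  by (rule mult_smult_distrib[of A "dim_row A" "dim_col A" B "dim_col B"]) auto

lemma mat_smult_mult: "dim_col A = dim_row B \<Longrightarrow> (c \<cdot>\<^sub>m A) * B = c \<cdot>\<^sub>m (A * (B :: complex mat))"
  by (rule mult_smult_assoc_mat[of A "dim_row A" "dim_col A" B "dim_col B"]) auto

lemmas mat_distribs = mat_distrib_left mat_distrib_right mat_minus_distrib_left
  mat_minus_distrib_right mat_mult_smult mat_smult_mult
  mat_adjoint_mult mat_adjoint_add mat_adjoint_minus mat_adjoint_smult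

lemma mat_mult_cancel_left:
  assumes "B * A = 1\<^sub>m n" "dim_row X = n" "dim_col A = n" "dim_col B = dim_row A"
  shows "B * (A * X) = (X :: complex mat)"
proof -
  have "B * (A * X) = (B * A) * X"
    by (rule mat_assoc[symmetric]) (use assms in auto)
  then show ?thesis
    using assms left_mult_one_mat[of X n "dim_col X"] by (metis carrier_matI)
qed

lemma mat_mult_one_left: "dim_row X = n \<Longrightarrow> 1\<^sub>m n * X = (X :: complex mat)"
  and mat_mult_one_right: "dim_col X = n \<Longrightarrow> X * 1\<^sub>m n = (X :: complex mat)"
  by (metis carrier_matI left_mult_one_mat) (metis carrier_matI right_mult_one_mat)

subsection \<open>Traces\<close>

lemma mtrace_mult:
  "dim_col A = dim_row B \<Longrightarrow> dim_col B = dim_row A \<Longrightarrow>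
   mtrace (A * B) = (\<Sum>i<dim_row A. \<Sum>k<dim_col A. A $$ (i, k) * B $$ (k, i))"
  by (auto simp: mtrace_def mat_mult_index simp del: index_mult_mat(1) intro!: sum.cong)

lemma mtrace_mult_commute:
  assumes "dim_col A = dim_row B" "dim_col B = dim_row A"
  shows "mtrace (A * B) = mtrace (B * A)"
  unfolding mtrace_mult[OF assms] mtrace_mult[OF assms(2,1)]
  using assms by (subst sum.swap) (auto simp: mult.commute)

lemma mtrace_add:
  "dim_row A = dim_row B \<Longrightarrow> dim_col B = dim_row B \<Longrightarrow> mtrace (A + B) = mtrace A + mtrace B"
  by (auto simp: mtrace_def sum.distrib)

lemma mtrace_minus:
  "dim_row A = dim_row B \<Longrightarrow> dim_col B = dim_row B \<Longrightarrow> mtrace (A - B) = mtrace A - mtrace B"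
  by (auto simp: mtrace_def sum_subtractf)

lemma mtrace_smult: "dim_col A = dim_row A \<Longrightarrow> mtrace (c \<cdot>\<^sub>m A) = c * mtrace A"
  by (auto simp: mtrace_def sum_distrib_left)

lemma mtrace_adjoint: "dim_col A = dim_row A \<Longrightarrow> mtrace (mat_adjoint A) = cnj (mtrace A)"
  by (auto simp: mtrace_def)

lemma msum_dim [simp]: "dim_row (msum n k X I) = n" "dim_col (msum n k X I) = k"
  by (auto simp: msum_def)

lemma msum_index [simp]: "i < n \<Longrightarrow> j < k \<Longrightarrow> msum n k X I $$ (i, j) = (\<Sum>l\<in>I. X l $$ (i, j))"
  by (auto simp: msum_def)

lemma mtrace_msum: "(\<And>i. i \<in> I \<Longrightarrow> dim_row (X i) = n) \<Longrightarrow> mtrace (msum n n X I) = (\<Sum>i\<in>I. mtrace (X i))"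
  by (auto simp: mtrace_def intro!: sum.swap[THEN trans])

lemma mult_msum:
  assumes "dim_col A = n" "\<And>i. i \<in> I \<Longrightarrow> X i \<in> carrier_mat n k"
  shows "A * msum n k X I = msum (dim_row A) k (\<lambda>i. A * X i) I"
proof (rule eq_matI)
  fix r c assume "r < dim_row (msum (dim_row A) k (\<lambda>i. A * X i) I)"
    "c < dim_col (msum (dim_row A) k (\<lambda>i. A * X i) I)"
  then have rc: "r < dim_row A" "c < k" by auto
  have "(A * msum n k X I) $$ (r, c) = (\<Sum>l<n. \<Sum>i\<in>I. A $$ (r, l) * X i $$ (l, c))"
    using rc assms by (auto simp: mat_mult_index sum_distrib_left simp del: index_mult_mat(1))
  also have "\<dots> = (\<Sum>i\<in>I. (A * X i) $$ (r, c))"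
    using rc assms
    by (subst sum.swap) (force simp: mat_mult_index simp del: index_mult_mat(1) intro!: sum.cong)
  finally show "(A * msum n k X I) $$ (r, c) = msum (dim_row A) k (\<lambda>i. A * X i) I $$ (r, c)"
    using rc by auto
qed (use assms in auto)

lemma msum_mult:
  assumes "dim_row A = k" "\<And>i. i \<in> I \<Longrightarrow> X i \<in> carrier_mat n k"
  shows "msum n k X I * A = msum n (dim_col A) (\<lambda>i. X i * A) I"
proof (rule eq_matI)
  fix r c assume "r < dim_row (msum n (dim_col A) (\<lambda>i. X i * A) I)"
    "c < dim_col (msum n (dim_col A) (\<lambda>i. X i * A) I)"
  then have rc: "r < n" "c < dim_col A" by auto
  have "(msum n k X I * A) $$ (r, c) = (\<Sum>l<k. \<Sum>i\<in>I. X i $$ (r, l) * A $$ (l, c))"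
    using rc assms by (auto simp: mat_mult_index sum_distrib_right simp del: index_mult_mat(1))
  also have "\<dots> = (\<Sum>i\<in>I. (X i * A) $$ (r, c))"
    using rc assms
    by (subst sum.swap) (force simp: mat_mult_index simp del: index_mult_mat(1) intro!: sum.cong)
  finally show "(msum n k X I * A) $$ (r, c) = msum n (dim_col A) (\<lambda>i. X i * A) I $$ (r, c)"
    using rc by auto
qed (use assms in auto)

lemma msum_cong: "(\<And>i. i \<in> I \<Longrightarrow> X i = Y i) \<Longrightarrow> msum n k X I = msum n k Y I"
  by (rule eq_matI) auto

subsection \<open>The sesquilinear trace form of a Hermitian matrix\<close>

text \<open>A real inner product on matrices, weighted by \<open>S\<close> and summed over rows
  (degenerate if \<open>S\<close> is only semidefinite). The terms of the objective, the power
  constraints and the second-order remainders are all instances, so one Cauchy-Schwarz inequality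
  serves them all.\<close>

definition hform :: "complex mat \<Rightarrow> complex mat \<Rightarrow> complex mat \<Rightarrow> real" where
  "hform S X Y = Re (mtrace (X * S * mat_adjoint Y))"

lemma hermitian_matD:
  assumes "hermitian_mat n A"
  shows "mat_adjoint A = A" "A \<in> carrier_mat n n" "dim_row A = n" "dim_col A = n"
  using assms by (auto simp: hermitian_mat_def)

lemma psd_hermitian: "psd_mat n A \<Longrightarrow> hermitian_mat n A"
  and pd_hermitian: "pd_mat n A \<Longrightarrow> hermitian_mat n A"
  by (auto simp: psd_mat_def pd_mat_def)

lemma hform_commute:
  assumes "hermitian_mat n S" "X \<in> carrier_mat m n" "Y \<in> carrier_mat m n"
  shows "hform S X Y = hform S Y X"
proof -
  have "mat_adjoint (X * S * mat_adjoint Y) = Y * S * mat_adjoint X"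
    using assms hermitian_matD[OF assms(1)] by (simp add: mat_adjoint_mult mat_assoc)
  then show ?thesis
    using assms mtrace_adjoint[of "X * S * mat_adjoint Y"]
    by (auto simp: hform_def)
qed

lemma hform_add_left:
  assumes "S \<in> carrier_mat n n" "X \<in> carrier_mat m n" "X' \<in> carrier_mat m n" "Y \<in> carrier_mat m n"
  shows "hform S (X + X') Y = hform S X Y + hform S X' Y"
  using assms by (auto simp: hform_def mat_distribs mtrace_add)

lemma hform_add_right:
  assumes "S \<in> carrier_mat n n" "X \<in> carrier_mat m n" "Y' \<in> carrier_mat m n" "Y \<in> carrier_mat m n"
  shows "hform S X (Y + Y') = hform S X Y + hform S X Y'"
  using assms by (auto simp: hform_def mat_distribs mtrace_add)

lemma hform_smult_left:
  assumes "S \<in> carrier_mat n n" "X \<in> carrier_mat m n" "Y \<in> carrier_mat m n"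
  shows "hform S (complex_of_real t \<cdot>\<^sub>m X) Y = t * hform S X Y"
  using assms by (auto simp: hform_def mat_distribs mtrace_smult)

lemma hform_smult_right:
  assumes "S \<in> carrier_mat n n" "X \<in> carrier_mat m n" "Y \<in> carrier_mat m n"
  shows "hform S X (complex_of_real t \<cdot>\<^sub>m Y) = t * hform S X Y"
  using assms by (auto simp: hform_def mat_distribs mtrace_smult)

lemma hform_add_self:
  assumes "hermitian_mat n S" "X \<in> carrier_mat m n" "Y \<in> carrier_mat m n"
  shows "hform S (X + Y) (X + Y) = hform S X X + 2 * hform S X Y + hform S Y Y"
  using assms hermitian_matD(2)[OF assms(1)]
  by (simp add: hform_add_left[where m = m and n = n] hform_add_right[where m = m and n = n]
      hform_commute[of n S Y m X])

text \<open>A row \<open>x\<close> enters as \<open>x S x\<close>-adjoint, while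
  \<open>\<bullet>c\<close> conjugates its second argument; the two agree for the conjugated row,
  which is why conjugates appear below.\<close>

lemma quadratic_form_index:
  fixes X S :: "complex mat"
  assumes "S \<in> carrier_mat n n" "X \<in> carrier_mat m n" "r < m"
  shows "(X * S * mat_adjoint X) $$ (r, r) = (S *\<^sub>v conjugate (row X r)) \<bullet>c conjugate (row X r)"
proof -
  have "(X * S * mat_adjoint X) $$ (r, r) =
    (\<Sum>a<n. X $$ (r, a) * (\<Sum>b<n. S $$ (a, b) * cnj (X $$ (r, b))))"
    using assms by (simp add: mat_mult_index del: index_mult_mat(1))
  also have "\<dots> = (S *\<^sub>v conjugate (row X r)) \<bullet>c conjugate (row X r)"
    using assms by (auto simp: scalar_prod_def atLeast0LessThan intro!: sum.cong)
  finally show ?thesis .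
qed

lemma hform_self:
  assumes "S \<in> carrier_mat n n" "X \<in> carrier_mat m n"
  shows "hform S X X = (\<Sum>r<m. Re ((S *\<^sub>v conjugate (row X r)) \<bullet>c conjugate (row X r)))"
  using assms quadratic_form_index[OF assms]
  by (auto simp: hform_def mtrace_def simp del: index_mult_mat(1) intro!: sum.cong)

lemma conjugate_row_carrier: "X \<in> carrier_mat m n \<Longrightarrow> conjugate (row X r) \<in> carrier_vec n"
  by (intro carrier_vecI) auto

lemma psd_matD: "psd_mat n A \<Longrightarrow> v \<in> carrier_vec n \<Longrightarrow> 0 \<le> Re ((A *\<^sub>v v) \<bullet>c v)"
  and pd_matD: "pd_mat n A \<Longrightarrow> v \<in> carrier_vec n \<Longrightarrow> v \<noteq> 0\<^sub>v n \<Longrightarrow> 0 < Re ((A *\<^sub>v v) \<bullet>c v)"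
  by (auto simp: psd_mat_def pd_mat_def)

lemma hform_nonneg:
  assumes "psd_mat n S" "X \<in> carrier_mat m n"
  shows "0 \<le> hform S X X"
  using psd_matD[OF assms(1) conjugate_row_carrier[OF assms(2)]]
    hermitian_matD(2)[OF psd_hermitian[OF assms(1)]] assms(2)
  by (simp only: hform_self sum_nonneg)

lemma pd_imp_psd:
  fixes A :: "complex mat"
  assumes "pd_mat n A"
  shows "psd_mat n A"
  unfolding psd_mat_def
proof (intro conjI ballI pd_hermitian[OF assms])
  fix v :: "complex Matrix.vec"
  assume v: "v \<in> carrier_vec n"
  show "0 \<le> Re ((A *\<^sub>v v) \<bullet>c v)"
  proof (cases "v = 0\<^sub>v n")
    case True
    then show ?thesis using hermitian_matD[OF pd_hermitian[OF assms]] by auto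
  next
    case False
    then show ?thesis using pd_matD[OF assms v] by simp
  qed
qed

lemma hform_pos:
  assumes "pd_mat n S" "X \<in> carrier_mat m n" "X \<noteq> 0\<^sub>m m n"
  shows "0 < hform S X X"
proof -
  obtain r c where rc: "r < m" "c < n" "X $$ (r, c) \<noteq> 0"
    using assms(2,3) by (metis carrier_matD eq_matI index_zero_mat(1) index_zero_mat(2) index_zero_mat(3))
  have "conjugate (row X r) $ c \<noteq> 0\<^sub>v n $ c"
    using rc assms by auto
  then have "conjugate (row X r) \<noteq> 0\<^sub>v n" by metis
  from pd_matD[OF assms(1) conjugate_row_carrier[OF assms(2)] this]
    psd_matD[OF pd_imp_psd[OF assms(1)] conjugate_row_carrier[OF assms(2)]]
  have "0 < (\<Sum>r<m. Re ((S *\<^sub>v conjugate (row X r)) \<bullet>c conjugate (row X r)))"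
    using rc by (intro sum_pos2[of _ r]) auto
  then show ?thesis
    using assms hermitian_matD[OF pd_hermitian[OF assms(1)]]
    by (subst hform_self) auto
qed

text \<open>The discriminant argument: the form at \<open>X + t Y\<close> is a nonnegative quadratic
  polynomial in \<open>t\<close>. It has to cover degenerate forms, where the leading coefficient
  \<open>c\<close> may vanish although \<open>Y\<close> does not; then nonnegativity for all
  \<open>t\<close> forces the linear coefficient to vanish.\<close>

lemma hform_Cauchy_Schwarz:
  assumes "psd_mat n S" "X \<in> carrier_mat m n" "Y \<in> carrier_mat m n"
  shows "\<bar>hform S X Y\<bar> \<le> sqrt (hform S X X * hform S Y Y)"
proof -
  define a b c where "a = hform S X X" and "b = hform S X Y" and "c = hform S Y Y"
  have S: "hermitian_mat n S" "S \<in> carrier_mat n n"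
    using psd_hermitian[OF assms(1)] hermitian_matD by auto
  have ac: "0 \<le> a" "0 \<le> c"
    using assms hform_nonneg by (auto simp: a_def c_def)
  have quad: "0 \<le> a + 2 * t * b + t\<^sup>2 * c" for t
  proof -
    have "0 \<le> hform S (X + complex_of_real t \<cdot>\<^sub>m Y) (X + complex_of_real t \<cdot>\<^sub>m Y)"
      using assms by (intro hform_nonneg[of n]) auto
    also have "\<dots> = a + 2 * t * b + t\<^sup>2 * c"
      using assms S
      by (simp add: hform_add_self[where m = m and n = n] hform_smult_left[where m = m and n = n]
          hform_smult_right[where m = m and n = n] a_def b_def c_def power2_eq_square)
    finally show ?thesis .
  qed
  have "b\<^sup>2 \<le> a * c"
  proof (cases "c = 0")
    case True
    have "b = 0"
    proof (rule ccontr)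
      assume "b \<noteq> 0"
      \<comment> \<open>With \<open>c = 0\<close> this choice of \<open>t\<close> gives the
        polynomial the value \<open>-1\<close>.\<close>
      then show False
        using quad[of "- (a + 1) / (2 * b)"] True by (simp add: field_simps)
    qed
    then show ?thesis using ac by simp
  next
    case False
    then show ?thesis
      using quad[of "- b / c"] ac by (simp add: field_simps power2_eq_square)
  qed
  then show ?thesis
    unfolding a_def[symmetric] b_def[symmetric] c_def[symmetric]
    by (metis real_sqrt_abs real_sqrt_le_mono)
qed

lemma hform_one_self:
  assumes "X \<in> carrier_mat m n"
  shows "hform (1\<^sub>m n) X X = (\<Sum>r<m. \<Sum>c<n. (cmod (X $$ (r, c)))\<^sup>2)"
proof -
  have "X * 1\<^sub>m n * mat_adjoint X = X * mat_adjoint X"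
    using assms by (simp add: mat_mult_one_right)
  moreover have "Re (z * cnj z) = (cmod z)\<^sup>2" for z
    by (simp add: complex_norm_square[symmetric] del: of_real_power)
  ultimately show ?thesis
    using assms by (simp add: hform_def mtrace_mult)
qed

text \<open>Encodes a vector as a one-row matrix, so that definiteness can be checked through
  \<open>hform\<close> with matrix algebra alone; this is the content of \<open>psd_matI\<close> and
  \<open>pd_matI\<close>.\<close>

lemma quadratic_form_row:
  fixes S :: "complex mat"
  assumes "S \<in> carrier_mat n n" "v \<in> carrier_vec n"
  defines "X \<equiv> Matrix.mat 1 n (\<lambda>(_, j). cnj (v $ j))"
  shows "Re ((S *\<^sub>v v) \<bullet>c v) = hform S X X" "X \<in> carrier_mat 1 n" "X = 0\<^sub>m 1 n \<longleftrightarrow> v = 0\<^sub>v n"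
proof -
  show X: "X \<in> carrier_mat 1 n" by (auto simp: X_def)
  have "conjugate (row X 0) = v"
    using assms(2) by (auto simp: X_def)
  then show "Re ((S *\<^sub>v v) \<bullet>c v) = hform S X X"
    using hform_self[OF assms(1) X] by simp
  show "X = 0\<^sub>m 1 n \<longleftrightarrow> v = 0\<^sub>v n"
  proof
    assume "X = 0\<^sub>m 1 n"
    then have "X $$ (0, j) = 0" if "j < n" for j using that by simp
    then show "v = 0\<^sub>v n" using assms(2) by (auto simp: X_def)
  next
    assume "v = 0\<^sub>v n"
    then show "X = 0\<^sub>m 1 n" by (auto simp: X_def)
  qed
qed

lemma psd_matI:
  assumes "hermitian_mat n S" "\<And>X. X \<in> carrier_mat 1 n \<Longrightarrow> 0 \<le> hform S X X"
  shows "psd_mat n S"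
  using assms quadratic_form_row[OF hermitian_matD(2)[OF assms(1)]]
  by (auto simp: psd_mat_def)

lemma pd_matI:
  assumes "hermitian_mat n S" "\<And>X. X \<in> carrier_mat 1 n \<Longrightarrow> X \<noteq> 0\<^sub>m 1 n \<Longrightarrow> 0 < hform S X X"
  shows "pd_mat n S"
  using assms quadratic_form_row[OF hermitian_matD(2)[OF assms(1)]]
  by (auto simp: pd_mat_def)

lemma psd_mult_adjoint:
  assumes "Q \<in> carrier_mat n n"
  shows "psd_mat n (Q * mat_adjoint Q)"
proof (rule psd_matI)
  show "hermitian_mat n (Q * mat_adjoint Q)"
    using assms by (auto simp: hermitian_mat_def mat_adjoint_mult)
  fix X :: "complex mat"
  assume X: "X \<in> carrier_mat 1 n"
  have "hform (Q * mat_adjoint Q) X X = hform (1\<^sub>m n) (X * Q) (X * Q)"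
    using assms X by (simp add: hform_def mat_assoc mat_adjoint_mult mat_mult_one_left)
  also have "\<dots> \<ge> 0"
    using assms X by (subst hform_one_self) (auto intro!: sum_nonneg simp del: index_mult_mat(1))
  finally show "0 \<le> hform (Q * mat_adjoint Q) X X" .
qed

subsection \<open>Diagonalization of Hermitian matrices\<close>

lemma mat_diag_dims [simp]: "dim_row (mat_diag n d) = n" "dim_col (mat_diag n d) = n"
  by (auto simp: mat_diag_def)

lemma mat_adjoint_diag: "mat_adjoint (mat_diag n d :: complex mat) = mat_diag n (\<lambda>k. cnj (d k))"
  by (rule eq_matI) (auto simp: mat_diag_def)

lemma unitary_diag_index:
  assumes "U \<in> carrier_mat n n" "i < n" "j < n"
  shows "(U * mat_diag n d * mat_adjoint U) $$ (i, j) = (\<Sum>k<n. U $$ (i, k) * d k * cnj (U $$ (j, k)))"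
  using assms
  by (subst mat_mult_index) (auto simp: mat_diag_mult_right[of U n n d] intro!: sum.cong)

lemma unitary_first_column:
  fixes v :: "complex Matrix.vec"
  assumes v: "v \<in> carrier_vec n" and v0: "v \<noteq> 0\<^sub>v n"
  obtains W c where "W \<in> carrier_mat n n" "mat_adjoint W * W = 1\<^sub>m n"
    "\<And>i. i < n \<Longrightarrow> W $$ (i, 0) = c * v $ i"
proof -
  interpret cof_vec_space n "TYPE(complex)" .
  define b where "b = basis_completion v"
  define ws where "ws = gram_schmidt n b"
  from basis_completion[OF v v0, folded b_def]
  have dist_b: "distinct b" and indep: "\<not> lin_dep (set b)" and b: "set b \<subseteq> carrier_vec n"
    and hdb: "hd b = v" and len_b: "length b = n" by auto
  have n: "n \<noteq> 0" using v v0 by (auto intro: eq_vecI)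
  from hdb len_b n obtain vs where bv: "b = v # vs" by (cases b) auto
  from gram_schmidt_result[OF b dist_b indep refl, folded ws_def]
  have ws: "set ws \<subseteq> carrier_vec n" "corthogonal ws" "length ws = n" by (auto simp: len_b)
  from gram_schmidt_hd[OF v, of vs, folded bv] have hdws: "hd ws = v" unfolding ws_def .
  have wsc: "ws ! j \<in> carrier_vec n" if "j < n" for j using ws that by auto
  have w0: "ws ! 0 = v" using hdws ws n by (cases ws) auto
  define N where "N j = (\<Sum>k<n. (cmod (ws ! j $ k))\<^sup>2)" for j
  have prod: "ws ! i \<bullet>c ws ! j = (\<Sum>k<n. ws ! i $ k * cnj (ws ! j $ k))" if "i < n" "j < n" for i j
    using wsc[OF that(1)] wsc[OF that(2)] by (auto simp: scalar_prod_def atLeast0LessThan)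
  have self: "ws ! j \<bullet>c ws ! j = complex_of_real (N j)" if "j < n" for j
    using prod[OF that that] by (simp add: N_def complex_norm_square del: of_real_power)
  have orth: "(ws ! i \<bullet>c ws ! j = 0) = (i \<noteq> j)" if "i < n" "j < n" for i j
    using corthogonalD[OF ws(2)] ws(3) that by auto
  have Npos: "0 < N j" if "j < n" for j
  proof -
    have "N j \<noteq> 0" using self[OF that] orth[OF that that] by auto
    moreover have "0 \<le> N j" by (auto simp: N_def intro!: sum_nonneg)
    ultimately show ?thesis by simp
  qed
  \<comment> \<open>The orthogonalized vectors are pairwise orthogonal but not of unit length;
    \<open>N j\<close> is the squared length of the \<open>j\<close>-th.\<close>
  define W where "W = Matrix.mat n n (\<lambda>(i, j). ws ! j $ i / complex_of_real (sqrt (N j)))"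
  have W: "W \<in> carrier_mat n n" by (auto simp: W_def)
  have "mat_adjoint W * W = 1\<^sub>m n"
  proof (rule eq_matI)
    fix i j assume "i < dim_row (1\<^sub>m n :: complex mat)" "j < dim_col (1\<^sub>m n :: complex mat)"
    then have ij: "i < n" "j < n" by auto
    have "(mat_adjoint W * W) $$ (i, j) =
      (\<Sum>k<n. cnj (ws ! i $ k / complex_of_real (sqrt (N i))) * (ws ! j $ k / complex_of_real (sqrt (N j))))"
      using W ij by (subst mat_mult_index) (auto simp: W_def intro!: sum.cong)
    also have "\<dots> = (ws ! j \<bullet>c ws ! i) / (complex_of_real (sqrt (N i)) * complex_of_real (sqrt (N j)))"
      by (simp add: prod[OF ij(2,1)] sum_divide_distrib mult_ac)
    also have "\<dots> = (1\<^sub>m n) $$ (i, j)"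
    proof (cases "i = j")
      case True
      then show ?thesis
        using ij Npos[of i] self[of i]
        by (simp add: of_real_mult[symmetric] del: of_real_mult)
    next
      case False
      then show ?thesis using orth[OF ij(2,1)] ij by simp
    qed
    finally show "(mat_adjoint W * W) $$ (i, j) = (1\<^sub>m n) $$ (i, j)" .
  qed (use W in auto)
  moreover have "W $$ (i, 0) = (1 / complex_of_real (sqrt (N 0))) * v $ i" if "i < n" for i
    using that n w0 by (simp add: W_def)
  ultimately show thesis using that W by blast
qed

lemma unitary_right_inverse:
  "U \<in> carrier_mat n n \<Longrightarrow> mat_adjoint U * U = 1\<^sub>m n \<Longrightarrow> U * mat_adjoint U = 1\<^sub>m n" for U :: "complex mat"
  using mat_mult_left_right_inverse[of "mat_adjoint U" n U] by auto

lemma eigenvector_exists: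
  fixes A :: "complex mat"
  assumes "A \<in> carrier_mat n n" "n \<noteq> 0"
  obtains v e where "v \<in> carrier_vec n" "v \<noteq> 0\<^sub>v n" "A *\<^sub>v v = e \<cdot>\<^sub>v v"
proof -
  have "degree (char_poly A) \<noteq> 0"
    using degree_monic_char_poly[OF assms(1)] assms(2) by simp
  then obtain e where "poly (char_poly A) e = 0"
    using fundamental_theorem_of_algebra[of "char_poly A"] constant_degree[of "char_poly A"] by auto
  then have "eigenvalue A e"
    using eigenvalue_root_char_poly[OF assms(1)] by simp
  then show thesis
    using that assms unfolding eigenvalue_def eigenvector_def by auto
qed

text \<open>Deflation: in a unitary basis that begins with an eigenvector, the matrix splits into a
  1-by-1 block and a smaller Hermitian block, to which induction applies. That the diagonal is real
  is derived in \<open>psd_square_root_exists\<close>.\<close>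

theorem hermitian_diagonalization:
  assumes "hermitian_mat n A"
  shows "\<exists>U d. U \<in> carrier_mat n n \<and> mat_adjoint U * U = 1\<^sub>m n \<and> A = U * mat_diag n d * mat_adjoint U"
  using assms
proof (induction n arbitrary: A)
  case 0
  have "A = 1\<^sub>m 0 * mat_diag 0 (\<lambda>_. 0) * mat_adjoint (1\<^sub>m 0)"
    using hermitian_matD[OF 0] by (intro eq_matI) auto
  then show ?case
    by (intro exI[of _ "1\<^sub>m 0"] exI[of _ "\<lambda>_. 0"]) auto
next
  case (Suc n A)
  note A = hermitian_matD[OF Suc.prems]
  obtain v e where v: "v \<in> carrier_vec (Suc n)" "v \<noteq> 0\<^sub>v (Suc n)" "A *\<^sub>v v = e \<cdot>\<^sub>v v"
    using eigenvector_exists[OF A(2)] by auto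
  obtain W c where W: "W \<in> carrier_mat (Suc n) (Suc n)" "mat_adjoint W * W = 1\<^sub>m (Suc n)"
    and W0: "\<And>i. i < Suc n \<Longrightarrow> W $$ (i, 0) = c * v $ i"
    using unitary_first_column[OF v(1,2)] by blast
  have dW: "dim_row W = Suc n" "dim_col W = Suc n" using W(1) by auto
  have WW: "W * mat_adjoint W = 1\<^sub>m (Suc n)" using unitary_right_inverse W by blast
  define B where "B = mat_adjoint W * (A * W)"
  have B: "B \<in> carrier_mat (Suc n) (Suc n)" using A W by (auto simp: B_def)
  have adjB: "mat_adjoint B = B" using A dW by (simp add: B_def mat_adjoint_mult mat_assoc)
  have AW0: "(A * W) $$ (i, 0) = e * W $$ (i, 0)" if i: "i < Suc n" for i
  proof -
    have "(A * W) $$ (i, 0) = (\<Sum>k<Suc n. A $$ (i, k) * (c * v $ k))"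
      using A dW i W0 by (subst mat_mult_index) (auto intro!: sum.cong simp del: sum.lessThan_Suc)
    also have "\<dots> = c * (A *\<^sub>v v) $ i"
      using A i v(1) by (simp add: scalar_prod_def atLeast0LessThan sum_distrib_left mult_ac del: sum.lessThan_Suc)
    finally show ?thesis using v i W0 by simp
  qed
  have B0: "B $$ (i, 0) = (if i = 0 then e else 0)" if i: "i < Suc n" for i
  proof -
    have "B $$ (i, 0) = (\<Sum>k<Suc n. mat_adjoint W $$ (i, k) * (e * W $$ (k, 0)))"
      unfolding B_def using A dW i AW0
      by (subst mat_mult_index) (auto intro!: sum.cong simp del: sum.lessThan_Suc index_mult_mat(1) mat_adjoint_index)
    also have "\<dots> = e * (mat_adjoint W * W) $$ (i, 0)"
      using dW i by (subst mat_mult_index) (auto simp: sum_distrib_left mult_ac simp del: sum.lessThan_Suc)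
    finally show ?thesis using i by (simp add: W(2))
  qed
  \<comment> \<open>The first column of \<open>B\<close> is known because it comes from an
    eigenvector; hermiticity transfers this to the first row and makes \<open>e\<close>
    real.\<close>
  have B0': "B $$ (0, i) = (if i = 0 then e else 0)" if i: "i < Suc n" for i
  proof -
    have "B $$ (0, i) = cnj (B $$ (i, 0))"
      using B i by (subst adjB[symmetric]) simp
    moreover have "cnj e = e"
      using B0[of 0] B adjB mat_adjoint_index[of 0 B 0] by simp
    ultimately show ?thesis using B0[OF i] by simp
  qed
  define B' where "B' = Matrix.mat n n (\<lambda>(i, j). B $$ (Suc i, Suc j))"
  have "mat_adjoint B' = B'"
  proof (rule eq_matI)
    fix i j assume "i < dim_row B'" "j < dim_col B'"
    then have "i < n" "j < n" by (auto simp: B'_def)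
    then show "mat_adjoint B' $$ (i, j) = B' $$ (i, j)"
      using mat_adjoint_index[of "Suc i" B "Suc j"] adjB B by (simp add: B'_def)
  qed (auto simp: B'_def)
  then have "hermitian_mat n B'" by (auto simp: hermitian_mat_def B'_def)
  then obtain U' d' where U': "U' \<in> carrier_mat n n" "mat_adjoint U' * U' = 1\<^sub>m n"
    and B'eq: "B' = U' * mat_diag n d' * mat_adjoint U'"
    using Suc.IH by blast
  \<comment> \<open>The unitary matrix of the smaller block, bordered by \<open>1\<close> in the
    corner; \<open>d\<close> puts \<open>e\<close> in front of the smaller diagonal.\<close>
  define V where "V = Matrix.mat (Suc n) (Suc n)
    (\<lambda>(i, j). if i = 0 \<or> j = 0 then (if i = j then 1 else 0) else U' $$ (i - 1, j - 1))"
  define d where "d k = (if k = 0 then e else d' (k - 1))" for k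
  have V: "V \<in> carrier_mat (Suc n) (Suc n)" by (auto simp: V_def)
  have dV: "dim_row V = Suc n" "dim_col V = Suc n" by (auto simp: V_def)
  have VV: "mat_adjoint V * V = 1\<^sub>m (Suc n)"
  proof (rule eq_matI)
    fix i j assume "i < dim_row (1\<^sub>m (Suc n) :: complex mat)" "j < dim_col (1\<^sub>m (Suc n) :: complex mat)"
    then have ij: "i < Suc n" "j < Suc n" by auto
    have "(mat_adjoint V * V) $$ (i, j) = (\<Sum>k<Suc n. cnj (V $$ (k, i)) * V $$ (k, j))"
      using dV ij by (subst mat_mult_index) (auto intro!: sum.cong simp del: sum.lessThan_Suc)
    also have "\<dots> = (if i = 0 \<or> j = 0 then (if i = j then 1 else 0)
        else (\<Sum>k<n. cnj (U' $$ (k, i - 1)) * U' $$ (k, j - 1)))"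
      using ij by (subst sum.lessThan_Suc_shift) (auto simp: V_def)
    also have "\<dots> = (if i = 0 \<or> j = 0 then (if i = j then 1 else 0)
        else (mat_adjoint U' * U') $$ (i - 1, j - 1))"
      using ij U'(1) by (auto simp: mat_mult_index simp del: index_mult_mat(1) intro!: sum.cong)
    also have "\<dots> = (1\<^sub>m (Suc n)) $$ (i, j)"
      using ij by (auto simp: U'(2))
    finally show "(mat_adjoint V * V) $$ (i, j) = (1\<^sub>m (Suc n)) $$ (i, j)" .
  qed (auto simp: dV)
  have Beq: "B = V * mat_diag (Suc n) d * mat_adjoint V"
  proof (rule eq_matI)
    fix i j assume "i < dim_row (V * mat_diag (Suc n) d * mat_adjoint V)"
      "j < dim_col (V * mat_diag (Suc n) d * mat_adjoint V)"
    then have ij: "i < Suc n" "j < Suc n" by (auto simp: dV)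
    have "(V * mat_diag (Suc n) d * mat_adjoint V) $$ (i, j) =
        V $$ (i, 0) * e * cnj (V $$ (j, 0)) + (\<Sum>k<n. V $$ (i, Suc k) * d' k * cnj (V $$ (j, Suc k)))"
      by (subst unitary_diag_index[OF V ij], subst sum.lessThan_Suc_shift) (simp add: d_def)
    also have "\<dots> = (if i = 0 \<or> j = 0 then (if i = j then e else 0)
        else (\<Sum>k<n. U' $$ (i - 1, k) * d' k * cnj (U' $$ (j - 1, k))))"
      using ij by (auto simp: V_def)
    also have "\<dots> = (if i = 0 \<or> j = 0 then (if i = j then e else 0) else B' $$ (i - 1, j - 1))"
      using ij unitary_diag_index[OF U'(1), of "i - 1" "j - 1" d'] by (auto simp: B'eq simp del: index_mult_mat(1))
    also have "\<dots> = B $$ (i, j)"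
      using ij B0[of i] B0'[of j] by (auto simp: B'_def)
    finally show "B $$ (i, j) = (V * mat_diag (Suc n) d * mat_adjoint V) $$ (i, j)" by simp
  qed (use B in \<open>auto simp: dV\<close>)
  define U where "U = W * V"
  have "U \<in> carrier_mat (Suc n) (Suc n)" using W V by (auto simp: U_def)
  moreover have "mat_adjoint U * U = mat_adjoint V * ((mat_adjoint W * W) * V)"
    using dV dW by (simp add: U_def mat_adjoint_mult mat_assoc)
  then have "mat_adjoint U * U = 1\<^sub>m (Suc n)"
    using dV by (simp add: W(2) mat_mult_one_left VV)
  moreover have "U * mat_diag (Suc n) d * mat_adjoint U = W * (B * mat_adjoint W)"
    unfolding Beq using dV dW by (simp add: U_def mat_adjoint_mult mat_assoc)
  moreover have "W * (B * mat_adjoint W) = (W * mat_adjoint W) * (A * (W * mat_adjoint W))"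
    using dW A by (simp add: B_def mat_assoc)
  then have "W * (B * mat_adjoint W) = A"
    using A by (simp add: WW mat_mult_one_left mat_mult_one_right)
  ultimately show ?case by metis
qed

subsection \<open>Inverses and square roots\<close>

text \<open>A right inverse of a square matrix is two-sided, so \<open>A\<close> is a unit and
  \<open>mat_inverse\<close> returns a value; \<open>minv\<close> then is the actual inverse and not
  the unspecified value of \<open>the None\<close>.\<close>

lemma minv_inverse:
  assumes "A \<in> carrier_mat n n" "B \<in> carrier_mat n n" "A * B = 1\<^sub>m n"
  shows "minv A \<in> carrier_mat n n" "A * minv A = 1\<^sub>m n" "minv A * A = 1\<^sub>m n"
proof -
  have "B * A = 1\<^sub>m n" using mat_mult_left_right_inverse[OF assms] .
  then have "A \<in> Units (ring_mat TYPE(complex) n ())"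
    using assms by (auto simp: Units_def ring_mat_def)
  then obtain C where "mat_inverse A = Some C"
    using mat_inverse(1)[OF assms(1), of "()"] by (cases "mat_inverse A") auto
  then show "minv A \<in> carrier_mat n n" "A * minv A = 1\<^sub>m n" "minv A * A = 1\<^sub>m n"
    using mat_inverse(2)[OF assms(1)] by (auto simp: minv_def)
qed

lemma minv_unique:
  assumes "A \<in> carrier_mat n n" "B \<in> carrier_mat n n" "A * B = 1\<^sub>m n"
  shows "minv A = B"
proof -
  note A = minv_inverse[OF assms]
  have "minv A = minv A * (A * B)"
    using A(1) assms(3) by (simp add: mat_mult_one_right)
  also have "\<dots> = B"
    by (rule mat_mult_cancel_left[OF A(3)]) (use A(1) assms in auto)
  finally show ?thesis .
qed

text \<open>A kernel vector would make the quadratic form zero, so the determinant cannot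
  vanish.\<close>

lemma pd_minv:
  assumes "pd_mat n A"
  shows "minv A \<in> carrier_mat n n" "A * minv A = 1\<^sub>m n" "minv A * A = 1\<^sub>m n"
proof -
  have A: "A \<in> carrier_mat n n" using hermitian_matD[OF pd_hermitian[OF assms]] by simp
  have "Determinant.det A \<noteq> 0"
  proof
    assume "Determinant.det A = 0"
    then obtain v where v: "v \<in> carrier_vec n" "v \<noteq> 0\<^sub>v n" "A *\<^sub>v v = 0\<^sub>v n"
      using det_0_iff_vec_prod_zero_field[OF A] by auto
    then show False using pd_matD[OF assms v(1,2)] by auto
  qed
  from det_non_zero_imp_unit[OF A this, of "()"]
  obtain B where "B \<in> carrier_mat n n" "A * B = 1\<^sub>m n"
    by (auto simp: Units_def ring_mat_def)
  from minv_inverse[OF A this]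
  show "minv A \<in> carrier_mat n n" "A * minv A = 1\<^sub>m n" "minv A * A = 1\<^sub>m n" .
qed

lemma psd_square_root_exists:
  assumes "psd_mat n A"
  shows "\<exists>R. psd_mat n R \<and> R * R = A"
proof -
  note A = hermitian_matD[OF psd_hermitian[OF assms]]
  obtain U d where U: "U \<in> carrier_mat n n" "mat_adjoint U * U = 1\<^sub>m n"
    and Aeq: "A = U * mat_diag n d * mat_adjoint U"
    using hermitian_diagonalization[OF psd_hermitian[OF assms]] by blast
  have dU: "dim_row U = n" "dim_col U = n" using U(1) by auto
  define P where "P = mat_adjoint U * A * U"
  have "P = (mat_adjoint U * U) * (mat_diag n d * (mat_adjoint U * U))"
    unfolding P_def Aeq using dU by (simp add: mat_assoc)
  then have P: "P = mat_diag n d"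
    by (simp add: U(2) mat_mult_one_left mat_mult_one_right)
  have adjP: "mat_adjoint P = P"
    using dU A by (simp add: P_def mat_adjoint_mult mat_assoc)
  have d: "d k = complex_of_real (Re (d k))" "0 \<le> Re (d k)" if k: "k < n" for k
  proof -
    have "cnj (d k) = d k"
      using arg_cong[OF adjP, of "\<lambda>X. X $$ (k, k)"] k unfolding P
      by (simp add: mat_adjoint_diag) (simp add: mat_diag_def)
    then show "d k = complex_of_real (Re (d k))"
      by (metis Reals_cnj_iff of_real_Re)
    \<comment> \<open>The \<open>k\<close>-th diagonal entry is the quadratic form of
      \<open>A\<close> at the \<open>k\<close>-th column of \<open>U\<close>, hence
      nonnegative.\<close>
    have "P $$ (k, k) = (A *\<^sub>v conjugate (row (mat_adjoint U) k)) \<bullet>c conjugate (row (mat_adjoint U) k)"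
      unfolding P_def using quadratic_form_index[OF A(2), of "mat_adjoint U" n k] U(1) k by simp
    moreover have "0 \<le> Re \<dots>"
      by (rule psd_matD[OF assms conjugate_row_carrier[of _ n]]) (use U(1) in auto)
    ultimately show "0 \<le> Re (d k)" using k unfolding P by (simp add: mat_diag_def)
  qed
  \<comment> \<open>Fourth roots: with \<open>Q = U diag(s)\<close>, the product of \<open>Q\<close>
    and its adjoint carries the square roots of the eigenvalues and is visibly positive semidefinite
    by \<open>psd_mult_adjoint\<close>.\<close>
  define s where "s k = complex_of_real (sqrt (sqrt (Re (d k))))" for k
  define Q where "Q = U * mat_diag n s"
  have Q: "Q \<in> carrier_mat n n" using U(1) by (auto simp: Q_def)
  have s4: "s k * s k * (s k * s k) = d k" if "k < n" for k
    using d(2)[OF that] by (subst d(1)[OF that]) (simp add: s_def of_real_mult[symmetric] del: of_real_mult)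
  have adjQ: "mat_adjoint Q = mat_diag n s * mat_adjoint U"
    using dU by (simp add: Q_def mat_adjoint_mult mat_adjoint_diag s_def[abs_def])
  have "Q * mat_adjoint Q * (Q * mat_adjoint Q) =
      U * (mat_diag n s * (mat_diag n s * ((mat_adjoint U * U) * (mat_diag n s * (mat_diag n s * mat_adjoint U)))))"
    unfolding adjQ using dU by (simp add: Q_def mat_assoc)
  also have "\<dots> = U * (mat_diag n s * mat_diag n s * (mat_diag n s * mat_diag n s)) * mat_adjoint U"
    using dU by (simp add: U(2) mat_mult_one_left mat_assoc del: mat_diag_diag)
  also have "mat_diag n s * mat_diag n s * (mat_diag n s * mat_diag n s) = mat_diag n d"
    unfolding mat_diag_diag using s4 by (intro eq_matI) (auto simp: mat_diag_def)
  finally show ?thesis using psd_mult_adjoint[OF Q] Aeq by auto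
qed

text \<open>For \<open>D = R - S\<close> one has \<open>R D + D S = R\<^sup>2 - S\<^sup>2 = 0\<close>, so the two nonnegative numbers
  \<open>tr (D R D)\<close> and \<open>tr (D S D)\<close> add up to \<open>0\<close>.\<close>

lemma pd_square_root_unique:
  assumes "pd_mat n A" "psd_mat n R" "R * R = A" "psd_mat n S" "S * S = A"
  shows "R = S"
proof -
  note R = hermitian_matD[OF psd_hermitian[OF assms(2)]]
  note S = hermitian_matD[OF psd_hermitian[OF assms(4)]]
  define D where "D = R - S"
  have D: "D \<in> carrier_mat n n" "mat_adjoint D = D"
    using R S by (auto simp: D_def mat_adjoint_minus)
  have dD: "dim_row D = n" "dim_col D = n" using D by auto
  have "mtrace (D * S * D) = mtrace (D * (D * S))"
    using mtrace_mult_commute[of "D * S" D] dD S by (simp add: mat_assoc)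
  then have "hform R D D + hform S D D = Re (mtrace (D * (R * D + D * S)))"
    using R S dD by (simp add: hform_def D(2) mat_distribs mtrace_add mat_assoc)
  also have "R * D + D * S = 0\<^sub>m n n"
  proof -
    have "R * D + D * S = (A - R * S) + (R * S - A)"
      unfolding D_def using R S assms(3,5) by (simp add: mat_distribs)
    also have "\<dots> = 0\<^sub>m n n"
      using R S assms(3)[symmetric] by (intro eq_matI) auto
    finally show ?thesis .
  qed
  finally have "hform R D D + hform S D D = 0"
    using dD by (simp add: mtrace_def)
  then have R0: "hform R D D = 0"
    using hform_nonneg[OF assms(2) D(1)] hform_nonneg[OF assms(4) D(1)] by simp
  \<comment> \<open>Vanishing of the form of \<open>R\<close> at \<open>D\<close> is weaker than
    \<open>D = 0\<close>. Cauchy-Schwarz for \<open>R\<close> transfers it to the definite form of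
    \<open>A = R * R\<close>.\<close>
  have "hform A D D = hform R D (D * R)"
    using dD R by (simp add: hform_def mat_distribs mat_assoc flip: assms(3))
  also have "\<bar>\<dots>\<bar> \<le> sqrt (hform R D D * hform R (D * R) (D * R))"
    using hform_Cauchy_Schwarz[OF assms(2) D(1), of "D * R"] D R by auto
  finally have "\<not> 0 < hform A D D" using R0 by simp
  then have "D = 0\<^sub>m n n" using hform_pos[OF assms(1) D(1)] by blast
  then have "R $$ (i, j) - S $$ (i, j) = 0" if "i < n" "j < n" for i j
    using that R S by (metis D_def index_minus_mat(1) index_zero_mat(1))
  then show ?thesis using R S by (intro eq_matI) auto
qed

text \<open>Existence and uniqueness of the positive semidefinite root give the description in
  \<open>msqrt\<close> its meaning. The root \<open>R\<close> is invertible because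
  \<open>R * (R * minv A)\<close> is the identity.\<close>

lemma minv_sqrt_pd:
  assumes "pd_mat n A"
  shows "minv_sqrt A \<in> carrier_mat n n" "mat_adjoint (minv_sqrt A) = minv_sqrt A"
    "minv_sqrt A * (A * minv_sqrt A) = 1\<^sub>m n" "msqrt A \<in> carrier_mat n n"
    "msqrt A * minv_sqrt A = 1\<^sub>m n" "minv_sqrt A * msqrt A = 1\<^sub>m n" "msqrt A * msqrt A = A"
    "mat_adjoint (msqrt A) = msqrt A"
proof -
  define W where "W = minv_sqrt A"
  define R where "R = msqrt A"
  note A = hermitian_matD[OF pd_hermitian[OF assms]]
  have "\<exists>!R. psd_mat n R \<and> R * R = A"
    using psd_square_root_exists[OF pd_imp_psd[OF assms]] pd_square_root_unique[OF assms] by blast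
  from theI'[OF this] have R: "psd_mat n R" "R * R = A"
    using A by (auto simp: msqrt_def R_def)
  note R' = hermitian_matD[OF psd_hermitian[OF R(1)]]
  have "R * (R * minv A) = A * minv A"
    using R R' pd_minv[OF assms] by (simp add: mat_assoc[symmetric])
  also have "\<dots> = 1\<^sub>m n" using pd_minv[OF assms] by simp
  finally have "R * (R * minv A) = 1\<^sub>m n" .
  from minv_inverse[OF R'(2) _ this]
  have W: "W \<in> carrier_mat n n" "R * W = 1\<^sub>m n" "W * R = 1\<^sub>m n"
    using pd_minv[OF assms] R' by (auto simp: W_def minv_sqrt_def R_def)
  \<comment> \<open>The adjoint of \<open>W\<close> inverts the Hermitian \<open>R\<close> too, so
    uniqueness of inverses makes \<open>W\<close> Hermitian.\<close>
  have "R * mat_adjoint W = mat_adjoint (W * R)"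
    using W(1) R' mat_adjoint_mult[of W R] by simp
  then have "R * mat_adjoint W = 1\<^sub>m n" by (simp add: W(3))
  from minv_unique[OF R'(2) _ this] W
  have adj: "mat_adjoint W = W" by (simp add: W_def minv_sqrt_def R_def)
  have "W * (A * W) = (W * R) * (R * W)"
    using W(1) R' by (simp add: R(2)[symmetric] mat_assoc)
  then have "W * (A * W) = 1\<^sub>m n" using W by simp
  with W adj R R' show "minv_sqrt A \<in> carrier_mat n n" "mat_adjoint (minv_sqrt A) = minv_sqrt A"
    "minv_sqrt A * (A * minv_sqrt A) = 1\<^sub>m n" "msqrt A \<in> carrier_mat n n"
    "msqrt A * minv_sqrt A = 1\<^sub>m n" "minv_sqrt A * msqrt A = 1\<^sub>m n" "msqrt A * msqrt A = A"
    "mat_adjoint (msqrt A) = msqrt A"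
    by (auto simp: W_def R_def)
qed

text \<open>\<open>A * X\<close> and \<open>A * Y\<close> are Hermitian projections onto the same
  range, hence equal; likewise \<open>X * A\<close> and \<open>Y * A\<close>. Then
  \<open>X = X A X = Y A Y = Y\<close>.\<close>

lemma pseudo_inverse_unique:
  assumes "is_pseudo_inverse A X" "is_pseudo_inverse A Y"
  shows "X = Y"
proof -
  have dims: "dim_row X = dim_col A" "dim_col X = dim_row A" "dim_row Y = dim_col A" "dim_col Y = dim_row A"
    using assms by (auto simp: is_pseudo_inverse_def)
  have X: "A * (X * A) = A" "X * (A * X) = X" "mat_adjoint (A * X) = A * X" "mat_adjoint (X * A) = X * A"
    and Y: "A * (Y * A) = A" "Y * (A * Y) = Y" "mat_adjoint (A * Y) = A * Y" "mat_adjoint (Y * A) = Y * A"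
    using assms dims by (auto simp: is_pseudo_inverse_def mat_assoc)
  have "A * X = mat_adjoint ((A * (Y * A)) * X)" using X Y by simp
  also have "\<dots> = mat_adjoint ((A * Y) * (A * X))" using dims by (simp add: mat_assoc)
  also have "\<dots> = (A * X) * (A * Y)" using dims X Y mat_adjoint_mult[of "A * Y" "A * X"] by simp
  also have "\<dots> = (A * (X * A)) * Y" using dims by (simp add: mat_assoc)
  finally have AX: "A * X = A * Y" using X by simp
  have "X * A = mat_adjoint (X * (A * (Y * A)))" using X Y by simp
  also have "\<dots> = mat_adjoint ((X * A) * (Y * A))" using dims by (simp add: mat_assoc)
  also have "\<dots> = (Y * A) * (X * A)" using dims X Y mat_adjoint_mult[of "X * A" "Y * A"] by simp
  also have "\<dots> = Y * (A * (X * A))" using dims by (simp add: mat_assoc)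
  finally have XA: "X * A = Y * A" using X by simp
  have "X = (X * A) * X" using X(2) dims by (simp add: mat_assoc)
  also have "\<dots> = Y * (A * X)" using dims by (simp add: XA mat_assoc)
  also have "\<dots> = Y" using Y by (simp add: AX)
  finally show ?thesis .
qed

lemma pseudo_inverse_eqI: "is_pseudo_inverse A X \<Longrightarrow> pseudo_inverse A = X"
  unfolding pseudo_inverse_def using pseudo_inverse_unique by blast

section \<open>Kronecker products and column stacking\<close>

text \<open>In column stacking, position \<open>k\<close> holds row \<open>k mod a\<close> of column
  \<open>k div a\<close>; summing over positions is summing over entries.\<close>

lemma sum_div_mod:
  fixes g :: "nat \<Rightarrow> nat \<Rightarrow> complex"
  shows "(\<Sum>k<b * a. g (k mod a) (k div a)) = (\<Sum>c<b. \<Sum>r<a. g r c)"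
proof -
  have less: "c * a + r < b * a" if "c < b" "r < a" for c r :: nat
  proof -
    have "c * a + r < Suc c * a" using that by simp
    also have "\<dots> \<le> b * a" using that by (intro mult_right_mono) auto
    finally show ?thesis .
  qed
  have mod: "k mod a < a" if "k < b * a" for k :: nat using that by (cases a) auto
  have "(\<Sum>k<b * a. g (k mod a) (k div a)) = (\<Sum>(c, r)\<in>{..<b} \<times> {..<a}. g r c)"
    by (rule sum.reindex_bij_witness[of _ "\<lambda>(c, r). c * a + r" "\<lambda>k. (k div a, k mod a)"])
      (auto simp: less less_mult_imp_div_less mod)
  then show ?thesis by (simp add: sum.cartesian_product)
qed

lemma div_mod_less:
  fixes k a b :: nat
  assumes "k < a * b"
  shows "k mod a < a" "k div a < b"
  using assms less_mult_imp_div_less[of k b a] by (cases a; simp add: mult.commute)+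

lemma kron_dim [simp]: "dim_row (kron A B) = dim_row A * dim_row B" "dim_col (kron A B) = dim_col A * dim_col B"
  by (auto simp: kron_def)

lemma kron_index:
  "r < dim_row A * dim_row B \<Longrightarrow> c < dim_col A * dim_col B \<Longrightarrow> kron A B $$ (r, c) =
     A $$ (r div dim_row B, c div dim_col B) * B $$ (r mod dim_row B, c mod dim_col B)"
  by (simp add: kron_def)

lemma vec_of_mat_dim [simp]: "dim_vec (vec_of_mat A) = dim_row A * dim_col A"
  by (auto simp: vec_of_mat_def)

lemma vec_of_mat_carrier: "A \<in> carrier_mat n m \<Longrightarrow> vec_of_mat A \<in> carrier_vec (n * m)"
  by (intro carrier_vecI) auto

lemma vec_of_mat_index:
  "k < dim_row A * dim_col A \<Longrightarrow> vec_of_mat A $ k = A $$ (k mod dim_row A, k div dim_row A)"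
  by (auto simp: vec_of_mat_def)

text \<open>The identity by which the vectorized quantities of the update are translated back into
  matrix products.\<close>

lemma kron_mult_vec:
  assumes "X \<in> carrier_mat n m" "P \<in> carrier_mat a n" "Q \<in> carrier_mat m b"
  shows "kron (transpose_mat Q) P *\<^sub>v vec_of_mat X = vec_of_mat (P * X * Q)"
proof (rule eq_vecI)
  fix k assume "k < dim_vec (vec_of_mat (P * X * Q))"
  then have k: "k < a * b" using assms by simp
  then have k': "k < b * a" by (simp add: mult.commute)
  note kd = div_mod_less[OF k]
  have "(kron (transpose_mat Q) P *\<^sub>v vec_of_mat X) $ k =
      (\<Sum>l<m * n. kron (transpose_mat Q) P $$ (k, l) * vec_of_mat X $ l)"
    using assms k' by (simp add: scalar_prod_def atLeast0LessThan mult.commute[of n m])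
  also have "\<dots> = (\<Sum>l<m * n. Q $$ (l div n, k div a) * P $$ (k mod a, l mod n) * X $$ (l mod n, l div n))"
  proof (rule sum.cong[OF refl])
    fix l assume l: "l \<in> {..<m * n}"
    then have "l < n * m" by (simp add: mult.commute)
    from div_mod_less[OF this] this l
    show "kron (transpose_mat Q) P $$ (k, l) * vec_of_mat X $ l =
        Q $$ (l div n, k div a) * P $$ (k mod a, l mod n) * X $$ (l mod n, l div n)"
      using assms k' kd by (simp add: kron_index vec_of_mat_index)
  qed
  also have "\<dots> = (\<Sum>c<m. \<Sum>r<n. Q $$ (c, k div a) * P $$ (k mod a, r) * X $$ (r, c))"
    by (rule sum_div_mod)
  also have "\<dots> = (\<Sum>c<m. (P * X) $$ (k mod a, c) * Q $$ (c, k div a))"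
    using assms kd by (simp add: mat_mult_index sum_distrib_left mult_ac del: index_mult_mat(1))
  also have "\<dots> = ((P * X) * Q) $$ (k mod a, k div a)"
    using assms kd by (subst (2) mat_mult_index) (auto simp del: index_mult_mat(1))
  also have "\<dots> = vec_of_mat (P * X * Q) $ k"
    using assms k by (subst vec_of_mat_index) auto
  finally show "(kron (transpose_mat Q) P *\<^sub>v vec_of_mat X) $ k = vec_of_mat (P * X * Q) $ k" .
qed (use assms in \<open>simp add: mult.commute\<close>)

lemma kron_adjoint: "mat_adjoint (kron A B) = kron (mat_adjoint A) (mat_adjoint B)"
proof (rule eq_matI)
  fix r c assume "r < dim_row (kron (mat_adjoint A) (mat_adjoint B))"
    "c < dim_col (kron (mat_adjoint A) (mat_adjoint B))"
  then have rc: "r < dim_col A * dim_col B" "c < dim_row A * dim_row B" by auto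
  then have "r < dim_col B * dim_col A" "c < dim_row B * dim_row A" by (simp_all add: mult.commute)
  from div_mod_less[OF this(1)] div_mod_less[OF this(2)]
  show "mat_adjoint (kron A B) $$ (r, c) = kron (mat_adjoint A) (mat_adjoint B) $$ (r, c)"
    using rc by (simp add: kron_index)
qed auto

lemma adjoint_transpose: "mat_adjoint (transpose_mat A :: complex mat) = transpose_mat (mat_adjoint A)"
  by (rule eq_matI) auto

lemma index_less_mult:
  fixes c m n r :: nat
  assumes "r < n" "c < m"
  shows "c * n + r < n * m"
proof -
  have "c * n + r < Suc c * n" using assms by simp
  also have "\<dots> \<le> m * n" using assms by (intro mult_right_mono) auto
  finally show ?thesis by (simp add: mult.commute)
qed

lemma vec_of_mat_inject:
  assumes "A \<in> carrier_mat n m" "B \<in> carrier_mat n m" "vec_of_mat A = vec_of_mat B"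
  shows "A = B"
proof (rule eq_matI)
  fix r c assume "r < dim_row B" "c < dim_col B"
  then have rc: "r < n" "c < m" using assms by auto
  have "vec_of_mat A $ (c * n + r) = vec_of_mat B $ (c * n + r)" by (simp add: assms(3))
  then show "A $$ (r, c) = B $$ (r, c)"
    using assms(1,2) rc index_less_mult[OF rc] by (simp add: vec_of_mat_index)
qed (use assms in auto)

lemma vec_of_mat_surj:
  assumes "v \<in> carrier_vec (n * m)"
  obtains X where "X \<in> carrier_mat n m" "vec_of_mat X = v"
proof
  let ?X = "Matrix.mat n m (\<lambda>(r, c). v $ (c * n + r))"
  show "?X \<in> carrier_mat n m" by simp
  show "vec_of_mat ?X = v"
    using assms by (intro eq_vecI) (auto simp: vec_of_mat_index div_mod_less)
qed

lemma vec_of_mat_add: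
  "A \<in> carrier_mat n m \<Longrightarrow> B \<in> carrier_mat n m \<Longrightarrow> vec_of_mat (A + B) = vec_of_mat A + vec_of_mat B"
  by (rule eq_vecI) (auto simp: vec_of_mat_index div_mod_less)

lemma vec_of_mat_minus:
  "A \<in> carrier_mat n m \<Longrightarrow> B \<in> carrier_mat n m \<Longrightarrow> vec_of_mat (A - B) = vec_of_mat A - vec_of_mat B"
  by (rule eq_vecI) (auto simp: vec_of_mat_index div_mod_less)

lemma vec_of_mat_smult: "vec_of_mat (c \<cdot>\<^sub>m A) = c \<cdot>\<^sub>v vec_of_mat A"
  by (rule eq_vecI) (auto simp: vec_of_mat_index div_mod_less)

lemma vec_of_mat_zero: "vec_of_mat (0\<^sub>m n m) = 0\<^sub>v (n * m)"
  by (rule eq_vecI) (auto simp: vec_of_mat_index div_mod_less)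

lemma vec_of_mat_msum:
  assumes "finite I" "\<And>i. i \<in> I \<Longrightarrow> X i \<in> carrier_mat n m"
  shows "finsum_vec TYPE(complex) (n * m) (\<lambda>i. vec_of_mat (X i)) I = vec_of_mat (msum n m X I)"
proof (rule eq_vecI)
  have c: "(\<lambda>i. vec_of_mat (X i)) \<in> I \<rightarrow> carrier_vec (n * m)"
    using vec_of_mat_carrier assms(2) by blast
  show "dim_vec (finsum_vec TYPE(complex) (n * m) (\<lambda>i. vec_of_mat (X i)) I) = dim_vec (vec_of_mat (msum n m X I))"
    using finsum_vec_closed[OF c] by auto
  fix k assume "k < dim_vec (vec_of_mat (msum n m X I))"
  then have k: "k < n * m" by simp
  show "finsum_vec TYPE(complex) (n * m) (\<lambda>i. vec_of_mat (X i)) I $ k = vec_of_mat (msum n m X I) $ k"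
    using index_finsum_vec[OF assms(1) k c] k carrier_matD[OF assms(2)]
    by (simp add: vec_of_mat_index div_mod_less)
qed

lemma vec_of_mat_inner:
  assumes "A \<in> carrier_mat n m" "B \<in> carrier_mat n m"
  shows "vec_of_mat A \<bullet>c vec_of_mat B = mtrace (A * mat_adjoint B)"
proof -
  have "vec_of_mat A \<bullet>c vec_of_mat B = (\<Sum>k<m * n. A $$ (k mod n, k div n) * cnj (B $$ (k mod n, k div n)))"
    using assms by (auto simp: scalar_prod_def atLeast0LessThan vec_of_mat_index mult.commute intro!: sum.cong)
  also have "\<dots> = (\<Sum>c<m. \<Sum>r<n. A $$ (r, c) * cnj (B $$ (r, c)))"
    by (rule sum_div_mod)
  also have "\<dots> = mtrace (A * mat_adjoint B)"
    using assms by (subst sum.swap) (simp add: mtrace_mult)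
  finally show ?thesis .
qed

text \<open>At the stacking of \<open>X\<close> the quadratic form is \<open>hform T X X\<close>,
  that is, the transmit power when \<open>T\<close> is a transmit covariance.\<close>

lemma kron_transpose_one_pd:
  assumes "pd_mat m T"
  shows "pd_mat (m * n) (kron (transpose_mat T) (1\<^sub>m n))"
  unfolding pd_mat_def
proof (intro conjI ballI impI)
  note T = hermitian_matD[OF pd_hermitian[OF assms]]
  show "hermitian_mat (m * n) (kron (transpose_mat T) (1\<^sub>m n))"
    using T by (auto simp: hermitian_mat_def kron_adjoint adjoint_transpose intro!: carrier_matI)
  fix v :: "complex Matrix.vec"
  assume v: "v \<in> carrier_vec (m * n)" "v \<noteq> 0\<^sub>v (m * n)"
  obtain X where X: "X \<in> carrier_mat n m" "vec_of_mat X = v"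
    using vec_of_mat_surj[of v n m] v(1) by (auto simp: mult.commute)
  have "X \<noteq> 0\<^sub>m n m"
    using v(2) X(2) vec_of_mat_zero by (auto simp: mult.commute)
  then have "0 < hform T X X" by (rule hform_pos[OF assms X(1)])
  moreover have "kron (transpose_mat T) (1\<^sub>m n) *\<^sub>v v = vec_of_mat (X * T)"
    using kron_mult_vec[OF X(1) one_carrier_mat T(2)] X by simp
  then have "(kron (transpose_mat T) (1\<^sub>m n) *\<^sub>v v) \<bullet>c v = mtrace (X * T * mat_adjoint X)"
    using vec_of_mat_inner[of "X * T" n m X] X T by auto
  ultimately show "0 < Re ((kron (transpose_mat T) (1\<^sub>m n) *\<^sub>v v) \<bullet>c v)"
    by (simp add: hform_def)
qed

section \<open>The trust-region subproblem\<close>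

lemma cscalar_prod_adjoint:
  fixes A :: "complex mat"
  assumes "A \<in> carrier_mat n m" "x \<in> carrier_vec m" "y \<in> carrier_vec n"
  shows "(A *\<^sub>v x) \<bullet>c y = x \<bullet>c (mat_adjoint A *\<^sub>v y)"
proof -
  have "(A *\<^sub>v x) \<bullet>c y = (\<Sum>i<n. \<Sum>j<m. A $$ (i, j) * x $ j * cnj (y $ i))"
    using assms by (simp add: scalar_prod_def atLeast0LessThan sum_distrib_right)
  also have "\<dots> = (\<Sum>j<m. \<Sum>i<n. A $$ (i, j) * x $ j * cnj (y $ i))"
    by (rule sum.swap)
  also have "\<dots> = x \<bullet>c (mat_adjoint A *\<^sub>v y)"
    using assms by (simp add: scalar_prod_def atLeast0LessThan sum_distrib_left mult_ac)
  finally show ?thesis .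
qed

lemma smult_mat_mult_vec:
  "dim_vec x = dim_col A \<Longrightarrow> (c \<cdot>\<^sub>m A) *\<^sub>v x = c \<cdot>\<^sub>v (A *\<^sub>v (x :: complex Matrix.vec))"
  by (rule eq_vecI) (auto simp: scalar_prod_def sum_distrib_left mult_ac)

text \<open>The left-hand side \<open>phi\<close> is nonincreasing for \<open>mu > 0\<close> and
  strictly decreasing from any point where it equals \<open>P > 0\<close>, which gives uniqueness.
  Failure of the first branch's test means that \<open>phi\<close> reaches at least \<open>P\<close>
  near \<open>0\<close>: either through a pole at a zero eigenvalue or because the limit at
  \<open>0\<close> exceeds \<open>P\<close>. For large \<open>mu\<close> it falls to
  \<open>P\<close> or below, and the intermediate value theorem applies.\<close>

lemma secular_equation_unique_solution:
  fixes a lam :: "nat \<Rightarrow> real"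
  assumes P: "0 < P" and r: "r \<le> n" and lam: "\<And>k. k < r \<Longrightarrow> 0 < lam k"
    and lam0: "\<And>k. r \<le> k \<Longrightarrow> k < n \<Longrightarrow> lam k = 0"
    and infeasible: "\<not> ((\<forall>k. r \<le> k \<longrightarrow> k < n \<longrightarrow> a k = 0) \<and> (\<Sum>k<r. (a k)\<^sup>2 / (lam k)\<^sup>2) \<le> P)"
  shows "\<exists>!mu. 0 < mu \<and> (\<Sum>k<n. (a k)\<^sup>2 / (lam k + mu)\<^sup>2) = P"
proof -
  define phi where "phi mu = (\<Sum>k<n. (a k)\<^sup>2 / (lam k + mu)\<^sup>2)" for mu
  have lam_nonneg: "0 \<le> lam k" if "k < n" for k
    using lam lam0 that by (cases "k < r") (auto intro: less_imp_le)
  have pos: "0 < lam k + mu" if "k < n" "0 < mu" for k mu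
    using lam_nonneg[OF that(1)] that(2) by simp
  have term_le: "(a k)\<^sup>2 / (lam k + y)\<^sup>2 \<le> (a k)\<^sup>2 / (lam k + x)\<^sup>2" if "k < n" "0 < x" "x \<le> y" for k x y
    using pos[OF that(1,2)] that by (intro divide_left_mono power_mono mult_pos_pos zero_less_power) auto
  have strict: "phi y < phi x" if xy: "0 < x" "x < y" "phi x = P" for x y
  proof -
    have "\<exists>k<n. a k \<noteq> 0"
    proof (rule ccontr)
      assume "\<not> (\<exists>k<n. a k \<noteq> 0)"
      then have "phi x = 0" by (simp add: phi_def)
      then show False using xy(3) P by simp
    qed
    then obtain k where k: "k < n" "a k \<noteq> 0" by auto
    show ?thesis unfolding phi_def
    proof (rule sum_strict_mono_ex1)
      show "\<forall>k\<in>{..<n}. (a k)\<^sup>2 / (lam k + y)\<^sup>2 \<le> (a k)\<^sup>2 / (lam k + x)\<^sup>2"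
        using term_le xy by auto
      have "(lam k + x)\<^sup>2 < (lam k + y)\<^sup>2"
        using pos[OF k(1) xy(1)] xy(2) by (intro power_strict_mono) auto
      then have "(a k)\<^sup>2 / (lam k + y)\<^sup>2 < (a k)\<^sup>2 / (lam k + x)\<^sup>2"
        using pos[OF k(1) xy(1)] k(2) xy
        by (intro divide_strict_left_mono mult_pos_pos) auto
      then show "\<exists>k\<in>{..<n}. (a k)\<^sup>2 / (lam k + y)\<^sup>2 < (a k)\<^sup>2 / (lam k + x)\<^sup>2"
        using k(1) by auto
    qed auto
  qed
  have small: "\<exists>x>0. P \<le> phi x"
  proof (cases "\<forall>k. r \<le> k \<longrightarrow> k < n \<longrightarrow> a k = 0")
    case False
    then obtain k where k: "r \<le> k" "k < n" "a k \<noteq> 0" by auto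
    \<comment> \<open>Since \<open>lam k = 0\<close>, the single term with index \<open>k\<close>
      equals \<open>P\<close> at this point.\<close>
    define x where "x = \<bar>a k\<bar> / sqrt P"
    have x: "0 < x" using k P by (simp add: x_def)
    have "P = (a k)\<^sup>2 / (lam k + x)\<^sup>2"
      using k P lam0 by (simp add: x_def power_divide)
    also have "\<dots> \<le> phi x"
      unfolding phi_def using k by (intro member_le_sum) auto
    finally show ?thesis using x by auto
  next
    case True
    \<comment> \<open>Only the terms with positive eigenvalue: they are continuous at
      \<open>0\<close>, where the default \<open>x / 0 = 0\<close> would spoil the argument for the
      others.\<close>
    define psi where "psi x = (\<Sum>k<r. (a k)\<^sup>2 / (lam k + x)\<^sup>2)" for x
    have "isCont psi 0"
      unfolding psi_def using lam by (intro continuous_intros) (force dest: lam)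
    moreover have "P < psi 0" using infeasible True by (auto simp: psi_def)
    ultimately have "eventually (\<lambda>x. P < psi x) (at 0)"
      by (intro order_tendstoD(1)[of psi "psi 0"]) (auto simp: isCont_def)
    then have "eventually (\<lambda>x. P < psi x) (at_right 0)"
      by (rule filter_leD[rotated]) (simp add: at_le)
    then have "eventually (\<lambda>x. P < psi x \<and> 0 < x) (at_right 0)"
      by (intro eventually_conj eventually_at_right_less)
    then obtain x where x: "P < psi x" "0 < x"
      using eventually_happens[of _ "at_right (0::real)"] by auto
    have "psi x \<le> phi x"
      unfolding phi_def psi_def using r by (intro sum_mono2) auto
    then show ?thesis using x by (intro exI[of _ x]) auto
  qed
  then obtain x where x: "0 < x" "P \<le> phi x" by auto
  define A where "A = (\<Sum>k<n. (a k)\<^sup>2)"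
  have A: "0 \<le> A" by (auto simp: A_def intro: sum_nonneg)
  \<comment> \<open>Each denominator is at least the square of \<open>y\<close>, so
    \<open>phi y\<close> is at most \<open>A\<close> divided by that square; \<open>y\<close> is
    chosen to make this at most \<open>P\<close>, and to lie to the right of
    \<open>x\<close>.\<close>
  define y where "y = max x (sqrt (A / P))"
  have y: "0 < y" "x \<le> y" using x by (auto simp: y_def)
  have "phi y \<le> (\<Sum>k<n. (a k)\<^sup>2 / y\<^sup>2)"
    unfolding phi_def using y lam_nonneg
    by (intro sum_mono divide_left_mono power_mono mult_pos_pos zero_less_power) (auto intro: add_nonneg_pos)
  also have "\<dots> = A / y\<^sup>2" by (simp add: A_def sum_divide_distrib)
  also have "\<dots> \<le> P"
  proof -
    have "A / P = (sqrt (A / P))\<^sup>2" using A P by simp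
    also have "\<dots> \<le> y\<^sup>2" using A P by (intro power_mono) (auto simp: y_def)
    finally show ?thesis using P y by (simp add: field_simps)
  qed
  finally have "phi y \<le> P" .
  moreover have "\<forall>z. x \<le> z \<and> z \<le> y \<longrightarrow> isCont phi z"
    unfolding phi_def using x(1) lam_nonneg
    by (intro allI impI continuous_intros) (smt (verit) lessThan_iff power_eq_0_iff)
  ultimately obtain mu where "x \<le> mu" "phi mu = P"
    using IVT2[of phi y P x] x(2) y(2) by auto
  with x(1) have mu: "0 < mu" "phi mu = P" by auto
  have "\<exists>!mu. 0 < mu \<and> phi mu = P"
  proof (rule ex1I)
    show "0 < mu \<and> phi mu = P" using mu by simp
    fix nu assume nu: "0 < nu \<and> phi nu = P"
    then show "nu = mu" using strict[of nu mu] strict[of mu nu] mu by (cases nu mu rule: linorder_cases) auto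
  qed
  then show ?thesis by (simp add: phi_def)
qed

text \<open>The two branches of the beamformer update for \<open>min f\<^sup>H Q f - 2 Re (b\<^sup>H f)\<close> subject to
  \<open>f\<^sup>H E f \<le> P\<close> both produce a Karush-Kuhn-Tucker point. Since \<open>x / 0 = 0\<close>, the coordinates of
  \<open>E\<^sup>1\<^sup>/\<^sup>2 f\<close> with respect to \<open>U\<close> are \<open>p\<^sub>k / (lam\<^sub>k + mu)\<close> in both branches.\<close>

lemma trust_region_KKT:
  fixes E Q :: "complex mat" and b f :: "complex Matrix.vec" and P :: real
  defines "W \<equiv> minv_sqrt E"
  defines "M \<equiv> W * Q * W"
  assumes E: "pd_mat n E" and Q: "Q \<in> carrier_mat n n" and b: "b \<in> carrier_vec n" and P: "0 < P"
    and eig: "psd_eigendecomposition n M U lam r"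
    and f: "let pv = mat_adjoint U *\<^sub>v (W *\<^sub>v b)
        in if (\<forall>k. r \<le> k \<longrightarrow> k < n \<longrightarrow> pv $ k = 0) \<and> (\<Sum>k<r. (cmod (pv $ k))\<^sup>2 / (lam k)\<^sup>2) \<le> P
           then f = W *\<^sub>v (pseudo_inverse M *\<^sub>v (W *\<^sub>v b))
           else (let mu = (THE mu::real. 0 < mu \<and> (\<Sum>k<n. (cmod (pv $ k))\<^sup>2 / (lam k + mu)\<^sup>2) = P)
                 in f = minv (Q + complex_of_real mu \<cdot>\<^sub>m E) *\<^sub>v b)"
  shows "\<exists>mu\<ge>0. (Q + complex_of_real mu \<cdot>\<^sub>m E) *\<^sub>v f = b \<and> Re ((E *\<^sub>v f) \<bullet>c f) \<le> P \<and>
           (mu = 0 \<or> Re ((E *\<^sub>v f) \<bullet>c f) = P)"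
proof -
  define R where "R = msqrt E"
  have W: "W \<in> carrier_mat n n" "mat_adjoint W = W" "R * W = 1\<^sub>m n" "W * R = 1\<^sub>m n"
    and R: "R \<in> carrier_mat n n" "R * R = E" "mat_adjoint R = R"
    using minv_sqrt_pd[OF E] by (auto simp: W_def R_def)
  have Ec: "E \<in> carrier_mat n n" using hermitian_matD[OF pd_hermitian[OF E]] by simp
  have U: "U \<in> carrier_mat n n" "mat_adjoint U * U = 1\<^sub>m n" "U * mat_adjoint U = 1\<^sub>m n"
    and Meq: "M = U * mat_diag n (\<lambda>k. complex_of_real (lam k)) * mat_adjoint U"
    and r: "r \<le> n" and lam: "\<And>k. k < r \<Longrightarrow> 0 < lam k" and lam0: "\<And>k. r \<le> k \<Longrightarrow> k < n \<Longrightarrow> lam k = 0"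
    using eig by (auto simp: psd_eigendecomposition_def)
  have dims: "dim_row U = n" "dim_col U = n" "dim_row W = n" "dim_col W = n" "dim_row R = n" "dim_col R = n"
    "dim_row Q = n" "dim_col Q = n" using U W R Q by auto
  have Mc: "M \<in> carrier_mat n n" unfolding M_def using W Q by auto
  have lam_nonneg: "0 \<le> lam k" if "k < n" for k
    using lam lam0 that by (cases "k < r") (auto intro: less_imp_le)
  \<comment> \<open>Functional calculus in the eigenbasis \<open>U\<close>: products, sums and
    adjoints of such matrices act on the spectral values alone, and \<open>M\<close> is one of
    them.\<close>
  define SF where "SF g = U * mat_diag n g * mat_adjoint U" for g :: "nat \<Rightarrow> complex"
  have SFc: "SF g \<in> carrier_mat n n" for g using U by (auto simp: SF_def)
  have SF_mult: "SF g * SF h = SF (\<lambda>k. g k * h k)" for g h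
  proof -
    have "SF g * SF h = U * (mat_diag n g * ((mat_adjoint U * U) * (mat_diag n h * mat_adjoint U)))"
      using dims by (simp add: SF_def mat_assoc)
    also have "\<dots> = U * (mat_diag n g * mat_diag n h) * mat_adjoint U"
      using dims by (simp add: U(2) mat_mult_one_left mat_assoc del: mat_diag_diag)
    finally show ?thesis by (simp add: SF_def)
  qed
  have SF_adj: "mat_adjoint (SF g) = SF (\<lambda>k. cnj (g k))" for g
    using dims by (simp add: SF_def mat_adjoint_mult mat_adjoint_diag mat_assoc)
  have SF_cong: "SF g = SF h" if "\<And>k. k < n \<Longrightarrow> g k = h k" for g h
  proof -
    have "mat_diag n g = mat_diag n h" using that by (intro eq_matI) (auto simp: mat_diag_def)
    then show ?thesis by (simp add: SF_def)
  qed
  have SF_add: "SF g + SF h = SF (\<lambda>k. g k + h k)" for g h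
  proof -
    have "mat_diag n (\<lambda>k. g k + h k) = mat_diag n g + mat_diag n h"
      by (intro eq_matI) (auto simp: mat_diag_def)
    then show ?thesis using dims by (simp add: SF_def mat_distribs)
  qed
  have SF_one: "SF (\<lambda>_. 1) = 1\<^sub>m n" using U by (simp add: SF_def)
  define pv where "pv = mat_adjoint U *\<^sub>v (W *\<^sub>v b)"
  have pv: "pv \<in> carrier_vec n" using U W b by (auto simp: pv_def)
  \<comment> \<open>Used with \<open>mu = 0\<close> for the pseudoinverse branch and with
    \<open>mu > 0\<close> for the other. The premise \<open>cancel\<close> demands that a coordinate
    of \<open>pv\<close> vanish wherever \<open>1 / 0 = 0\<close> stands in for a division.\<close>
  have KKT: "(Q + complex_of_real mu \<cdot>\<^sub>m E) *\<^sub>v f = b \<and>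
      Re ((E *\<^sub>v f) \<bullet>c f) = (\<Sum>k<n. (cmod (pv $ k))\<^sup>2 / (lam k + mu)\<^sup>2)"
    if mu: "0 \<le> mu" and cancel: "\<And>k. k < n \<Longrightarrow> lam k + mu = 0 \<Longrightarrow> pv $ k = 0"
      and feq: "f = W *\<^sub>v (SF (\<lambda>k. 1 / complex_of_real (lam k + mu)) *\<^sub>v (W *\<^sub>v b))" for mu
  proof -
    define z where "z = Matrix.vec n (\<lambda>k. pv $ k / complex_of_real (lam k + mu))"
    have z: "z \<in> carrier_vec n" by (auto simp: z_def)
    have "mat_diag n (\<lambda>k. 1 / complex_of_real (lam k + mu)) *\<^sub>v pv = z"
      using pv by (intro eq_vecI) (auto simp: z_def mat_diag_def scalar_prod_def if_distrib[of "\<lambda>x. x * _"] cong: if_cong)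
    moreover have "SF (\<lambda>k. 1 / complex_of_real (lam k + mu)) *\<^sub>v (W *\<^sub>v b) =
        U *\<^sub>v (mat_diag n (\<lambda>k. 1 / complex_of_real (lam k + mu)) *\<^sub>v pv)"
      unfolding SF_def pv_def using U W b
      by (simp add: assoc_mult_mat_vec[of _ n n _ n])
    ultimately have fz: "f = W *\<^sub>v (U *\<^sub>v z)" using feq by simp
    have Uz: "U *\<^sub>v z \<in> carrier_vec n" using U z by auto
    have Rf: "R *\<^sub>v f = U *\<^sub>v z"
      unfolding fz using R(1) W(1) Uz by (simp add: assoc_mult_mat_vec[symmetric, of _ n n _ n] W(3))
    have fc: "f \<in> carrier_vec n" using fz W Uz by auto
    have Ef: "E *\<^sub>v f = R *\<^sub>v (U *\<^sub>v z)"
      unfolding R(2)[symmetric] using R(1) fc Rf by (simp add: assoc_mult_mat_vec[of _ n n _ n])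
    have "(E *\<^sub>v f) \<bullet>c f = (U *\<^sub>v z) \<bullet>c (R *\<^sub>v f)"
      unfolding Ef using cscalar_prod_adjoint[OF R(1) Uz fc] R(3) by simp
    also have "\<dots> = z \<bullet>c (mat_adjoint U *\<^sub>v (U *\<^sub>v z))"
      unfolding Rf by (rule cscalar_prod_adjoint[OF U(1) z Uz])
    also have "mat_adjoint U *\<^sub>v (U *\<^sub>v z) = z"
      using U z by (simp add: assoc_mult_mat_vec[symmetric, of _ n n _ n])
    also have "z \<bullet>c z = (\<Sum>k<n. z $ k * cnj (z $ k))"
      using z by (simp add: scalar_prod_def atLeast0LessThan)
    finally have "Re ((E *\<^sub>v f) \<bullet>c f) = (\<Sum>k<n. (cmod (z $ k))\<^sup>2)"
      by (simp add: complex_norm_square[symmetric] del: of_real_power)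
    also have "\<dots> = (\<Sum>k<n. (cmod (pv $ k))\<^sup>2 / (lam k + mu)\<^sup>2)"
      by (intro sum.cong refl) (simp add: z_def norm_divide power_divide del: of_real_add)
    finally have power: "Re ((E *\<^sub>v f) \<bullet>c f) = \<dots>" .
    have "Q = (R * W) * (Q * (W * R))"
      using dims by (simp add: W mat_mult_one_left mat_mult_one_right)
    also have "\<dots> = R * (M * R)" unfolding M_def using dims by (simp add: mat_assoc)
    finally have QM: "Q = R * (M * R)" .
    have "(Q + complex_of_real mu \<cdot>\<^sub>m E) *\<^sub>v f = Q *\<^sub>v f + complex_of_real mu \<cdot>\<^sub>v (E *\<^sub>v f)"
      using Q Ec fc by (simp add: add_mult_distrib_mat_vec[of _ n n] smult_mat_mult_vec)
    also have "Q *\<^sub>v f = R *\<^sub>v (M *\<^sub>v (U *\<^sub>v z))"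
      using R(1) Mc fc Rf by (subst QM) (simp add: assoc_mult_mat_vec[of _ n n _ n])
    also have "M *\<^sub>v (U *\<^sub>v z) = U *\<^sub>v (mat_diag n (\<lambda>k. complex_of_real (lam k)) *\<^sub>v ((mat_adjoint U * U) *\<^sub>v z))"
      unfolding Meq using U(1) z by (simp add: assoc_mult_mat_vec[of _ n n _ n])
    also have "\<dots> = U *\<^sub>v (mat_diag n (\<lambda>k. complex_of_real (lam k)) *\<^sub>v z)"
      using z by (simp add: U(2))
    also have "R *\<^sub>v \<dots> + complex_of_real mu \<cdot>\<^sub>v (E *\<^sub>v f) =
        R *\<^sub>v (U *\<^sub>v (mat_diag n (\<lambda>k. complex_of_real (lam k)) *\<^sub>v z + complex_of_real mu \<cdot>\<^sub>v z))"
      unfolding Ef using R(1) U(1) z mult_mat_vec_carrier[OF mat_diag_dim z]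
      by (simp add: mult_add_distrib_mat_vec[of _ n n] mult_mat_vec[of _ n n])
    also have "mat_diag n (\<lambda>k. complex_of_real (lam k)) *\<^sub>v z + complex_of_real mu \<cdot>\<^sub>v z = pv"
    proof (rule eq_vecI)
      fix k assume "k < dim_vec pv"
      then have k: "k < n" using pv by simp
      have "(mat_diag n (\<lambda>k. complex_of_real (lam k)) *\<^sub>v z) $ k = complex_of_real (lam k) * z $ k"
        using k z by (simp add: mat_diag_def scalar_prod_def if_distrib[of "\<lambda>x. x * _"] cong: if_cong)
      then have "(mat_diag n (\<lambda>k. complex_of_real (lam k)) *\<^sub>v z + complex_of_real mu \<cdot>\<^sub>v z) $ k =
          complex_of_real (lam k + mu) * z $ k"
        using k z by (simp add: distrib_right)
      also have "\<dots> = pv $ k"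
        using k cancel[OF k] by (cases "lam k + mu = 0") (simp_all add: z_def del: of_real_add)
      finally show "(mat_diag n (\<lambda>k. complex_of_real (lam k)) *\<^sub>v z + complex_of_real mu \<cdot>\<^sub>v z) $ k = pv $ k" .
    qed (use pv z in auto)
    also have "U *\<^sub>v pv = (U * mat_adjoint U) *\<^sub>v (W *\<^sub>v b)"
      unfolding pv_def using U(1) W(1) b by (intro assoc_mult_mat_vec[of _ n n _ n, symmetric]) auto
    also have "\<dots> = W *\<^sub>v b" using W(1) b by (simp add: U(3))
    also have "R *\<^sub>v (W *\<^sub>v b) = (R * W) *\<^sub>v b"
      using R(1) W(1) b by (intro assoc_mult_mat_vec[of _ n n _ n, symmetric]) auto
    also have "\<dots> = b" using b by (simp add: W(3))
    finally show ?thesis using power by simp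
  qed
  show ?thesis
  proof (cases "(\<forall>k. r \<le> k \<longrightarrow> k < n \<longrightarrow> pv $ k = 0) \<and> (\<Sum>k<r. (cmod (pv $ k))\<^sup>2 / (lam k)\<^sup>2) \<le> P")
    case True
    \<comment> \<open>Because \<open>1 / 0 = 0\<close>, inverting the spectral values leaves zeros
      in place, and the products with \<open>M\<close> are the spectral projection onto the nonzero
      eigenvalues. This is the Moore-Penrose inverse.\<close>
    have "is_pseudo_inverse M (SF (\<lambda>k. 1 / complex_of_real (lam k + 0)))"
      using Mc SFc Meq[folded SF_def] unfolding is_pseudo_inverse_def
      by (auto simp: SF_mult SF_adj carrier_matD[OF SFc] intro!: SF_cong)
    then have "f = W *\<^sub>v (SF (\<lambda>k. 1 / complex_of_real (lam k + 0)) *\<^sub>v (W *\<^sub>v b))"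
      using f True pseudo_inverse_eqI by (simp add: Let_def pv_def[symmetric])
    moreover have "pv $ k = 0" if "k < n" "lam k + 0 = 0" for k
      using that True lam[of k] by (cases "k < r") auto
    ultimately have "(Q + complex_of_real 0 \<cdot>\<^sub>m E) *\<^sub>v f = b \<and>
      Re ((E *\<^sub>v f) \<bullet>c f) = (\<Sum>k<n. (cmod (pv $ k))\<^sup>2 / (lam k + 0)\<^sup>2)"
      by (intro KKT) auto
    moreover have "(\<Sum>k<n. (cmod (pv $ k))\<^sup>2 / (lam k + 0)\<^sup>2) = (\<Sum>k<r. (cmod (pv $ k))\<^sup>2 / (lam k)\<^sup>2)"
      using r True by (intro sum.mono_neutral_cong_right) auto
    ultimately show ?thesis using True by (intro exI[of _ 0]) auto
  next
    case False
    define mu where "mu = (THE mu::real. 0 < mu \<and> (\<Sum>k<n. (cmod (pv $ k))\<^sup>2 / (lam k + mu)\<^sup>2) = P)"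
    have "\<exists>!mu::real. 0 < mu \<and> (\<Sum>k<n. (cmod (pv $ k))\<^sup>2 / (lam k + mu)\<^sup>2) = P"
      using False by (intro secular_equation_unique_solution[OF P r lam lam0]) auto
    from theI'[OF this] have mu: "0 < mu" "(\<Sum>k<n. (cmod (pv $ k))\<^sup>2 / (lam k + mu)\<^sup>2) = P"
      by (auto simp: mu_def)
    have pos: "lam k + mu \<noteq> 0" if "k < n" for k using lam_nonneg[OF that] mu by simp
    define N where "N = SF (\<lambda>k. 1 / complex_of_real (lam k + mu))"
    have N: "N \<in> carrier_mat n n" by (simp add: N_def SFc)
    have MN: "(M + complex_of_real mu \<cdot>\<^sub>m 1\<^sub>m n) * N = 1\<^sub>m n"
    proof -
      have "(M + complex_of_real mu \<cdot>\<^sub>m 1\<^sub>m n) * N = M * N + complex_of_real mu \<cdot>\<^sub>m N"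
        using Mc N by (simp add: mat_distribs mat_mult_one_left)
      also have "complex_of_real mu \<cdot>\<^sub>m N = SF (\<lambda>_. complex_of_real mu) * N"
      proof -
        have "SF (\<lambda>_. complex_of_real mu) = complex_of_real mu \<cdot>\<^sub>m 1\<^sub>m n"
        proof -
          have "mat_diag n (\<lambda>_. complex_of_real mu) = complex_of_real mu \<cdot>\<^sub>m 1\<^sub>m n"
            by (rule eq_matI) (auto simp: mat_diag_def)
          then show ?thesis using dims U(3) by (simp add: SF_def mat_distribs mat_mult_one_right)
        qed
        then show ?thesis using N by (simp add: mat_distribs mat_mult_one_left)
      qed
      also have "M * N + SF (\<lambda>_. complex_of_real mu) * N = 1\<^sub>m n"
      proof -
        have "M * N + SF (\<lambda>_. complex_of_real mu) * N =
            SF (\<lambda>k. complex_of_real (lam k) * (1 / complex_of_real (lam k + mu)))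
            + SF (\<lambda>k. complex_of_real mu * (1 / complex_of_real (lam k + mu)))"
          unfolding N_def Meq[folded SF_def] by (simp add: SF_mult)
        also have "\<dots> = SF (\<lambda>_. 1)"
          unfolding SF_add
        proof (rule SF_cong)
          fix k assume "k < n"
          then have "complex_of_real (lam k + mu) \<noteq> 0" using pos by (metis of_real_eq_0_iff)
          then show "complex_of_real (lam k) * (1 / complex_of_real (lam k + mu))
              + complex_of_real mu * (1 / complex_of_real (lam k + mu)) = 1"
            by (simp add: add_divide_distrib[symmetric])
        qed
        finally show ?thesis by (simp add: SF_one)
      qed
      finally show ?thesis .
    qed
    \<comment> \<open>By congruence \<open>Q + mu E\<close> is \<open>R (M + mu 1) R\<close>; since
      \<open>R\<close> and \<open>W\<close> invert each other, its inverse is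
      \<open>W N W\<close>.\<close>
    have "(Q + complex_of_real mu \<cdot>\<^sub>m E) * (W * (N * W)) = 1\<^sub>m n"
    proof -
      have "Q + complex_of_real mu \<cdot>\<^sub>m E = R * ((M + complex_of_real mu \<cdot>\<^sub>m 1\<^sub>m n) * R)"
      proof -
        have "(R * W) * (Q * (W * R)) = R * (M * R)" unfolding M_def using dims by (simp add: mat_assoc)
        then have "Q = R * (M * R)"
          using dims by (simp add: W mat_mult_one_left mat_mult_one_right)
        then show ?thesis
          using dims Mc R(2) by (simp add: mat_distribs mat_mult_one_left)
      qed
      then have "(Q + complex_of_real mu \<cdot>\<^sub>m E) * (W * (N * W)) =
          R * ((M + complex_of_real mu \<cdot>\<^sub>m 1\<^sub>m n) * ((R * W) * (N * W)))"
        using dims Mc N by (simp add: mat_assoc)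
      also have "\<dots> = R * (((M + complex_of_real mu \<cdot>\<^sub>m 1\<^sub>m n) * N) * W)"
        using dims Mc N by (simp add: W(3) mat_mult_one_left mat_assoc)
      also have "\<dots> = 1\<^sub>m n" using dims by (simp only: MN mat_mult_one_left W(3))
      finally show ?thesis .
    qed
    then have "minv (Q + complex_of_real mu \<cdot>\<^sub>m E) = W * (N * W)"
      using Q Ec W N by (intro minv_unique[of _ n]) auto
    then have "f = W *\<^sub>v (N *\<^sub>v (W *\<^sub>v b))"
      using f False W(1) N b by (auto simp: Let_def pv_def[symmetric] mu_def[symmetric] assoc_mult_mat_vec[of _ n n _ n])
    then have "(Q + complex_of_real mu \<cdot>\<^sub>m E) *\<^sub>v f = b \<and>
      Re ((E *\<^sub>v f) \<bullet>c f) = (\<Sum>k<n. (cmod (pv $ k))\<^sup>2 / (lam k + mu)\<^sup>2)"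
      using mu(1) pos by (intro KKT) (auto simp: N_def)
    then show ?thesis using mu by (intro exI[of _ mu]) auto
  qed
qed

section \<open>The mean square error as a quadratic function\<close>

locale bf_setting =
  fixes p :: bf_problem
  assumes valid: "valid_problem p"
    and pd_assm: "\<And>i. i \<in> {1..nL p} \<Longrightarrow>
      pd_mat (nJ p i) (Kmat p i * Sigs p * mat_adjoint (Kmat p i)) \<or> pd_mat (nJ p i) (Sig p i)"
begin

declare One_nat_def [simp del]

definition shaped :: "(nat \<Rightarrow> complex mat) \<Rightarrow> bool" where
  "shaped F \<longleftrightarrow> (\<forall>i\<in>{1..nL p}. F i \<in> carrier_mat (nN p i) (nJ p i))"

lemma Sigs_psd: "psd_mat (nK p) (Sigs p)" and noise_pos: "0 < noise p"
  using valid by (auto simp: valid_problem_def)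

lemma block_facts:
  assumes "i \<in> {1..nL p}"
  shows "Kmat p i \<in> carrier_mat (nJ p i) (nK p)" "Hmat p i \<in> carrier_mat (nM p) (nN p i)"
    "psd_mat (nJ p i) (Sig p i)" "0 < budget p i"
  using valid assms by (auto simp: valid_problem_def)

lemma Sigs_facts: "Sigs p \<in> carrier_mat (nK p) (nK p)" "mat_adjoint (Sigs p) = Sigs p"
  and Sigs_dim [simp]: "dim_row (Sigs p) = nK p" "dim_col (Sigs p) = nK p"
  using hermitian_matD[OF psd_hermitian[OF Sigs_psd]] by auto

lemma block_dim [simp]:
  assumes "i \<in> {1..nL p}"
  shows "dim_row (Kmat p i) = nJ p i" "dim_col (Kmat p i) = nK p"
    "dim_row (Hmat p i) = nM p" "dim_col (Hmat p i) = nN p i"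
    "dim_row (Sig p i) = nJ p i" "dim_col (Sig p i) = nJ p i"
  using block_facts[OF assms] hermitian_matD[OF psd_hermitian[OF block_facts(3)[OF assms]]] by auto

lemma Sig_facts:
  assumes "i \<in> {1..nL p}"
  shows "Sig p i \<in> carrier_mat (nJ p i) (nJ p i)" "mat_adjoint (Sig p i) = Sig p i"
  using hermitian_matD[OF psd_hermitian[OF block_facts(3)[OF assms]]] by auto

lemma shaped_dim:
  assumes "shaped F" "i \<in> {1..nL p}"
  shows "F i \<in> carrier_mat (nN p i) (nJ p i)" "dim_row (F i) = nN p i" "dim_col (F i) = nJ p i"
  using assms by (auto simp: shaped_def)

lemma shaped_upd: "shaped F \<Longrightarrow> Y \<in> carrier_mat (nN p i) (nJ p i) \<Longrightarrow> shaped (F(i := Y))"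
  by (auto simp: shaped_def)

lemma Smat_dim [simp]: "dim_row (Smat p F) = nM p" "dim_col (Smat p F) = nK p"
  by (auto simp: Smat_def)

text \<open>The linear map from the source to the estimation error when all noise is absent.\<close>

definition residual :: "(nat \<Rightarrow> complex mat) \<Rightarrow> complex mat \<Rightarrow> complex mat" where
  "residual F G = mat_adjoint G * Smat p F - 1\<^sub>m (nK p)"

lemma residual_dim [simp]: "dim_row (residual F G) = nK p" "dim_col (residual F G) = nK p"
  by (auto simp: residual_def)

lemma residual_carrier: "residual F G \<in> carrier_mat (nK p) (nK p)"
  by (rule carrier_matI) auto

text \<open>Completing the square: all the terms with \<open>Sigs p\<close> combine into the power
  of the source error. What remains are the powers of the observation noises and of the receiver
  noise, so the objective is a sum of nonnegative parts.\<close>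

lemma MSE_hform:
  assumes "shaped F" "G \<in> carrier_mat (nM p) (nK p)"
  shows "MSE p F G = hform (Sigs p) (residual F G) (residual F G)
    + (\<Sum>i\<in>{1..nL p}. hform (Sig p i) (mat_adjoint G * (Hmat p i * F i)) (mat_adjoint G * (Hmat p i * F i)))
    + noise p * hform (1\<^sub>m (nM p)) (mat_adjoint G) (mat_adjoint G)"
proof -
  have G: "dim_row G = nM p" "dim_col G = nK p" using assms by auto
  have res: "residual F G * Sigs p * mat_adjoint (residual F G) =
      mat_adjoint G * Smat p F * Sigs p * mat_adjoint (Smat p F) * G - mat_adjoint G * Smat p F * Sigs p
      - (Sigs p * mat_adjoint (Smat p F) * G - Sigs p)"
    using G by (simp add: residual_def mat_distribs mat_assoc mat_mult_one_left mat_mult_one_right)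
      (intro eq_matI; simp del: index_mult_mat(1))
  have blocks: "mtrace (msum (nK p) (nK p)
       (\<lambda>i. mat_adjoint G * Hmat p i * F i * Sig p i * mat_adjoint (F i) * mat_adjoint (Hmat p i) * G) {1..nL p})
    = (\<Sum>i\<in>{1..nL p}. mtrace (mat_adjoint G * (Hmat p i * F i) * Sig p i * mat_adjoint (mat_adjoint G * (Hmat p i * F i))))"
    using G shaped_dim[OF assms(1)]
    by (subst mtrace_msum) (auto simp: mat_adjoint_mult mat_assoc intro!: sum.cong)
  show ?thesis
    unfolding MSE_def hform_def res
    using G by (simp add: mtrace_add mtrace_minus mtrace_smult blocks mat_mult_one_right)
qed

lemma hform_msum_nonneg:
  assumes "shaped F" "G \<in> carrier_mat (nM p) (nK p)"
  shows "0 \<le> (\<Sum>i\<in>{1..nL p}. hform (Sig p i) (mat_adjoint G * (Hmat p i * F i)) (mat_adjoint G * (Hmat p i * F i)))"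
proof (rule sum_nonneg)
  fix i assume i: "i \<in> {1..nL p}"
  show "0 \<le> hform (Sig p i) (mat_adjoint G * (Hmat p i * F i)) (mat_adjoint G * (Hmat p i * F i))"
    using assms(2) shaped_dim[OF assms(1) i] i
    by (intro hform_nonneg[OF block_facts(3)[OF i], of _ "nK p"] carrier_matI) auto
qed

lemma MSE_ge_noise:
  assumes "shaped F" "G \<in> carrier_mat (nM p) (nK p)"
  shows "noise p * hform (1\<^sub>m (nM p)) (mat_adjoint G) (mat_adjoint G) \<le> MSE p F G"
  unfolding MSE_hform[OF assms]
  using hform_msum_nonneg[OF assms] hform_nonneg[OF Sigs_psd residual_carrier] by simp

lemma Smat_upd:
  assumes "shaped F" "i \<in> {1..nL p}" "Y \<in> carrier_mat (nN p i) (nJ p i)"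
  shows "Smat p (F(i := Y)) = Smat p F + Hmat p i * ((Y - F i) * Kmat p i)"
proof (rule eq_matI)
  note F = shaped_dim[OF assms(1)]
  fix r c assume "r < dim_row (Smat p F + Hmat p i * ((Y - F i) * Kmat p i))"
    "c < dim_col (Smat p F + Hmat p i * ((Y - F i) * Kmat p i))"
  then have rc: "r < nM p" "c < nK p" using assms by auto
  have eq: "Hmat p i * Y * Kmat p i = Hmat p i * F i * Kmat p i + Hmat p i * ((Y - F i) * Kmat p i)"
    using assms F[OF assms(2)]
    by (simp add: mat_distribs mat_assoc) (intro eq_matI; auto)
  have "Smat p (F(i := Y)) $$ (r, c) = (Hmat p i * Y * Kmat p i) $$ (r, c)
      + (\<Sum>j\<in>{1..nL p} - {i}. (Hmat p j * F j * Kmat p j) $$ (r, c))"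
    using rc assms(2) by (simp add: Smat_def sum.remove[of _ i] del: index_mult_mat(1))
  moreover have "Smat p F $$ (r, c) = (Hmat p i * F i * Kmat p i) $$ (r, c)
      + (\<Sum>j\<in>{1..nL p} - {i}. (Hmat p j * F j * Kmat p j) $$ (r, c))"
    using rc assms(2) by (simp add: Smat_def sum.remove[of _ i] del: index_mult_mat(1))
  ultimately show "Smat p (F(i := Y)) $$ (r, c) = (Smat p F + Hmat p i * ((Y - F i) * Kmat p i)) $$ (r, c)"
    using rc assms unfolding eq by (simp del: index_mult_mat(1))
qed (use assms in auto)

text \<open>The directional derivative of the objective at \<open>(F, G)\<close> when block
  \<open>i\<close> moves along \<open>D\<close>; \<open>grad_app_beamformer\<close> identifies it
  with the gradient of the problem statement.\<close>

definition mse_lin :: "(nat \<Rightarrow> complex mat) \<Rightarrow> complex mat \<Rightarrow> nat \<Rightarrow> complex mat \<Rightarrow> real" where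
  "mse_lin F G i D = 2 * (hform (Sigs p) (residual F G) (mat_adjoint G * (Hmat p i * D) * Kmat p i)
     + hform (Sig p i) (mat_adjoint G * (Hmat p i * F i)) (mat_adjoint G * (Hmat p i * D)))"

text \<open>The second-order remainder of the same expansion. It depends on the receiver and the
  direction but not on the beamformers, and it may vanish at nonzero \<open>D\<close>.\<close>

definition mse_quad :: "complex mat \<Rightarrow> nat \<Rightarrow> complex mat \<Rightarrow> real" where
  "mse_quad G i D = hform (Sigs p) (mat_adjoint G * (Hmat p i * D) * Kmat p i) (mat_adjoint G * (Hmat p i * D) * Kmat p i)
     + hform (Sig p i) (mat_adjoint G * (Hmat p i * D)) (mat_adjoint G * (Hmat p i * D))"

lemma residual_upd:
  assumes "shaped F" "i \<in> {1..nL p}" "Y \<in> carrier_mat (nN p i) (nJ p i)" "G \<in> carrier_mat (nM p) (nK p)"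
  shows "residual (F(i := Y)) G = residual F G + mat_adjoint G * (Hmat p i * (Y - F i)) * Kmat p i"
  unfolding residual_def Smat_upd[OF assms(1-3)]
  using assms shaped_dim[OF assms(1,2)]
  by (simp add: mat_distrib_left[of "mat_adjoint G" "Smat p F"] mat_assoc) (intro eq_matI; auto)

lemma received_carrier:
  assumes "i \<in> {1..nL p}" "D \<in> carrier_mat (nN p i) (nJ p i)" "G \<in> carrier_mat (nM p) (nK p)"
  shows "mat_adjoint G * (Hmat p i * D) \<in> carrier_mat (nK p) (nJ p i)"
    "mat_adjoint G * (Hmat p i * D) * Kmat p i \<in> carrier_mat (nK p) (nK p)"
  using assms by (auto intro!: carrier_matI)

text \<open>The expansion is exact: both the residual and the \<open>i\<close>-th observation-noise
  factor are affine in block \<open>i\<close>, and nothing else changes.\<close>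

lemma MSE_upd:
  assumes "shaped F" "i \<in> {1..nL p}" "Y \<in> carrier_mat (nN p i) (nJ p i)" "G \<in> carrier_mat (nM p) (nK p)"
  shows "MSE p (F(i := Y)) G = MSE p F G + mse_lin F G i (Y - F i) + mse_quad G i (Y - F i)"
proof -
  note F = shaped_dim[OF assms(1,2)]
  define D where "D = Y - F i"
  have D: "D \<in> carrier_mat (nN p i) (nJ p i)" using assms F by (auto simp: D_def)
  have Yeq: "mat_adjoint G * (Hmat p i * Y) = mat_adjoint G * (Hmat p i * F i) + mat_adjoint G * (Hmat p i * D)"
  proof -
    have "Y = F i + D" using assms F by (intro eq_matI) (auto simp: D_def)
    then show ?thesis using assms F D by (simp add: mat_distribs)
  qed
  let ?h = "\<lambda>F j. hform (Sig p j) (mat_adjoint G * (Hmat p j * F j)) (mat_adjoint G * (Hmat p j * F j))"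
  have rest: "(\<Sum>j\<in>{1..nL p}. ?h (F(i := Y)) j) = ?h (F(i := Y)) i + (\<Sum>j\<in>{1..nL p} - {i}. ?h F j)"
    "(\<Sum>j\<in>{1..nL p}. ?h F j) = ?h F i + (\<Sum>j\<in>{1..nL p} - {i}. ?h F j)"
    using assms(2) by (simp_all add: sum.remove[of _ i])
  have "?h (F(i := Y)) i = ?h F i + 2 * hform (Sig p i) (mat_adjoint G * (Hmat p i * F i)) (mat_adjoint G * (Hmat p i * D))
      + hform (Sig p i) (mat_adjoint G * (Hmat p i * D)) (mat_adjoint G * (Hmat p i * D))"
    using hform_add_self[OF psd_hermitian[OF block_facts(3)[OF assms(2)]]
      received_carrier(1)[OF assms(2) F(1) assms(4)] received_carrier(1)[OF assms(2) D assms(4)]]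
    by (simp add: Yeq)
  moreover have "hform (Sigs p) (residual (F(i := Y)) G) (residual (F(i := Y)) G) =
      hform (Sigs p) (residual F G) (residual F G)
      + 2 * hform (Sigs p) (residual F G) (mat_adjoint G * (Hmat p i * D) * Kmat p i)
      + hform (Sigs p) (mat_adjoint G * (Hmat p i * D) * Kmat p i) (mat_adjoint G * (Hmat p i * D) * Kmat p i)"
    unfolding residual_upd[OF assms] D_def[symmetric]
    by (rule hform_add_self[OF psd_hermitian[OF Sigs_psd] residual_carrier received_carrier(2)[OF assms(2) D assms(4)]])
  ultimately show ?thesis
    unfolding MSE_hform[OF assms(1,4)] MSE_hform[OF shaped_upd[OF assms(1,3)] assms(4)] rest
      mse_lin_def mse_quad_def D_def[symmetric]
    by simp
qed

lemma mse_quad_parts: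
  assumes "i \<in> {1..nL p}" "D \<in> carrier_mat (nN p i) (nJ p i)" "G \<in> carrier_mat (nM p) (nK p)"
  shows "0 \<le> hform (Sigs p) (mat_adjoint G * (Hmat p i * D) * Kmat p i) (mat_adjoint G * (Hmat p i * D) * Kmat p i)"
    "0 \<le> hform (Sig p i) (mat_adjoint G * (Hmat p i * D)) (mat_adjoint G * (Hmat p i * D))"
  using hform_nonneg[OF Sigs_psd received_carrier(2)[OF assms]]
    hform_nonneg[OF block_facts(3)[OF assms(1)] received_carrier(1)[OF assms]] by auto

lemma mse_quad_nonneg:
  assumes "i \<in> {1..nL p}" "D \<in> carrier_mat (nN p i) (nJ p i)" "G \<in> carrier_mat (nM p) (nK p)"
  shows "0 \<le> mse_quad G i D"
  using mse_quad_parts[OF assms] by (simp add: mse_quad_def)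

text \<open>Half the real gradient with respect to block \<open>i\<close>, as the matrix that
  represents \<open>mse_lin\<close> in the trace inner product.\<close>

definition mse_grad :: "(nat \<Rightarrow> complex mat) \<Rightarrow> complex mat \<Rightarrow> nat \<Rightarrow> complex mat" where
  "mse_grad F G i = mat_adjoint (Hmat p i) *
     (G * (residual F G * (Sigs p * mat_adjoint (Kmat p i)) + mat_adjoint G * (Hmat p i * (F i * Sig p i))))"

lemma mse_lin_grad:
  assumes "shaped F" "i \<in> {1..nL p}" "D \<in> carrier_mat (nN p i) (nJ p i)" "G \<in> carrier_mat (nM p) (nK p)"
  shows "mse_lin F G i D = 2 * Re (mtrace (mse_grad F G i * mat_adjoint D))"
proof -
  note F = shaped_dim[OF assms(1,2)]
  have G: "dim_row G = nM p" "dim_col G = nK p" and D: "dim_row D = nN p i" "dim_col D = nJ p i"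
    using assms by auto
  let ?H = "Hmat p i" and ?K = "Kmat p i"
  have "mtrace (residual F G * Sigs p * mat_adjoint (mat_adjoint G * (?H * D) * ?K)) =
      mtrace ((residual F G * (Sigs p * (mat_adjoint ?K * mat_adjoint D))) * (mat_adjoint ?H * G))"
    using G D assms(2) by (simp add: mat_adjoint_mult mat_assoc)
  also have "\<dots> = mtrace ((mat_adjoint ?H * G) * (residual F G * (Sigs p * (mat_adjoint ?K * mat_adjoint D))))"
    by (rule mtrace_mult_commute) (use G D assms(2) in auto)
  finally have 1: "mtrace (residual F G * Sigs p * mat_adjoint (mat_adjoint G * (?H * D) * ?K)) = \<dots>" .
  have "mtrace (mat_adjoint G * (?H * F i) * Sig p i * mat_adjoint (mat_adjoint G * (?H * D))) =
      mtrace ((mat_adjoint G * (?H * (F i * (Sig p i * mat_adjoint D)))) * (mat_adjoint ?H * G))"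
    using G D F assms(2) by (simp add: mat_adjoint_mult mat_assoc)
  also have "\<dots> = mtrace ((mat_adjoint ?H * G) * (mat_adjoint G * (?H * (F i * (Sig p i * mat_adjoint D)))))"
    by (rule mtrace_mult_commute) (use G D F assms(2) in auto)
  finally have 2: "mtrace (mat_adjoint G * (?H * F i) * Sig p i * mat_adjoint (mat_adjoint G * (?H * D))) = \<dots>" .
  show ?thesis
    unfolding mse_lin_def hform_def 1 2 mse_grad_def
    using G D F assms(2) by (simp add: mat_distribs mat_assoc mtrace_add)
qed

lemma mse_grad_carrier:
  assumes "shaped F" "i \<in> {1..nL p}" "G \<in> carrier_mat (nM p) (nK p)"
  shows "mse_grad F G i \<in> carrier_mat (nN p i) (nJ p i)"
  unfolding mse_grad_def using assms shaped_dim[OF assms(1,2)] by (auto intro!: carrier_matI)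

section \<open>The beamformer update\<close>

text \<open>Both summands are positive semidefinite, and \<open>pd_assm\<close> makes one of them
  definite.\<close>

lemma tx_cov_pd:
  assumes i: "i \<in> {1..nL p}"
  shows "pd_mat (nJ p i) (tx_cov p i)"
proof (rule pd_matI)
  let ?A = "Kmat p i * Sigs p * mat_adjoint (Kmat p i)"
  have A: "?A \<in> carrier_mat (nJ p i) (nJ p i)" using i by (auto intro!: carrier_matI)
  have hA: "mat_adjoint ?A = ?A" using i Sigs_facts by (simp add: mat_adjoint_mult mat_assoc)
  show "hermitian_mat (nJ p i) (tx_cov p i)"
    using A hA Sig_facts[OF i] i unfolding hermitian_mat_def tx_cov_def
    by (auto simp: mat_adjoint_add simp del: assoc_mult_mat)
  fix X :: "complex mat"
  assume X: "X \<in> carrier_mat 1 (nJ p i)" "X \<noteq> 0\<^sub>m 1 (nJ p i)"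
  have sum: "hform (tx_cov p i) X X = hform ?A X X + hform (Sig p i) X X"
    using X i by (simp add: hform_def tx_cov_def mat_distrib_left mat_distrib_right mtrace_add)
  have "hform ?A X X = hform (Sigs p) (X * Kmat p i) (X * Kmat p i)"
    using X i by (simp add: hform_def mat_adjoint_mult mat_assoc)
  also have "\<dots> \<ge> 0"
    using X i by (intro hform_nonneg[OF Sigs_psd, of _ 1] carrier_matI) auto
  finally have "0 \<le> hform ?A X X" .
  moreover have "0 \<le> hform (Sig p i) X X"
    using hform_nonneg[OF block_facts(3)[OF i] X(1)] .
  moreover have "0 < hform ?A X X \<or> 0 < hform (Sig p i) X X"
    using pd_assm[OF i] hform_pos[OF _ X] by blast
  ultimately show "0 < hform (tx_cov p i) X X" unfolding sum by linarith
qed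

lemma tx_cov_facts:
  assumes "i \<in> {1..nL p}"
  shows "tx_cov p i \<in> carrier_mat (nJ p i) (nJ p i)" "mat_adjoint (tx_cov p i) = tx_cov p i"
    "dim_row (tx_cov p i) = nJ p i" "dim_col (tx_cov p i) = nJ p i"
  using hermitian_matD[OF pd_hermitian[OF tx_cov_pd[OF assms]]] by auto

lemma feasible_iff:
  "feasible p F \<longleftrightarrow> shaped F \<and> (\<forall>i\<in>{1..nL p}. hform (tx_cov p i) (F i) (F i) \<le> budget p i)"
  by (auto simp: feasible_def shaped_def hform_def)

lemma Emat_pd: "i \<in> {1..nL p} \<Longrightarrow> pd_mat (nJ p i * nN p i) (Emat p i)"
  unfolding Emat_def by (intro kron_transpose_one_pd tx_cov_pd)

section \<open>The vectorized update in terms of matrices\<close>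

lemma Amat_mult_vec:
  assumes "i \<in> {1..nL p}" "j \<in> {1..nL p}" "X \<in> carrier_mat (nN p j) (nJ p j)" "G \<in> carrier_mat (nM p) (nK p)"
  shows "Amat p G i j *\<^sub>v vec_of_mat X = vec_of_mat (mat_adjoint (Hmat p i) * (G * (mat_adjoint G *
    (Hmat p j * (X * (Kmat p j * (Sigs p * mat_adjoint (Kmat p i))))))))"
proof -
  have "Amat p G i j *\<^sub>v vec_of_mat X = vec_of_mat (mat_adjoint (Hmat p i) * G * mat_adjoint G * Hmat p j * X
      * (Kmat p j * Sigs p * mat_adjoint (Kmat p i)))"
    unfolding Amat_def using assms by (intro kron_mult_vec[of _ "nN p j" "nJ p j" _ "nN p i" _ "nJ p i"] carrier_matI) auto
  also have "mat_adjoint (Hmat p i) * G * mat_adjoint G * Hmat p j * X * (Kmat p j * Sigs p * mat_adjoint (Kmat p i)) =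
    mat_adjoint (Hmat p i) * (G * (mat_adjoint G * (Hmat p j * (X * (Kmat p j * (Sigs p * mat_adjoint (Kmat p i)))))))"
    using assms by (simp add: mat_assoc)
  finally show ?thesis .
qed

lemma Cmat_mult_vec:
  assumes "i \<in> {1..nL p}" "X \<in> carrier_mat (nN p i) (nJ p i)" "G \<in> carrier_mat (nM p) (nK p)"
  shows "Cmat p G i *\<^sub>v vec_of_mat X = vec_of_mat (mat_adjoint (Hmat p i) * (G * (mat_adjoint G *
    (Hmat p i * (X * Sig p i)))))"
proof -
  have "map_mat cnj (Sig p i) = transpose_mat (mat_adjoint (Sig p i))"
    by (rule eq_matI) auto
  then have "map_mat cnj (Sig p i) = transpose_mat (Sig p i)"
    using Sig_facts[OF assms(1)] by simp
  then have "Cmat p G i *\<^sub>v vec_of_mat X = vec_of_mat (mat_adjoint (Hmat p i) * G * mat_adjoint G * Hmat p i * X * Sig p i)"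
    unfolding Cmat_def using assms
    by (simp only:) (intro kron_mult_vec[of _ "nN p i" "nJ p i" _ "nN p i" _ "nJ p i"] carrier_matI; simp)
  also have "mat_adjoint (Hmat p i) * G * mat_adjoint G * Hmat p i * X * Sig p i =
    mat_adjoint (Hmat p i) * (G * (mat_adjoint G * (Hmat p i * (X * Sig p i))))"
    using assms by (simp add: mat_assoc)
  finally show ?thesis .
qed

lemma Emat_mult_vec:
  assumes "i \<in> {1..nL p}" "X \<in> carrier_mat (nN p i) (nJ p i)"
  shows "Emat p i *\<^sub>v vec_of_mat X = vec_of_mat (X * tx_cov p i)"
  unfolding Emat_def using kron_mult_vec[OF assms(2) one_carrier_mat tx_cov_facts(1)[OF assms(1)]] assms
  by simp

lemma Bmat_adjoint_mult_vec:
  assumes "i \<in> {1..nL p}" "G \<in> carrier_mat (nM p) (nK p)"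
  shows "mat_adjoint (Bmat p i) *\<^sub>v vec_of_mat G =
    vec_of_mat (mat_adjoint (Hmat p i) * (G * (Sigs p * mat_adjoint (Kmat p i))))"
proof -
  have "mat_adjoint (Bmat p i) *\<^sub>v vec_of_mat G =
      vec_of_mat (mat_adjoint (Hmat p i) * G * mat_adjoint (Kmat p i * Sigs p))"
    unfolding Bmat_def kron_adjoint adjoint_transpose using assms
    by (intro kron_mult_vec[of _ "nM p" "nK p" _ "nN p i" _ "nJ p i"] carrier_matI) auto
  also have "mat_adjoint (Hmat p i) * G * mat_adjoint (Kmat p i * Sigs p) =
      mat_adjoint (Hmat p i) * (G * (Sigs p * mat_adjoint (Kmat p i)))"
    using assms Sigs_facts by (simp add: mat_adjoint_mult mat_assoc)
  finally show ?thesis .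
qed

text \<open>The contribution of block \<open>j\<close> to the normal equation of block
  \<open>i\<close>, unstacked from \<open>Amat p G i j\<close> applied to the stacking of
  \<open>F j\<close>. For \<open>j = i\<close> it is the part of the left-hand side that belongs to
  \<open>Amat p G i i\<close>.\<close>

definition rhs_mat :: "complex mat \<Rightarrow> (nat \<Rightarrow> complex mat) \<Rightarrow> nat \<Rightarrow> nat \<Rightarrow> complex mat" where
  "rhs_mat G F i j = mat_adjoint (Hmat p i) * (G * (mat_adjoint G *
    (Hmat p j * (F j * (Kmat p j * (Sigs p * mat_adjoint (Kmat p i)))))))"

lemma rhs_mat_carrier:
  assumes "i \<in> {1..nL p}" "G \<in> carrier_mat (nM p) (nK p)"
  shows "rhs_mat G F i j \<in> carrier_mat (nN p i) (nJ p i)"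
  unfolding rhs_mat_def using assms by (auto intro!: carrier_matI)

lemma rhs_vec_eq:
  assumes "shaped F" "i \<in> {1..nL p}" "G \<in> carrier_mat (nM p) (nK p)"
  shows "rhs_vec p G F i = vec_of_mat (mat_adjoint (Hmat p i) * (G * (Sigs p * mat_adjoint (Kmat p i)))
    - msum (nN p i) (nJ p i) (rhs_mat G F i) ({1..nL p} - {i}))"
proof -
  let ?I = "{1..nL p} - {i}"
  have "qvec p G F i = finsum_vec TYPE(complex) (nN p i * nJ p i) (\<lambda>j. vec_of_mat (rhs_mat G F i j)) ?I"
  proof -
    have c1: "(\<lambda>j. vec_of_mat (rhs_mat G F i j)) \<in> ?I \<rightarrow> carrier_vec (nN p i * nJ p i)"
      using vec_of_mat_carrier[OF rhs_mat_carrier[OF assms(2,3)]] by blast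
    have eq: "Amat p G i j *\<^sub>v vec_of_mat (F j) = vec_of_mat (rhs_mat G F i j)" if "j \<in> ?I" for j
      unfolding rhs_mat_def using that assms shaped_dim[OF assms(1)] by (intro Amat_mult_vec) auto
    then have c2: "(\<lambda>j. Amat p G i j *\<^sub>v vec_of_mat (F j)) \<in> ?I \<rightarrow> carrier_vec (nN p i * nJ p i)"
      using c1 by (simp add: Pi_iff)
    show ?thesis
      unfolding qvec_def mult.commute[of "nJ p i"]
    proof (rule eq_vecI)
      fix k assume "k < dim_vec (finsum_vec TYPE(complex) (nN p i * nJ p i) (\<lambda>j. vec_of_mat (rhs_mat G F i j)) ?I)"
      then have k: "k < nN p i * nJ p i" using finsum_vec_closed[OF c1] by auto
      show "finsum_vec TYPE(complex) (nN p i * nJ p i) (\<lambda>j. Amat p G i j *\<^sub>v vec_of_mat (F j)) ?I $ k =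
          finsum_vec TYPE(complex) (nN p i * nJ p i) (\<lambda>j. vec_of_mat (rhs_mat G F i j)) ?I $ k"
        unfolding index_finsum_vec[OF finite_Diff[OF finite_atLeastAtMost] k c1]
          index_finsum_vec[OF finite_Diff[OF finite_atLeastAtMost] k c2]
        by (rule sum.cong[OF refl]) (simp only: eq)
    qed (use finsum_vec_closed[OF c1] finsum_vec_closed[OF c2] in auto)
  qed
  also have "\<dots> = vec_of_mat (msum (nN p i) (nJ p i) (rhs_mat G F i) ?I)"
    using rhs_mat_carrier[OF assms(2,3)] by (intro vec_of_mat_msum) auto
  finally have q: "qvec p G F i = \<dots>" .
  show ?thesis
    unfolding rhs_vec_def q Bmat_adjoint_mult_vec[OF assms(2,3)]
    using assms by (intro vec_of_mat_minus[of _ "nN p i" "nJ p i", symmetric] carrier_matI) auto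
qed

text \<open>Expanding \<open>Smat\<close> over the blocks brings the gradient into the shape of the
  subproblem: the sum carries the \<open>A\<close> terms including the interference
  \<open>q\<close>, the second term is that of \<open>B\<close>, the third that of
  \<open>C\<close>.\<close>

lemma mse_grad_msum:
  assumes "shaped F" "i \<in> {1..nL p}" "G \<in> carrier_mat (nM p) (nK p)"
  shows "mse_grad F G i = msum (nN p i) (nJ p i) (rhs_mat G F i) {1..nL p}
    - mat_adjoint (Hmat p i) * (G * (Sigs p * mat_adjoint (Kmat p i)))
    + mat_adjoint (Hmat p i) * (G * (mat_adjoint G * (Hmat p i * (F i * Sig p i))))"
proof -
  note F = shaped_dim[OF assms(1)]
  have G: "dim_row G = nM p" "dim_col G = nK p" using assms by auto
  let ?T = "Sigs p * mat_adjoint (Kmat p i)"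
  have "Smat p F * ?T = msum (nM p) (nJ p i) (\<lambda>j. Hmat p j * F j * Kmat p j * ?T) {1..nL p}"
    unfolding Smat_def using F assms(2)
    by (subst msum_mult) (auto intro!: carrier_matI)
  moreover have "mat_adjoint G * msum (nM p) (nJ p i) (\<lambda>j. Hmat p j * F j * Kmat p j * ?T) {1..nL p} =
      msum (nK p) (nJ p i) (\<lambda>j. mat_adjoint G * (Hmat p j * F j * Kmat p j * ?T)) {1..nL p}"
    using G assms(2) by (subst mult_msum) (auto intro!: carrier_matI simp del: assoc_mult_mat)
  moreover have "G * msum (nK p) (nJ p i) (\<lambda>j. mat_adjoint G * (Hmat p j * F j * Kmat p j * ?T)) {1..nL p} =
      msum (nM p) (nJ p i) (\<lambda>j. G * (mat_adjoint G * (Hmat p j * F j * Kmat p j * ?T))) {1..nL p}"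
    using G assms(2) by (subst mult_msum) (auto intro!: carrier_matI simp del: assoc_mult_mat)
  moreover have "mat_adjoint (Hmat p i) * msum (nM p) (nJ p i) (\<lambda>j. G * (mat_adjoint G * (Hmat p j * F j * Kmat p j * ?T))) {1..nL p} =
      msum (nN p i) (nJ p i) (\<lambda>j. mat_adjoint (Hmat p i) * (G * (mat_adjoint G * (Hmat p j * F j * Kmat p j * ?T)))) {1..nL p}"
    using G assms(2) by (subst mult_msum) (auto intro!: carrier_matI simp del: assoc_mult_mat)
  ultimately have "mat_adjoint (Hmat p i) * (G * (mat_adjoint G * (Smat p F * ?T))) =
      msum (nN p i) (nJ p i) (\<lambda>j. mat_adjoint (Hmat p i) * (G * (mat_adjoint G * (Hmat p j * F j * Kmat p j * ?T)))) {1..nL p}"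
    by (simp only:)
  also have "\<dots> = msum (nN p i) (nJ p i) (rhs_mat G F i) {1..nL p}"
    unfolding rhs_mat_def using F G assms(2) by (intro msum_cong) (simp add: mat_assoc)
  finally have S: "mat_adjoint (Hmat p i) * (G * (mat_adjoint G * (Smat p F * ?T))) = \<dots>" .
  have "mse_grad F G i = mat_adjoint (Hmat p i) * (G * (mat_adjoint G * (Smat p F * ?T)))
    - mat_adjoint (Hmat p i) * (G * ?T)
    + mat_adjoint (Hmat p i) * (G * (mat_adjoint G * (Hmat p i * (F i * Sig p i))))"
    unfolding mse_grad_def residual_def using F[OF assms(2)] G assms(2)
    by (simp add: mat_distribs mat_assoc mat_mult_one_left)
  then show ?thesis unfolding S .
qed

text \<open>Unstacking the linear system of \<open>trust_region_KKT\<close> turns it into the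
  Lagrange condition: the gradient at the updated block is a nonpositive multiple of the
  constraint's gradient, with complementary slackness.\<close>

lemma beamformer_update_KKT:
  assumes F: "shaped F" and i: "i \<in> {1..nL p}" and G: "G \<in> carrier_mat (nM p) (nK p)"
    and upd: "beamformer_update p G F i Fi"
  obtains mu where "0 \<le> mu" "mse_grad (F(i := Fi)) G i = complex_of_real (- mu) \<cdot>\<^sub>m (Fi * tx_cov p i)"
    "hform (tx_cov p i) Fi Fi \<le> budget p i" "mu = 0 \<or> hform (tx_cov p i) Fi Fi = budget p i"
proof -
  let ?n = "nJ p i * nN p i"
  let ?T = "tx_cov p i"
  have Fi: "Fi \<in> carrier_mat (nN p i) (nJ p i)" using upd by (simp add: beamformer_update_def)
  have Gd: "dim_row G = nM p" "dim_col G = nK p" using G by auto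
  obtain U lam r where eig: "psd_eigendecomposition ?n (Mmat p G i) U lam r"
    and f: "let n = ?n; pv = mat_adjoint U *\<^sub>v bvec p G F i
        in if (\<forall>k. r \<le> k \<longrightarrow> k < n \<longrightarrow> pv $ k = 0) \<and> (\<Sum>k<r. (cmod (pv $ k))\<^sup>2 / (lam k)\<^sup>2) \<le> budget p i
           then vec_of_mat Fi = minv_sqrt (Emat p i) *\<^sub>v (pseudo_inverse (Mmat p G i) *\<^sub>v bvec p G F i)
           else (let mu = (THE mu::real. 0 < mu \<and> (\<Sum>k<n. (cmod (pv $ k))\<^sup>2 / (lam k + mu)\<^sup>2) = budget p i)
                 in vec_of_mat Fi = minv (Amat p G i i + Cmat p G i + complex_of_real mu \<cdot>\<^sub>m Emat p i) *\<^sub>v rhs_vec p G F i)"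
    using upd unfolding beamformer_update_def by blast
  have A: "Amat p G i i \<in> carrier_mat ?n ?n" and C: "Cmat p G i \<in> carrier_mat ?n ?n"
    using i Gd by (auto simp: Amat_def Cmat_def intro!: carrier_matI)
  have E: "Emat p i \<in> carrier_mat ?n ?n" using hermitian_matD[OF pd_hermitian[OF Emat_pd[OF i]]] by simp
  have b: "rhs_vec p G F i \<in> carrier_vec ?n"
    unfolding rhs_vec_eq[OF F i G] by (rule carrier_vecI) (use i Gd in \<open>simp add: mult.commute\<close>)
  have "\<exists>mu\<ge>0. (Amat p G i i + Cmat p G i + complex_of_real mu \<cdot>\<^sub>m Emat p i) *\<^sub>v vec_of_mat Fi = rhs_vec p G F i
      \<and> Re ((Emat p i *\<^sub>v vec_of_mat Fi) \<bullet>c vec_of_mat Fi) \<le> budget p i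
      \<and> (mu = 0 \<or> Re ((Emat p i *\<^sub>v vec_of_mat Fi) \<bullet>c vec_of_mat Fi) = budget p i)"
    using eig f unfolding Mmat_def bvec_def Let_def
    by (intro trust_region_KKT[OF Emat_pd[OF i] _ b block_facts(4)[OF i], where U = U and lam = lam and r = r])
      (use A C in \<open>auto simp: Let_def\<close>)
  then obtain mu where mu: "0 \<le> mu"
    and eq: "(Amat p G i i + Cmat p G i + complex_of_real mu \<cdot>\<^sub>m Emat p i) *\<^sub>v vec_of_mat Fi = rhs_vec p G F i"
    and le: "Re ((Emat p i *\<^sub>v vec_of_mat Fi) \<bullet>c vec_of_mat Fi) \<le> budget p i"
    and comp: "mu = 0 \<or> Re ((Emat p i *\<^sub>v vec_of_mat Fi) \<bullet>c vec_of_mat Fi) = budget p i"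
    by blast
  have FT: "Fi * ?T \<in> carrier_mat (nN p i) (nJ p i)" using Fi tx_cov_facts[OF i] by auto
  have power: "Re ((Emat p i *\<^sub>v vec_of_mat Fi) \<bullet>c vec_of_mat Fi) = hform ?T Fi Fi"
    unfolding Emat_mult_vec[OF i Fi] by (simp add: vec_of_mat_inner[OF FT Fi] hform_def)
  let ?F = "F(i := Fi)"
  have F': "shaped ?F" using F Fi by (rule shaped_upd)
  let ?C = "mat_adjoint (Hmat p i) * (G * (mat_adjoint G * (Hmat p i * (Fi * Sig p i))))"
  let ?B = "mat_adjoint (Hmat p i) * (G * (Sigs p * mat_adjoint (Kmat p i)))"
  let ?rest = "msum (nN p i) (nJ p i) (rhs_mat G F i) ({1..nL p} - {i})"
  have Cc: "?C \<in> carrier_mat (nN p i) (nJ p i)" and Bc: "?B \<in> carrier_mat (nN p i) (nJ p i)"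
    using i Gd by (auto intro!: carrier_matI)
  have Ai: "Amat p G i i *\<^sub>v vec_of_mat Fi = vec_of_mat (rhs_mat G ?F i i)"
    unfolding Amat_mult_vec[OF i i Fi G] rhs_mat_def by simp
  have v: "vec_of_mat Fi \<in> carrier_vec ?n" using vec_of_mat_carrier[OF Fi] by (simp add: mult.commute)
  have muE: "(complex_of_real mu \<cdot>\<^sub>m Emat p i) *\<^sub>v vec_of_mat Fi = complex_of_real mu \<cdot>\<^sub>v vec_of_mat (Fi * ?T)"
    using smult_mat_mult_vec[of "vec_of_mat Fi" "Emat p i"] carrier_vecD[OF v] carrier_matD[OF E]
    by (simp only: Emat_mult_vec[OF i Fi])
  have "(Amat p G i i + Cmat p G i + complex_of_real mu \<cdot>\<^sub>m Emat p i) *\<^sub>v vec_of_mat Fi =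
      (Amat p G i i + Cmat p G i) *\<^sub>v vec_of_mat Fi + (complex_of_real mu \<cdot>\<^sub>m Emat p i) *\<^sub>v vec_of_mat Fi"
    using A C E v by (intro add_mult_distrib_mat_vec[of _ ?n ?n]) auto
  also have "\<dots> = (vec_of_mat (rhs_mat G ?F i i) + vec_of_mat ?C) + complex_of_real mu \<cdot>\<^sub>v vec_of_mat (Fi * ?T)"
    by (simp only: muE add_mult_distrib_mat_vec[OF A C v] Ai Cmat_mult_vec[OF i Fi G])
  also have "\<dots> = vec_of_mat (rhs_mat G ?F i i + ?C + complex_of_real mu \<cdot>\<^sub>m (Fi * ?T))"
    using rhs_mat_carrier[OF i G, of ?F i] Cc FT
    by (simp del: assoc_mult_mat assoc_add_vec assoc_add_mat add: vec_of_mat_add[where n = "nN p i" and m = "nJ p i"] vec_of_mat_smult)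
  finally have "vec_of_mat (rhs_mat G ?F i i + ?C + complex_of_real mu \<cdot>\<^sub>m (Fi * ?T)) = vec_of_mat (?B - ?rest)"
    using eq unfolding rhs_vec_eq[OF F i G] by simp
  then have mat_eq: "rhs_mat G ?F i i + ?C + complex_of_real mu \<cdot>\<^sub>m (Fi * ?T) = ?B - ?rest"
    using rhs_mat_carrier[OF i G, of ?F i] Cc FT Bc
    by (intro vec_of_mat_inject[of _ "nN p i" "nJ p i"]) (auto intro!: carrier_matI)
  have aux: "x = - m" if "x = a + s - b + c" "a + c + m = b - s" for x m a s b c :: complex
  proof -
    have "b = a + c + m + s" using that(2) by simp
    then show ?thesis using that(1) by simp
  qed
  have "mse_grad ?F G i = complex_of_real (- mu) \<cdot>\<^sub>m (Fi * ?T)"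
  proof (rule eq_matI)
    fix a c assume "a < dim_row (complex_of_real (- mu) \<cdot>\<^sub>m (Fi * ?T))" "c < dim_col (complex_of_real (- mu) \<cdot>\<^sub>m (Fi * ?T))"
    then have ac: "a < nN p i" "c < nJ p i" using FT by auto
    \<comment> \<open>Only the summand \<open>j = i\<close> sees the new block; the remaining ones
      form the interference on the right-hand side of the linear system.\<close>
    have "rhs_mat G ?F i j = rhs_mat G F i j" if "j \<noteq> i" for j
      using that by (simp add: rhs_mat_def)
    then have "msum (nN p i) (nJ p i) (rhs_mat G ?F i) {1..nL p} $$ (a, c) =
        rhs_mat G ?F i i $$ (a, c) + ?rest $$ (a, c)"
      using i ac by (simp add: sum.remove[of _ i])
    then have "mse_grad ?F G i $$ (a, c) =
        rhs_mat G ?F i i $$ (a, c) + ?rest $$ (a, c) - ?B $$ (a, c) + ?C $$ (a, c)"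
      unfolding mse_grad_msum[OF F' i G] using ac carrier_matD[OF Bc] carrier_matD[OF Cc]
      by (simp del: index_mult_mat(1) assoc_mult_mat)
    moreover have "rhs_mat G ?F i i $$ (a, c) + ?C $$ (a, c) + complex_of_real mu * (Fi * ?T) $$ (a, c)
        = ?B $$ (a, c) - ?rest $$ (a, c)"
      using arg_cong[OF mat_eq, of "\<lambda>X. X $$ (a, c)"] ac carrier_matD[OF Cc] carrier_matD[OF FT]
        carrier_matD[OF Bc]
      by (simp del: index_mult_mat(1) assoc_mult_mat msum_index)
    ultimately have "mse_grad ?F G i $$ (a, c) = - (complex_of_real mu * (Fi * ?T) $$ (a, c))"
      by (rule aux)
    then show "mse_grad ?F G i $$ (a, c) = (complex_of_real (- mu) \<cdot>\<^sub>m (Fi * ?T)) $$ (a, c)"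
      using ac carrier_matD[OF FT] by (simp del: index_mult_mat(1))
  qed (use mse_grad_carrier[OF F' i G] FT in auto)
  then show thesis using that mu le comp unfolding power by blast
qed

text \<open>By the Lagrange condition the derivative is \<open>2 * mu\<close> times the form at
  \<open>(Fi, Fi)\<close> minus the form at \<open>(Fi, Y)\<close>. If \<open>mu\<close> is nonzero,
  the constraint is active, so the first value is the budget, while the second is at most the budget
  by Cauchy-Schwarz.\<close>

lemma beamformer_update_variational:
  assumes F: "shaped F" and i: "i \<in> {1..nL p}" and G: "G \<in> carrier_mat (nM p) (nK p)"
    and upd: "beamformer_update p G F i Fi"
    and Y: "Y \<in> carrier_mat (nN p i) (nJ p i)" "hform (tx_cov p i) Y Y \<le> budget p i"
  shows "0 \<le> mse_lin (F(i := Fi)) G i (Y - Fi)"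
proof -
  let ?T = "tx_cov p i"
  note T = tx_cov_facts[OF i]
  have Fi: "Fi \<in> carrier_mat (nN p i) (nJ p i)" using upd by (simp add: beamformer_update_def)
  obtain mu where mu: "0 \<le> mu" "mse_grad (F(i := Fi)) G i = complex_of_real (- mu) \<cdot>\<^sub>m (Fi * ?T)"
    "hform ?T Fi Fi \<le> budget p i" "mu = 0 \<or> hform ?T Fi Fi = budget p i"
    using beamformer_update_KKT[OF F i G upd] .
  have "mse_lin (F(i := Fi)) G i (Y - Fi) = 2 * Re (mtrace (complex_of_real (- mu) \<cdot>\<^sub>m (Fi * ?T) * mat_adjoint (Y - Fi)))"
    using mse_lin_grad[OF shaped_upd[OF F Fi] i minus_carrier_mat[OF Fi] G, of Y] unfolding mu(2) .
  also have "\<dots> = 2 * (mu * (hform ?T Fi Fi - hform ?T Fi Y))"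
    using Fi Y T by (simp add: hform_def mat_distribs mtrace_minus mtrace_smult algebra_simps)
  finally have eq: "mse_lin (F(i := Fi)) G i (Y - Fi) = 2 * (mu * (hform ?T Fi Fi - hform ?T Fi Y))" .
  have "0 \<le> mu * (hform ?T Fi Fi - hform ?T Fi Y)"
  proof (cases "mu = 0")
    case False
    then have eq: "hform ?T Fi Fi = budget p i" using mu by simp
    have P: "0 < budget p i" using block_facts(4)[OF i] .
    have "hform ?T Fi Y \<le> sqrt (hform ?T Fi Fi * hform ?T Y Y)"
      using hform_Cauchy_Schwarz[OF pd_imp_psd[OF tx_cov_pd[OF i]] Fi Y(1)] by simp
    also have "\<dots> \<le> sqrt (budget p i * budget p i)"
      unfolding eq using P Y(2) by (intro real_sqrt_le_mono mult_left_mono) auto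
    finally have "hform ?T Fi Y \<le> budget p i" using P by simp
    then show ?thesis using mu(1) eq by simp
  qed simp
  then show ?thesis unfolding eq by simp
qed

section \<open>The receiver update\<close>

text \<open>The matrix inverted in \<open>Gstar\<close>, the covariance of the received signal; it
  is also the second-order part of the objective in the receiver.\<close>

definition recv_cov :: "(nat \<Rightarrow> complex mat) \<Rightarrow> complex mat" where
  "recv_cov F = Smat p F * Sigs p * mat_adjoint (Smat p F) + complex_of_real (noise p) \<cdot>\<^sub>m 1\<^sub>m (nM p)
     + msum (nM p) (nM p) (\<lambda>i. Hmat p i * F i * Sig p i * mat_adjoint (F i) * mat_adjoint (Hmat p i)) {1..nL p}"

lemma recv_cov_carrier: "recv_cov F \<in> carrier_mat (nM p) (nM p)"
  by (auto simp: recv_cov_def intro!: carrier_matI)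

lemma recv_cov_form:
  assumes F: "shaped F" and X: "X \<in> carrier_mat m (nM p)" and Y: "Y \<in> carrier_mat m (nM p)"
  shows "hform (recv_cov F) X Y = hform (Sigs p) (X * Smat p F) (Y * Smat p F)
    + (\<Sum>i\<in>{1..nL p}. hform (Sig p i) (X * (Hmat p i * F i)) (Y * (Hmat p i * F i)))
    + noise p * hform (1\<^sub>m (nM p)) X Y"
proof -
  note Fd = shaped_dim[OF F]
  let ?N = "\<lambda>i. Hmat p i * F i * Sig p i * mat_adjoint (F i) * mat_adjoint (Hmat p i)"
  let ?m = "msum (nM p) (nM p) ?N {1..nL p}"
  have "X * ?m = msum m (nM p) (\<lambda>i. X * ?N i) {1..nL p}"
    using X by (subst mult_msum) (auto intro!: carrier_matI)
  then have "X * ?m * mat_adjoint Y = msum m m (\<lambda>i. X * ?N i * mat_adjoint Y) {1..nL p}"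
    using X Y by (simp del: assoc_mult_mat) (subst msum_mult; auto intro!: carrier_matI)
  then have "mtrace (X * ?m * mat_adjoint Y) = (\<Sum>i\<in>{1..nL p}. mtrace (X * ?N i * mat_adjoint Y))"
    using X by (simp del: assoc_mult_mat add: mtrace_msum)
  also have "\<dots> = (\<Sum>i\<in>{1..nL p}. mtrace (X * (Hmat p i * F i) * Sig p i * mat_adjoint (Y * (Hmat p i * F i))))"
    using X Y Fd by (intro sum.cong refl arg_cong[of _ _ mtrace]) (simp add: mat_adjoint_mult mat_assoc)
  finally have 1: "mtrace (X * ?m * mat_adjoint Y) = \<dots>" .
  have 2: "X * (Smat p F * Sigs p * mat_adjoint (Smat p F)) * mat_adjoint Y =
      X * Smat p F * Sigs p * mat_adjoint (Y * Smat p F)"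
    using X Y by (simp add: mat_adjoint_mult mat_assoc)
  have "X * recv_cov F * mat_adjoint Y = X * (Smat p F * Sigs p * mat_adjoint (Smat p F)) * mat_adjoint Y
      + complex_of_real (noise p) \<cdot>\<^sub>m (X * 1\<^sub>m (nM p) * mat_adjoint Y) + X * ?m * mat_adjoint Y"
    unfolding recv_cov_def using X Y by (simp add: mat_distribs del: assoc_mult_mat)
  then show ?thesis
    unfolding hform_def 2 using X Y
    by (simp del: assoc_mult_mat add: mtrace_add mtrace_smult 1)
qed

text \<open>Strictness comes from the noise: signal and observation noise contribute nonnegative
  terms, the receiver noise a multiple of the squared norm.\<close>

lemma recv_cov_pd:
  assumes F: "shaped F"
  shows "pd_mat (nM p) (recv_cov F)"
proof (rule pd_matI)
  note Fd = shaped_dim[OF F]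
  let ?N = "\<lambda>i. Hmat p i * F i * Sig p i * mat_adjoint (F i) * mat_adjoint (Hmat p i)"
  have Nadj: "mat_adjoint (?N i) = ?N i" if "i \<in> {1..nL p}" for i
    using Fd[OF that] that Sig_facts[OF that] by (simp add: mat_adjoint_mult mat_assoc)
  have "mat_adjoint (msum (nM p) (nM p) ?N {1..nL p}) = msum (nM p) (nM p) ?N {1..nL p}"
  proof (rule eq_matI)
    fix r c assume "r < dim_row (msum (nM p) (nM p) ?N {1..nL p})" "c < dim_col (msum (nM p) (nM p) ?N {1..nL p})"
    then have rc: "r < nM p" "c < nM p" by auto
    have "cnj (?N i $$ (c, r)) = ?N i $$ (r, c)" if i: "i \<in> {1..nL p}" for i
      using arg_cong[OF Nadj[OF i], of "\<lambda>X. X $$ (r, c)"] rc i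
      by (subst (asm) mat_adjoint_index) auto
    then show "mat_adjoint (msum (nM p) (nM p) ?N {1..nL p}) $$ (r, c) = msum (nM p) (nM p) ?N {1..nL p} $$ (r, c)"
      using rc by (simp del: index_mult_mat(1) assoc_mult_mat)
  qed auto
  then show "hermitian_mat (nM p) (recv_cov F)"
    using recv_cov_carrier[of F] Sigs_facts
    by (simp add: hermitian_mat_def) (simp add: recv_cov_def mat_adjoint_add mat_adjoint_mult mat_adjoint_smult mat_assoc)
  fix X :: "complex mat"
  assume X: "X \<in> carrier_mat 1 (nM p)" "X \<noteq> 0\<^sub>m 1 (nM p)"
  obtain c where c: "c < nM p" "X $$ (0, c) \<noteq> 0"
  proof -
    have "\<exists>c<nM p. X $$ (0, c) \<noteq> 0"
    proof (rule ccontr)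
      assume "\<not> (\<exists>c<nM p. X $$ (0, c) \<noteq> 0)"
      then have "X = 0\<^sub>m 1 (nM p)" using X(1) by (intro eq_matI) auto
      with X(2) show False by simp
    qed
    then show thesis using that by blast
  qed
  have "0 < (\<Sum>c<nM p. (cmod (X $$ (0, c)))\<^sup>2)"
    using c by (intro sum_pos2[of _ c]) auto
  then have "0 < hform (1\<^sub>m (nM p)) X X"
    by (simp add: hform_one_self[OF X(1)] One_nat_def)
  moreover have "0 \<le> hform (Sigs p) (X * Smat p F) (X * Smat p F)"
    using X by (intro hform_nonneg[OF Sigs_psd, of _ 1] carrier_matI) auto
  moreover have "0 \<le> (\<Sum>i\<in>{1..nL p}. hform (Sig p i) (X * (Hmat p i * F i)) (X * (Hmat p i * F i)))"
    using X Fd by (intro sum_nonneg hform_nonneg[OF block_facts(3), of _ _ 1] carrier_matI) auto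
  ultimately show "0 < hform (recv_cov F) X X"
    unfolding recv_cov_form[OF F X(1) X(1)] using noise_pos by (simp add: add_nonneg_pos)
qed

lemma Gstar_eq: "Gstar p F = minv (recv_cov F) * (Smat p F * Sigs p)"
  by (simp add: Gstar_def recv_cov_def)

lemma Gstar_carrier:
  assumes "shaped F"
  shows "Gstar p F \<in> carrier_mat (nM p) (nK p)"
  unfolding Gstar_eq using pd_minv(1)[OF recv_cov_pd[OF assms]] by (auto intro!: carrier_matI)

text \<open>The form of the receiver update that survives limits, since it contains no
  inverse.\<close>

lemma Gstar_normal_equation:
  assumes "shaped F"
  shows "recv_cov F * Gstar p F = Smat p F * Sigs p"
  unfolding Gstar_eq
  by (rule mat_mult_cancel_left[OF pd_minv(2)[OF recv_cov_pd[OF assms]]])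
    (use pd_minv(1)[OF recv_cov_pd[OF assms]] recv_cov_carrier[of F] in auto)

lemma MSE_receiver_upd:
  assumes F: "shaped F" and G: "G \<in> carrier_mat (nM p) (nK p)" and D: "D \<in> carrier_mat (nM p) (nK p)"
  shows "MSE p F (G + D) = MSE p F G
    + 2 * Re (mtrace ((recv_cov F * G - Smat p F * Sigs p) * mat_adjoint D))
    + hform (recv_cov F) (mat_adjoint D) (mat_adjoint D)"
proof -
  let ?S = "Smat p F" and ?A = "mat_adjoint G" and ?B = "mat_adjoint D"
  have AB: "?A \<in> carrier_mat (nK p) (nM p)" "?B \<in> carrier_mat (nK p) (nM p)" using G D by auto
  have d: "dim_row G = nM p" "dim_col G = nK p" "dim_row D = nM p" "dim_col D = nK p" using G D by auto
  \<comment> \<open>The objective as a function of the receiver alone: quadratic term, linear term,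
    constant. The two linear terms of the definition are conjugates of each other and merge under
    \<open>Re\<close>.\<close>
  have val: "MSE p F X = hform (recv_cov F) (mat_adjoint X) (mat_adjoint X)
      - 2 * Re (mtrace (mat_adjoint X * ?S * Sigs p)) + Re (mtrace (Sigs p))"
    if X: "X \<in> carrier_mat (nM p) (nK p)" for X
  proof -
    have X': "dim_row X = nM p" "dim_col X = nK p" using X by auto
    have adj: "mat_adjoint (mat_adjoint X * ?S * Sigs p) = Sigs p * mat_adjoint ?S * X"
      using X' Sigs_facts by (simp add: mat_adjoint_mult mat_assoc)
    have "Re (mtrace (Sigs p * mat_adjoint ?S * X)) = Re (mtrace (mat_adjoint X * ?S * Sigs p))"
      unfolding adj[symmetric] using X' by (subst mtrace_adjoint) auto
    moreover have "hform (Sigs p) (residual F X) (residual F X) = hform (Sigs p) (mat_adjoint X * ?S) (mat_adjoint X * ?S)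
        - Re (mtrace (mat_adjoint X * ?S * Sigs p)) - Re (mtrace (Sigs p * mat_adjoint ?S * X)) + Re (mtrace (Sigs p))"
      unfolding hform_def residual_def using X'
      by (simp add: mat_distribs mat_assoc mat_mult_one_left mat_mult_one_right mtrace_minus mtrace_add)
    ultimately show ?thesis
      using X unfolding MSE_hform[OF F X] by (subst recv_cov_form[OF F, of _ "nK p"]) auto
  qed
  have "hform (recv_cov F) (?A + ?B) (?A + ?B) = hform (recv_cov F) ?A ?A + 2 * hform (recv_cov F) ?A ?B
      + hform (recv_cov F) ?B ?B"
    by (rule hform_add_self[OF pd_hermitian[OF recv_cov_pd[OF F]] AB])
  moreover have "hform (recv_cov F) ?A ?B = Re (mtrace (recv_cov F * G * ?B))"
  proof -
    have "hform (recv_cov F) ?A ?B = hform (recv_cov F) ?B ?A"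
      by (rule hform_commute[OF pd_hermitian[OF recv_cov_pd[OF F]] AB])
    also have "\<dots> = Re (mtrace (?B * (recv_cov F * G)))"
      using d carrier_matD[OF recv_cov_carrier[of F]] by (simp add: hform_def mat_assoc)
    also have "mtrace (?B * (recv_cov F * G)) = mtrace (recv_cov F * G * ?B)"
      by (rule mtrace_mult_commute) (use d carrier_matD[OF recv_cov_carrier[of F]] in auto)
    finally show ?thesis .
  qed
  moreover have "mtrace (?B * ?S * Sigs p) = mtrace (?S * Sigs p * ?B)"
    using mtrace_mult_commute[of ?B "?S * Sigs p"] d by (simp add: mat_assoc)
  moreover have "mtrace (mat_adjoint (G + D) * ?S * Sigs p) = mtrace (?A * ?S * Sigs p) + mtrace (?B * ?S * Sigs p)"
    using d by (simp add: mat_adjoint_add mat_distrib_right mtrace_add del: assoc_mult_mat)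
  moreover have "mtrace ((recv_cov F * G - ?S * Sigs p) * ?B) = mtrace (recv_cov F * G * ?B) - mtrace (?S * Sigs p * ?B)"
    using d carrier_matD[OF recv_cov_carrier[of F]] by (simp add: mat_minus_distrib_right mtrace_minus del: assoc_mult_mat)
  ultimately show ?thesis
    using val[OF G] val[of "G + D"] G D d by (simp add: mat_adjoint_add del: assoc_mult_mat)
qed

text \<open>In the expansion around \<open>Gstar p F\<close> the linear term vanishes by the normal
  equation, and the remainder is nonnegative.\<close>

lemma Gstar_minimizes:
  assumes F: "shaped F" and G: "G \<in> carrier_mat (nM p) (nK p)"
  shows "MSE p F (Gstar p F) \<le> MSE p F G"
proof -
  note Gs = Gstar_carrier[OF F]
  have D: "G - Gstar p F \<in> carrier_mat (nM p) (nK p)" using G Gs by auto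
  have G_eq: "G = Gstar p F + (G - Gstar p F)" using G Gs by (intro eq_matI) auto
  have "Smat p F * Sigs p - Smat p F * Sigs p = 0\<^sub>m (nM p) (nK p)"
    by (intro eq_matI) (auto simp del: index_mult_mat(1))
  moreover have "0\<^sub>m (nM p) (nK p) * mat_adjoint (G - Gstar p F) = 0\<^sub>m (nM p) (nM p)"
    using D by (intro left_mult_zero_mat) auto
  ultimately have "mtrace ((recv_cov F * Gstar p F - Smat p F * Sigs p) * mat_adjoint (G - Gstar p F)) = 0"
    unfolding Gstar_normal_equation[OF F] by (simp add: mtrace_def)
  moreover have "0 \<le> hform (recv_cov F) (mat_adjoint (G - Gstar p F)) (mat_adjoint (G - Gstar p F))"
    using D by (intro hform_nonneg[OF pd_imp_psd[OF recv_cov_pd[OF F]], of _ "nK p"]) auto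
  ultimately show ?thesis
    using MSE_receiver_upd[OF F Gs D] G_eq by simp
qed

end

section \<open>Gradients of quadratic functions\<close>

text \<open>Along every line through \<open>X\<close> the function is a polynomial of degree two in
  the parameter, so each partial derivative is its linear coefficient; the homogeneous remainder
  contributes nothing at \<open>0\<close>.\<close>

lemma grad_app_quadratic:
  assumes X: "X \<in> carrier_mat m n" and Gam: "Gam \<in> carrier_mat m n" and D: "D \<in> carrier_mat m n"
    and expand: "\<And>V. V \<in> carrier_mat m n \<Longrightarrow> f (X + V) = f X + 2 * Re (mtrace (Gam * mat_adjoint V)) + q V"
    and homogeneous: "\<And>t V. V \<in> carrier_mat m n \<Longrightarrow> q (complex_of_real t \<cdot>\<^sub>m V) = t\<^sup>2 * q V"
  shows "grad_app f X D = 2 * Re (mtrace (Gam * mat_adjoint D))"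
proof -
  \<comment> \<open>The direction \<open>z = 1\<close> gives the partial derivative in the real part
    of the entry, \<open>z = \<i>\<close> the one in the imaginary part.\<close>
  have deriv: "deriv (\<lambda>t. f (add_entry X r c (complex_of_real t * z))) 0 = 2 * Re (Gam $$ (r, c) * cnj z)"
    if rc: "r < m" "c < n" for r c z
  proof -
    define V where "V = Matrix.mat m n (\<lambda>(a, b). if a = r \<and> b = c then z else 0)"
    have V: "V \<in> carrier_mat m n" by (simp add: V_def)
    have "mtrace (Gam * mat_adjoint V) = (\<Sum>a<m. \<Sum>b<n. if a = r \<and> b = c then Gam $$ (a, b) * cnj z else 0)"
      using Gam by (subst mtrace_mult) (auto simp: V_def intro!: sum.cong)
    also have "\<dots> = (\<Sum>a<m. if a = r then Gam $$ (a, c) * cnj z else 0)"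
      using rc by (intro sum.cong refl) (auto simp: sum.delta if_distrib cong: if_cong)
    also have "\<dots> = Gam $$ (r, c) * cnj z"
      using rc by simp
    finally have tr: "mtrace (Gam * mat_adjoint V) = Gam $$ (r, c) * cnj z" .
    have "add_entry X r c (complex_of_real t * z) = X + complex_of_real t \<cdot>\<^sub>m V" for t
      using X by (intro eq_matI) (auto simp: add_entry_def V_def)
    then have "(\<lambda>t. f (add_entry X r c (complex_of_real t * z))) =
        (\<lambda>t. f X + 2 * (t * Re (Gam $$ (r, c) * cnj z)) + t\<^sup>2 * q V)"
      using V Gam by (simp add: expand homogeneous mat_adjoint_smult mat_mult_smult mtrace_smult tr)
    moreover have "((\<lambda>t. f X + 2 * (t * Re (Gam $$ (r, c) * cnj z)) + t\<^sup>2 * q V) has_field_derivative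
        2 * Re (Gam $$ (r, c) * cnj z)) (at 0)"
      by (auto intro!: derivative_eq_intros)
    ultimately show ?thesis by (simp add: DERIV_imp_deriv)
  qed
  have dX: "dim_row X = m" "dim_col X = n" using X by auto
  have "grad_app f X D = (\<Sum>r<m. \<Sum>c<n. 2 * Re (Gam $$ (r, c) * cnj (D $$ (r, c))))"
    unfolding grad_app_def dX
  proof (intro sum.cong refl)
    fix r c assume "r \<in> {..<m}" "c \<in> {..<n}"
    then have rc: "r < m" "c < n" by auto
    show "deriv (\<lambda>t. f (add_entry X r c (complex_of_real t))) 0 * Re (D $$ (r, c)) +
        deriv (\<lambda>t. f (add_entry X r c (\<i> * complex_of_real t))) 0 * Im (D $$ (r, c)) =
        2 * Re (Gam $$ (r, c) * cnj (D $$ (r, c)))"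
    proof -
      have "(\<lambda>t. f (add_entry X r c (\<i> * complex_of_real t))) = (\<lambda>t. f (add_entry X r c (complex_of_real t * \<i>)))"
        by (simp only: mult.commute)
      then show ?thesis
        using deriv[OF rc, of 1] deriv[OF rc, of \<i>] by (simp add: algebra_simps)
    qed
  qed
  also have "\<dots> = 2 * Re (mtrace (Gam * mat_adjoint D))"
    using Gam D by (subst mtrace_mult) (auto simp: sum_distrib_left intro!: sum.cong)
  finally show ?thesis .
qed

section \<open>Convergence of matrices\<close>

text \<open>\<open>mat_tendsto\<close> fixes the size of the limit only; products and adjoints of
  the members need the size of every member as well.\<close>

definition mat_conv :: "nat \<Rightarrow> nat \<Rightarrow> (nat \<Rightarrow> complex mat) \<Rightarrow> complex mat \<Rightarrow> bool" where
  "mat_conv nr nc X A \<longleftrightarrow> (\<forall>n. X n \<in> carrier_mat nr nc) \<and> mat_tendsto nr nc X A"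

lemma mat_convD:
  assumes "mat_conv nr nc X A"
  shows "X n \<in> carrier_mat nr nc" "A \<in> carrier_mat nr nc" "dim_row (X n) = nr" "dim_col (X n) = nc"
    "dim_row A = nr" "dim_col A = nc" "r < nr \<Longrightarrow> c < nc \<Longrightarrow> (\<lambda>n. X n $$ (r, c)) \<longlonglongrightarrow> A $$ (r, c)"
proof -
  show "X n \<in> carrier_mat nr nc" "A \<in> carrier_mat nr nc" using assms by (auto simp: mat_conv_def mat_tendsto_def)
  then show "dim_row (X n) = nr" "dim_col (X n) = nc" "dim_row A = nr" "dim_col A = nc" by auto
qed (use assms in \<open>auto simp: mat_conv_def mat_tendsto_def\<close>)

lemma mat_convI:
  assumes "\<And>n. X n \<in> carrier_mat nr nc" "A \<in> carrier_mat nr nc"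
    "\<And>r c. r < nr \<Longrightarrow> c < nc \<Longrightarrow> (\<lambda>n. X n $$ (r, c)) \<longlonglongrightarrow> A $$ (r, c)"
  shows "mat_conv nr nc X A"
  using assms by (auto simp: mat_conv_def mat_tendsto_def)

lemma mat_conv_const: "A \<in> carrier_mat nr nc \<Longrightarrow> mat_conv nr nc (\<lambda>_. A) A"
  by (auto intro: mat_convI)

lemma mat_conv_add:
  assumes "mat_conv nr nc X A" "mat_conv nr nc Y B"
  shows "mat_conv nr nc (\<lambda>n. X n + Y n) (A + B)"
  using mat_convD[OF assms(1)] mat_convD[OF assms(2)]
  by (intro mat_convI carrier_matI) (simp_all add: tendsto_add)

lemma mat_conv_minus:
  assumes "mat_conv nr nc X A" "mat_conv nr nc Y B"
  shows "mat_conv nr nc (\<lambda>n. X n - Y n) (A - B)"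
  using mat_convD[OF assms(1)] mat_convD[OF assms(2)]
  by (intro mat_convI carrier_matI) (simp_all add: tendsto_diff)

lemma mat_conv_mult:
  assumes "mat_conv nr k X A" "mat_conv k nc Y B"
  shows "mat_conv nr nc (\<lambda>n. X n * Y n) (A * B)"
proof (rule mat_convI)
  note X = mat_convD[OF assms(1)] and Y = mat_convD[OF assms(2)]
  show "X n * Y n \<in> carrier_mat nr nc" for n by (rule mult_carrier_mat[OF X(1) Y(1)])
  show "A * B \<in> carrier_mat nr nc" by (rule mult_carrier_mat[OF X(2) Y(2)])
  fix r c assume rc: "r < nr" "c < nc"
  have "(\<lambda>n. \<Sum>l<k. X n $$ (r, l) * Y n $$ (l, c)) \<longlonglongrightarrow> (\<Sum>l<k. A $$ (r, l) * B $$ (l, c))"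
    using rc by (intro tendsto_sum tendsto_mult X(7) Y(7)) auto
  then show "(\<lambda>n. (X n * Y n) $$ (r, c)) \<longlonglongrightarrow> (A * B) $$ (r, c)"
    using rc X(3-6) Y(3-6) by (simp add: mat_mult_index del: index_mult_mat(1))
qed

lemma mat_conv_adjoint:
  assumes "mat_conv nr nc X A"
  shows "mat_conv nc nr (\<lambda>n. mat_adjoint (X n)) (mat_adjoint A)"
  using mat_convD[OF assms]
  by (intro mat_convI carrier_matI) (simp_all add: tendsto_cnj)

lemma mat_conv_msum:
  assumes "\<And>i. i \<in> I \<Longrightarrow> mat_conv nr nc (X i) (A i)"
  shows "mat_conv nr nc (\<lambda>n. msum nr nc (\<lambda>i. X i n) I) (msum nr nc A I)"
  using mat_convD(7)[OF assms]
  by (intro mat_convI carrier_matI) (simp_all add: tendsto_sum)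

lemma mat_conv_mtrace:
  assumes "mat_conv k k X A"
  shows "(\<lambda>n. mtrace (X n)) \<longlonglongrightarrow> mtrace A"
  unfolding mtrace_def mat_convD(3,5)[OF assms]
  using mat_convD(7)[OF assms] by (intro tendsto_sum) auto

lemma mat_conv_hform:
  assumes "S \<in> carrier_mat k k" "mat_conv m k X A" "mat_conv m k Y B"
  shows "(\<lambda>n. hform S (X n) (Y n)) \<longlonglongrightarrow> hform S A B"
  unfolding hform_def
  by (intro tendsto_Re mat_conv_mtrace[of m] mat_conv_mult[of _ k] assms(2) mat_conv_adjoint assms(3)
      mat_conv_const assms(1))

lemma mat_conv_unique:
  assumes "mat_conv nr nc X A" "mat_conv nr nc X B"
  shows "A = B"
proof (rule eq_matI)
  fix r c assume "r < dim_row B" "c < dim_col B"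
  then have "r < nr" "c < nc" using mat_convD(5,6)[OF assms(2)] by auto
  then show "A $$ (r, c) = B $$ (r, c)"
    using LIMSEQ_unique[OF mat_convD(7)[OF assms(1)] mat_convD(7)[OF assms(2)]] by blast
qed (use mat_convD(5,6)[OF assms(1)] mat_convD(5,6)[OF assms(2)] in auto)

text \<open>Bolzano-Weierstrass is applied to one scalar sequence after another, refining the
  subsequence each time; earlier limits persist. Working with scalar entries avoids a compactness
  argument for matrices of varying size.\<close>

lemma common_convergent_subsequence:
  fixes u :: "'a \<Rightarrow> nat \<Rightarrow> complex"
  assumes "finite I" "\<And>a. a \<in> I \<Longrightarrow> bounded (range (u a))"
  shows "\<exists>s. strict_mono s \<and> (\<forall>a\<in>I. convergent (\<lambda>n. u a (s n)))"
  using assms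
proof (induction I rule: finite_induct)
  case empty
  then show ?case by (auto intro: exI[of _ id] simp: strict_mono_def)
next
  case (insert b I)
  then obtain s where s: "strict_mono s" "\<forall>a\<in>I. convergent (\<lambda>n. u a (s n))" by auto
  have "bounded (range (\<lambda>n. u b (s n)))"
    using insert.prems[of b] by (rule bounded_subset) auto
  then obtain l r where r: "strict_mono r" "((\<lambda>n. u b (s n)) \<circ> r) \<longlonglongrightarrow> l"
    using bounded_imp_convergent_subsequence by blast
  have "convergent (\<lambda>n. u a (s (r n)))" if "a \<in> I" for a
    using convergent_subseq_convergent[OF _ r(1), of "\<lambda>n. u a (s n)"] s(2) that by (simp add: o_def)
  moreover have "convergent (\<lambda>n. u b (s (r n)))"
    using r(2) by (auto simp: convergent_def o_def)
  ultimately show ?case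
    using strict_mono_o[OF s(1) r(1), unfolded o_def] by (intro exI[of _ "\<lambda>n. s (r n)"]) auto
qed

text \<open>With \<open>R\<close> the square root of \<open>T\<close>, the form at \<open>X\<close>
  is the squared Frobenius norm of \<open>X * R\<close>, and \<open>X\<close> is recovered by
  multiplication with the fixed matrix \<open>W\<close>.\<close>

lemma pd_hform_entry_bound:
  assumes T: "pd_mat n T"
  shows "\<exists>C. \<forall>X\<in>carrier_mat m n. hform T X X \<le> P \<longrightarrow> (\<forall>r<m. \<forall>c<n. cmod (X $$ (r, c)) \<le> C)"
proof -
  define R where "R = msqrt T"
  define W where "W = minv_sqrt T"
  have R: "R \<in> carrier_mat n n" "R * R = T" "mat_adjoint R = R" and W: "W \<in> carrier_mat n n" "R * W = 1\<^sub>m n"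
    using minv_sqrt_pd[OF T] by (auto simp: R_def W_def)
  \<comment> \<open>Column \<open>c\<close> of \<open>W\<close> alone bounds the entries in column
    \<open>c\<close> of \<open>X\<close>; summing over all columns makes the constant
    uniform.\<close>
  define C where "C = (\<Sum>c<n. \<Sum>k<n. sqrt P * cmod (W $$ (k, c)))"
  have "cmod (X $$ (r, c)) \<le> C" if X: "X \<in> carrier_mat m n" and P: "hform T X X \<le> P" and rc: "r < m" "c < n" for X r c
  proof -
    have XR: "X * R \<in> carrier_mat m n" using X R by auto
    have "hform T X X = hform (1\<^sub>m n) (X * R) (X * R)"
      using X R by (simp add: hform_def mat_adjoint_mult mat_assoc mat_mult_one_left flip: R(2))
    then have sum: "(\<Sum>r<m. \<Sum>k<n. (cmod ((X * R) $$ (r, k)))\<^sup>2) \<le> P"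
      using P hform_one_self[OF XR] by simp
    have entry: "cmod ((X * R) $$ (r, k)) \<le> sqrt P" if k: "k < n" for k
    proof -
      have "(cmod ((X * R) $$ (r, k)))\<^sup>2 \<le> (\<Sum>k<n. (cmod ((X * R) $$ (r, k)))\<^sup>2)"
        using k by (intro member_le_sum[of k "{..<n}" "\<lambda>k. (cmod ((X * R) $$ (r, k)))\<^sup>2"]) auto
      also have "\<dots> \<le> (\<Sum>r<m. \<Sum>k<n. (cmod ((X * R) $$ (r, k)))\<^sup>2)"
        using rc by (intro member_le_sum[of r "{..<m}" "\<lambda>r. \<Sum>k<n. (cmod ((X * R) $$ (r, k)))\<^sup>2"]) (auto intro: sum_nonneg)
      finally show ?thesis using sum by (intro real_le_rsqrt) simp
    qed
    \<comment> \<open>\<open>sqrt\<close> is negative at negative arguments, so its sign is read off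
      from the bound just proved.\<close>
    have P0: "0 \<le> sqrt P" using entry[of c] rc norm_ge_zero order_trans by blast
    have "X = (X * R) * W" using X R W by (simp add: mat_assoc mat_mult_one_right)
    then have "X $$ (r, c) = ((X * R) * W) $$ (r, c)" by simp
    also have "\<dots> = (\<Sum>k<n. (X * R) $$ (r, k) * W $$ (k, c))"
      using X R W rc by (subst mat_mult_index) auto
    finally have "cmod (X $$ (r, c)) \<le> (\<Sum>k<n. cmod ((X * R) $$ (r, k)) * cmod (W $$ (k, c)))"
      by (metis (no_types, lifting) norm_mult norm_sum sum.cong)
    also have "\<dots> \<le> (\<Sum>k<n. sqrt P * cmod (W $$ (k, c)))"
      using entry by (intro sum_mono mult_right_mono) auto
    also have "\<dots> \<le> C"
      unfolding C_def using rc P0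
      by (intro member_le_sum[of c "{..<n}" "\<lambda>c. \<Sum>k<n. sqrt P * cmod (W $$ (k, c))"]) (auto intro: sum_nonneg)
    finally show ?thesis .
  qed
  then show ?thesis by blast
qed

section \<open>Descent along one pass\<close>

context bf_setting
begin

lemma mse_lin_minus:
  assumes "shaped F" "i \<in> {1..nL p}" "D \<in> carrier_mat (nN p i) (nJ p i)" "D' \<in> carrier_mat (nN p i) (nJ p i)"
    "G \<in> carrier_mat (nM p) (nK p)"
  shows "mse_lin F G i (D - D') = mse_lin F G i D - mse_lin F G i D'"
proof -
  have DD: "D - D' \<in> carrier_mat (nN p i) (nJ p i)" using assms by auto
  show ?thesis
    using carrier_matD[OF mse_grad_carrier[OF assms(1,2,5)]] assms(3,4)
    unfolding mse_lin_grad[OF assms(1,2,3,5)] mse_lin_grad[OF assms(1,2,4,5)] mse_lin_grad[OF assms(1,2) DD assms(5)]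
    by (simp add: mat_distribs mtrace_minus)
qed

text \<open>The objective is expanded around the new point, back towards the old one: the decrease
  \<open>d\<close> is the linear plus the quadratic term of \<open>F i - Fi\<close>. The linear term
  is nonnegative by the variational inequality tested with the old block, so each of the two is at
  most \<open>d\<close>. For the last claim, starting the test direction at \<open>F i\<close>
  instead of \<open>Fi\<close> therefore costs at most \<open>d\<close>.\<close>

lemma beamformer_update_step:
  assumes F: "feasible p F" and i: "i \<in> {1..nL p}" and G: "G \<in> carrier_mat (nM p) (nK p)"
    and upd: "beamformer_update p G F i Fi"
  defines "F' \<equiv> F(i := Fi)"
  defines "d \<equiv> MSE p F G - MSE p F' G"
  shows "feasible p F'" "mse_quad G i (F i - Fi) \<le> d"
    "\<And>Y. Y \<in> carrier_mat (nN p i) (nJ p i) \<Longrightarrow> hform (tx_cov p i) Y Y \<le> budget p i \<Longrightarrow>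
      - d \<le> mse_lin F' G i (Y - F i)"
proof -
  have sF: "shaped F" and power: "\<And>j. j \<in> {1..nL p} \<Longrightarrow> hform (tx_cov p j) (F j) (F j) \<le> budget p j"
    using F by (auto simp: feasible_iff)
  have Fi: "Fi \<in> carrier_mat (nN p i) (nJ p i)" using upd by (simp add: beamformer_update_def)
  note Fic = shaped_dim(1)[OF sF i]
  have sF': "shaped F'" using shaped_upd[OF sF Fi] by (simp add: F'_def)
  obtain mu where "hform (tx_cov p i) Fi Fi \<le> budget p i"
    using beamformer_update_KKT[OF sF i G upd] .
  then show "feasible p F'" using power sF' by (auto simp: feasible_iff F'_def)
  have restore: "F'(i := F i) = F" by (simp add: F'_def)
  have var: "0 \<le> mse_lin F' G i (Y - Fi)"
    if "Y \<in> carrier_mat (nN p i) (nJ p i)" "hform (tx_cov p i) Y Y \<le> budget p i" for Y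
    using beamformer_update_variational[OF sF i G upd that] by (simp add: F'_def)
  have d: "d = mse_lin F' G i (F i - Fi) + mse_quad G i (F i - Fi)"
    using MSE_upd[OF sF' i Fic G] unfolding restore d_def by (simp add: F'_def)
  have Dc: "F i - Fi \<in> carrier_mat (nN p i) (nJ p i)" using Fi Fic by auto
  show "mse_quad G i (F i - Fi) \<le> d"
    using d var[OF Fic power[OF i]] by simp
  fix Y assume Y: "Y \<in> carrier_mat (nN p i) (nJ p i)" "hform (tx_cov p i) Y Y \<le> budget p i"
  have "Y - F i = (Y - Fi) - (F i - Fi)" using Y Fi Fic by (intro eq_matI) auto
  then have "mse_lin F' G i (Y - F i) = mse_lin F' G i (Y - Fi) - mse_lin F' G i (F i - Fi)"
    using mse_lin_minus[OF sF' i _ Dc G, of "Y - Fi"] Y Fi by (simp add: minus_carrier_mat)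
  then show "- d \<le> mse_lin F' G i (Y - F i)"
    using d var[OF Y] mse_quad_nonneg[OF i Dc G] by simp
qed

text \<open>A change of one block that is small in the quadratic form of the objective changes the
  partial gradients of all blocks only slightly, even where that form is degenerate.\<close>

lemma mse_lin_perturbation:
  assumes F: "shaped F" and l: "l \<in> {1..nL p}" and i: "i \<in> {1..nL p}" and G: "G \<in> carrier_mat (nM p) (nK p)"
    and Y: "Y \<in> carrier_mat (nN p l) (nJ p l)" and D: "D \<in> carrier_mat (nN p i) (nJ p i)"
  shows "\<bar>mse_lin (F(l := Y)) G i D - mse_lin F G i D\<bar> \<le> 4 * sqrt (mse_quad G l (Y - F l) * mse_quad G i D)"
proof -
  let ?Z = "mat_adjoint G * (Hmat p i * D)" and ?V = "mat_adjoint G * (Hmat p l * (Y - F l))"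
  have V: "Y - F l \<in> carrier_mat (nN p l) (nJ p l)" using Y shaped_dim[OF F l] by auto
  note cZ = received_carrier[OF i D G] and cV = received_carrier[OF l V G]
  note qZ = mse_quad_parts[OF i D G] and qV = mse_quad_parts[OF l V G]
  let ?s = "sqrt (mse_quad G l (Y - F l) * mse_quad G i D)"
  have 1: "\<bar>hform (Sigs p) (?V * Kmat p l) (?Z * Kmat p i)\<bar> \<le> ?s"
  proof -
    have "\<bar>hform (Sigs p) (?V * Kmat p l) (?Z * Kmat p i)\<bar> \<le> sqrt (hform (Sigs p) (?V * Kmat p l) (?V * Kmat p l)
        * hform (Sigs p) (?Z * Kmat p i) (?Z * Kmat p i))"
      by (rule hform_Cauchy_Schwarz[OF Sigs_psd cV(2) cZ(2)])
    also have "\<dots> \<le> ?s"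
      unfolding mse_quad_def using qZ qV by (intro real_sqrt_le_mono mult_mono) auto
    finally show ?thesis .
  qed
  have first: "hform (Sigs p) (residual (F(l := Y)) G) (?Z * Kmat p i) =
      hform (Sigs p) (residual F G) (?Z * Kmat p i) + hform (Sigs p) (?V * Kmat p l) (?Z * Kmat p i)"
    unfolding residual_upd[OF F l Y G]
    by (rule hform_add_left[OF Sigs_facts(1) residual_carrier cV(2) cZ(2)])
  have second: "\<bar>hform (Sig p i) (mat_adjoint G * (Hmat p i * (F(l := Y)) i)) ?Z
      - hform (Sig p i) (mat_adjoint G * (Hmat p i * F i)) ?Z\<bar> \<le> ?s"
  \<comment> \<open>The observation-noise term of block \<open>i\<close> is affected only by a
    change of that same block.\<close>
  proof (cases "l = i")
    case False
    then show ?thesis using mse_quad_nonneg[OF i D G] mse_quad_nonneg[OF l V G] by simp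
  next
    case True
    have "Y = F i + (Y - F i)" using Y shaped_dim[OF F i] True by (intro eq_matI) auto
    then have "mat_adjoint G * (Hmat p i * Y) = mat_adjoint G * (Hmat p i * (F i + (Y - F i)))" by simp
    also have "\<dots> = mat_adjoint G * (Hmat p i * F i) + mat_adjoint G * (Hmat p i * (Y - F i))"
      using Y shaped_dim[OF F i] True G i by (simp add: mat_distrib_left)
    finally have split: "mat_adjoint G * (Hmat p i * Y) = \<dots>" .
    have cV': "?V \<in> carrier_mat (nK p) (nJ p i)" using cV(1) True by simp
    have "mat_adjoint G * (Hmat p i * Y) = mat_adjoint G * (Hmat p i * F i) + ?V" using split True by simp
    then have sum: "hform (Sig p i) (mat_adjoint G * (Hmat p i * Y)) ?Z =
        hform (Sig p i) (mat_adjoint G * (Hmat p i * F i)) ?Z + hform (Sig p i) ?V ?Z"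
      using hform_add_left[OF Sig_facts(1)[OF i] received_carrier(1)[OF i shaped_dim(1)[OF F i] G] cV' cZ(1)]
      by simp
    have "\<bar>hform (Sig p i) ?V ?Z\<bar> \<le> sqrt (hform (Sig p i) ?V ?V * hform (Sig p i) ?Z ?Z)"
      by (rule hform_Cauchy_Schwarz[OF block_facts(3)[OF i] cV' cZ(1)])
    also have "\<dots> \<le> ?s"
      unfolding mse_quad_def using qZ qV True by (intro real_sqrt_le_mono mult_mono) auto
    finally have "\<bar>hform (Sig p i) ?V ?Z\<bar> \<le> ?s" .
    then show ?thesis using True sum by simp
  qed
  \<comment> \<open>Two terms, each changed by at most \<open>?s\<close>, and the factor
    \<open>2\<close> in \<open>mse_lin\<close> give the constant \<open>4\<close>.\<close>
  show ?thesis
    unfolding mse_lin_def first using 1 second by (simp add: abs_le_iff)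
qed

text \<open>Block \<open>i\<close> satisfies its inequality at \<open>X i\<close>, after
  \<open>i\<close> updates. The derivative is carried back to \<open>F\<close> one update at a time,
  at a price governed by the decrease of the pass; hence the factor \<open>nL p\<close> in the
  error.\<close>

lemma inner_pass_descent:
  assumes F: "feasible p F" and G: "G \<in> carrier_mat (nM p) (nK p)" and pass: "inner_pass p G F F'"
  defines "d \<equiv> MSE p F G - MSE p F' G"
  shows "feasible p F'" "0 \<le> d"
    "\<And>i Y. i \<in> {1..nL p} \<Longrightarrow> Y \<in> carrier_mat (nN p i) (nJ p i) \<Longrightarrow> hform (tx_cov p i) Y Y \<le> budget p i \<Longrightarrow>
      - d - 4 * nL p * sqrt (d * mse_quad G i (Y - F i)) \<le> mse_lin F G i (Y - F i)"
proof -
  obtain X where X0: "X 0 = F" and XL: "X (nL p) = F'"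
    and step: "\<And>i. i \<in> {1..nL p} \<Longrightarrow> \<exists>Fi. beamformer_update p G (X (i - 1)) i Fi \<and> X i = (X (i - 1))(i := Fi)"
    using pass unfolding inner_pass_def by blast
  have step': "\<exists>Fi. beamformer_update p G (X l) (Suc l) Fi \<and> X (Suc l) = (X l)(Suc l := Fi)" if "l < nL p" for l
    using step[of "Suc l"] that by (auto simp: One_nat_def)
  have S: "Suc l \<in> {1..nL p}" if "l < nL p" for l using that by (auto simp: One_nat_def)
  \<comment> \<open>Blocks beyond \<open>l\<close> still have their initial values; so block
    \<open>i\<close> enters its own update as \<open>F i\<close>, and the test direction there is
    \<open>Y - F i\<close>.\<close>
  have inv: "feasible p (X l) \<and> (\<forall>j>l. X l j = F j)" if "l \<le> nL p" for l
    using that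
  proof (induction l)
    case 0
    then show ?case using F X0 by simp
  next
    case (Suc l)
    then have l: "l < nL p" by simp
    obtain Fi where Fi: "beamformer_update p G (X l) (Suc l) Fi" "X (Suc l) = (X l)(Suc l := Fi)"
      using step'[OF l] by blast
    have "feasible p (X (Suc l))"
      using Suc beamformer_update_step(1)[OF _ S[OF l] G Fi(1)] unfolding Fi(2) by simp
    moreover have "\<forall>j>Suc l. X (Suc l) j = F j"
      using Suc unfolding Fi(2) by simp
    ultimately show ?case by simp
  qed
  define e where "e l = MSE p (X l) G - MSE p (X (Suc l)) G" for l
  have e: "0 \<le> e l" if l: "l < nL p" for l
  proof -
    obtain Fi where Fi: "beamformer_update p G (X l) (Suc l) Fi" "X (Suc l) = (X l)(Suc l := Fi)"
      using step'[OF l] by blast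
    have f: "feasible p (X l)" using inv[of l] l by simp
    then have "shaped (X l)" by (simp add: feasible_iff)
    moreover have "Fi \<in> carrier_mat (nN p (Suc l)) (nJ p (Suc l))"
      using Fi(1) by (simp add: beamformer_update_def)
    ultimately have "X l (Suc l) - Fi \<in> carrier_mat (nN p (Suc l)) (nJ p (Suc l))"
      by (intro minus_carrier_mat)
    from mse_quad_nonneg[OF S[OF l] this G] beamformer_update_step(2)[OF f S[OF l] G Fi(1)]
    show ?thesis by (simp add: e_def Fi(2))
  qed
  have d_sum: "d = (\<Sum>l<nL p. e l)"
  proof -
    have "(\<Sum>l<n. e l) = MSE p (X 0) G - MSE p (X n) G" for n
      by (induction n) (auto simp: e_def)
    then show ?thesis by (simp add: d_def X0 XL)
  qed
  have e_le: "e l \<le> d" if "l < nL p" for l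
    unfolding d_sum using that e by (intro member_le_sum) auto
  show "feasible p F'" using inv[of "nL p"] XL by simp
  show "0 \<le> d" unfolding d_sum using e by (intro sum_nonneg) auto
  fix i Y assume i: "i \<in> {1..nL p}" and Y: "Y \<in> carrier_mat (nN p i) (nJ p i)" "hform (tx_cov p i) Y Y \<le> budget p i"
  define D where "D = Y - F i"
  have sF: "shaped F" using F by (simp add: feasible_iff)
  have D: "D \<in> carrier_mat (nN p i) (nJ p i)" unfolding D_def by (rule minus_carrier_mat[OF shaped_dim(1)[OF sF i]])
  \<comment> \<open>Each update has a step whose quadratic form is at most its own decrease
    \<open>e l\<close>, hence at most the total \<open>d\<close>.\<close>
  have drift: "\<bar>mse_lin (X l) G i D - mse_lin F G i D\<bar> \<le> l * (4 * sqrt (d * mse_quad G i D))" if "l \<le> nL p" for l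
    using that
  proof (induction l)
    case 0
    then show ?case by (simp add: X0)
  next
    case (Suc l)
    then have l: "l < nL p" by simp
    obtain Fi where Fi: "beamformer_update p G (X l) (Suc l) Fi" "X (Suc l) = (X l)(Suc l := Fi)"
      using step'[OF l] by blast
    have f: "feasible p (X l)" "feasible p (X (Suc l))" using inv[of l] inv[of "Suc l"] l by auto
    then have s: "shaped (X l)" "shaped (X (Suc l))" by (auto simp: feasible_iff)
    \<comment> \<open>The perturbation bound is applied backwards, because
      \<open>beamformer_update_step\<close> controls the quadratic form at old minus new.\<close>
    have "X l = (X (Suc l))(Suc l := X l (Suc l))" by (simp add: Fi(2))
    then have "\<bar>mse_lin (X l) G i D - mse_lin (X (Suc l)) G i D\<bar>
        \<le> 4 * sqrt (mse_quad G (Suc l) (X l (Suc l) - X (Suc l) (Suc l)) * mse_quad G i D)"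
      using mse_lin_perturbation[OF s(2) S[OF l] i G shaped_dim(1)[OF s(1) S[OF l]] D] by simp
    also have "\<dots> \<le> 4 * sqrt (d * mse_quad G i D)"
      using beamformer_update_step(2)[OF f(1) S[OF l] G Fi(1)] e_le[OF l] mse_quad_nonneg[OF i D G]
      by (intro mult_left_mono real_sqrt_le_mono mult_right_mono) (auto simp: e_def Fi(2))
    finally show ?case using Suc by (simp add: algebra_simps)
  qed
  obtain l where l: "i = Suc l" "l < nL p" using i by (cases i) (auto simp: One_nat_def)
  obtain Fi where Fi: "beamformer_update p G (X l) i Fi" "X i = (X l)(i := Fi)"
    using step'[OF l(2)] unfolding l(1)[symmetric] by blast
  have f: "feasible p (X l)" "X l i = F i" using inv[of l] l by auto
  have "- d \<le> - e l" using e_le[OF l(2)] by simp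
  also have "\<dots> \<le> mse_lin (X i) G i D"
    using beamformer_update_step(3)[OF f(1) i G Fi(1) Y] unfolding Fi(2)[symmetric] f(2)
    by (simp only: e_def D_def l(1)[symmetric])
  also have "\<dots> \<le> mse_lin F G i D + i * (4 * sqrt (d * mse_quad G i D))"
    using drift[of i] i by auto
  also have "i * (4 * sqrt (d * mse_quad G i D)) \<le> nL p * (4 * sqrt (d * mse_quad G i D))"
    using i \<open>0 \<le> d\<close> mse_quad_nonneg[OF i D G] by (intro mult_right_mono) auto
  finally show "- d - 4 * nL p * sqrt (d * mse_quad G i (Y - F i)) \<le> mse_lin F G i (Y - F i)"
    by (simp add: D_def)
qed

text \<open>The number of passes is unknown and only the first starts at an outer iterate. That pass
  is singled out; all later ones keep the same receiver and can only lower the objective.\<close>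

lemma inner_loop_descent:
  assumes "inner_loop p sm G F F''" "feasible p F" "G \<in> carrier_mat (nM p) (nK p)"
  shows "feasible p F'' \<and> (\<exists>F'. inner_pass p G F F' \<and> MSE p F'' G \<le> MSE p F' G)"
  using assms
proof (induction rule: inner_loop.induct)
  case (stop F F')
  then show ?case using inner_pass_descent(1)[of F G F'] by blast
next
  case (again F F' F'')
  have F': "feasible p F'" using inner_pass_descent(1)[OF again.prems(1,2) again.hyps(1)] .
  with again obtain F1 where F1: "feasible p F''" "inner_pass p G F' F1" "MSE p F'' G \<le> MSE p F1 G" by blast
  have "MSE p F1 G \<le> MSE p F' G" using inner_pass_descent(2)[OF F' again.prems(2) F1(2)] by simp
  then show ?case using F1 again.hyps(1) by (intro conjI exI[of _ F']) auto
qed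

section \<open>Continuity of the derivatives and of the normal equation\<close>

lemma Smat_conv:
  assumes "\<And>i. i \<in> {1..nL p} \<Longrightarrow> mat_conv (nN p i) (nJ p i) (\<lambda>n. F n i) (Fl i)"
  shows "mat_conv (nM p) (nK p) (\<lambda>n. Smat p (F n)) (Smat p Fl)"
  unfolding Smat_def
proof (rule mat_conv_msum)
  fix i assume i: "i \<in> {1..nL p}"
  show "mat_conv (nM p) (nK p) (\<lambda>n. Hmat p i * F n i * Kmat p i) (Hmat p i * Fl i * Kmat p i)"
    by (rule mat_conv_mult[OF mat_conv_mult[OF mat_conv_const[OF block_facts(2)[OF i]] assms[OF i]]
          mat_conv_const[OF block_facts(1)[OF i]]])
qed

lemma received_conv:
  assumes "i \<in> {1..nL p}" "mat_conv (nM p) (nK p) G Gl" "mat_conv (nN p i) (nJ p i) D Dl"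
  shows "mat_conv (nK p) (nJ p i) (\<lambda>n. mat_adjoint (G n) * (Hmat p i * D n)) (mat_adjoint Gl * (Hmat p i * Dl))"
  by (intro mat_conv_mult[of _ "nM p"] mat_conv_mult[of _ "nN p i"] mat_conv_adjoint mat_conv_const assms block_facts)

lemma mse_lin_conv:
  assumes F: "\<And>i. i \<in> {1..nL p} \<Longrightarrow> mat_conv (nN p i) (nJ p i) (\<lambda>n. F n i) (Fl i)"
    and G: "mat_conv (nM p) (nK p) G Gl" and i: "i \<in> {1..nL p}" and D: "mat_conv (nN p i) (nJ p i) D Dl"
  shows "(\<lambda>n. mse_lin (F n) (G n) i (D n)) \<longlonglongrightarrow> mse_lin Fl Gl i Dl"
proof -
  have "mat_conv (nK p) (nK p) (\<lambda>n. residual (F n) (G n)) (residual Fl Gl)"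
    unfolding residual_def
    by (intro mat_conv_minus mat_conv_mult[of _ "nM p"] mat_conv_adjoint G Smat_conv F mat_conv_const) auto
  then show ?thesis
    unfolding mse_lin_def
    by (intro tendsto_intros mat_conv_hform[of _ "nK p" "nK p"] mat_conv_hform[of _ "nJ p i" "nK p"]
        Sigs_facts Sig_facts received_conv mat_conv_mult[of _ "nJ p i"] mat_conv_const block_facts i G D F)
qed

lemma mse_quad_conv:
  assumes G: "mat_conv (nM p) (nK p) G Gl" and i: "i \<in> {1..nL p}" and D: "mat_conv (nN p i) (nJ p i) D Dl"
  shows "(\<lambda>n. mse_quad (G n) i (D n)) \<longlonglongrightarrow> mse_quad Gl i Dl"
  unfolding mse_quad_def
  by (intro tendsto_intros mat_conv_hform[of _ "nK p" "nK p"] mat_conv_hform[of _ "nJ p i" "nK p"]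
      Sigs_facts Sig_facts received_conv mat_conv_mult[of _ "nJ p i"] mat_conv_const block_facts i G D)

lemma recv_cov_conv:
  assumes F: "\<And>i. i \<in> {1..nL p} \<Longrightarrow> mat_conv (nN p i) (nJ p i) (\<lambda>n. F n i) (Fl i)"
  shows "mat_conv (nM p) (nM p) (\<lambda>n. recv_cov (F n)) (recv_cov Fl)"
  unfolding recv_cov_def
proof (intro mat_conv_add mat_conv_msum)
  show "mat_conv (nM p) (nM p) (\<lambda>n. Smat p (F n) * Sigs p * mat_adjoint (Smat p (F n)))
      (Smat p Fl * Sigs p * mat_adjoint (Smat p Fl))"
    by (intro mat_conv_mult[of _ "nK p"] mat_conv_adjoint mat_conv_const Sigs_facts Smat_conv F)
  show "mat_conv (nM p) (nM p) (\<lambda>n. complex_of_real (noise p) \<cdot>\<^sub>m 1\<^sub>m (nM p)) (complex_of_real (noise p) \<cdot>\<^sub>m 1\<^sub>m (nM p))"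
    by (intro mat_conv_const) auto
  fix i assume i: "i \<in> {1..nL p}"
  show "mat_conv (nM p) (nM p)
      (\<lambda>n. Hmat p i * F n i * Sig p i * mat_adjoint (F n i) * mat_adjoint (Hmat p i))
      (Hmat p i * Fl i * Sig p i * mat_adjoint (Fl i) * mat_adjoint (Hmat p i))"
    by (rule mat_conv_mult[OF mat_conv_mult[OF mat_conv_mult[OF mat_conv_mult[OF
          mat_conv_const[OF block_facts(2)[OF i]] F[OF i]] mat_conv_const[OF Sig_facts(1)[OF i]]]
          mat_conv_adjoint[OF F[OF i]]] mat_conv_adjoint[OF mat_conv_const[OF block_facts(2)[OF i]]]])
qed

section \<open>Stationarity of limit points\<close>

lemma mse_quad_smult:
  assumes "i \<in> {1..nL p}" "V \<in> carrier_mat (nN p i) (nJ p i)" "G \<in> carrier_mat (nM p) (nK p)"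
  shows "mse_quad G i (complex_of_real t \<cdot>\<^sub>m V) = t\<^sup>2 * mse_quad G i V"
proof -
  have "mat_adjoint G * (Hmat p i * (complex_of_real t \<cdot>\<^sub>m V)) = complex_of_real t \<cdot>\<^sub>m (mat_adjoint G * (Hmat p i * V))"
    "mat_adjoint G * (Hmat p i * (complex_of_real t \<cdot>\<^sub>m V)) * Kmat p i
      = complex_of_real t \<cdot>\<^sub>m (mat_adjoint G * (Hmat p i * V) * Kmat p i)"
    using assms by (simp_all add: mat_mult_smult mat_smult_mult)
  moreover have "hform S (complex_of_real t \<cdot>\<^sub>m X) (complex_of_real t \<cdot>\<^sub>m X) = t\<^sup>2 * hform S X X"
    if "S \<in> carrier_mat k k" "X \<in> carrier_mat l k" for S X k l
    using that by (simp add: hform_smult_left[of S k _ l] hform_smult_right[of S k _ l] power2_eq_square)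
  ultimately show ?thesis
    unfolding mse_quad_def using received_carrier[OF assms] Sigs_facts(1) Sig_facts(1)[OF assms(1)]
    by (simp add: distrib_left)
qed

lemma grad_app_beamformer:
  assumes F: "shaped F" and i: "i \<in> {1..nL p}" and D: "D \<in> carrier_mat (nN p i) (nJ p i)"
    and G: "G \<in> carrier_mat (nM p) (nK p)"
  shows "grad_app (\<lambda>Y. MSE p (F(i := Y)) G) (F i) D = mse_lin F G i D"
  unfolding mse_lin_grad[OF F i D G]
proof (rule grad_app_quadratic[where q = "mse_quad G i"])
  note Fi = shaped_dim[OF F i]
  show "F i \<in> carrier_mat (nN p i) (nJ p i)" "mse_grad F G i \<in> carrier_mat (nN p i) (nJ p i)"
    using Fi mse_grad_carrier[OF F i G] by auto
  fix V :: "complex mat"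
  assume V: "V \<in> carrier_mat (nN p i) (nJ p i)"
  have "F i + V - F i = V" using V Fi by (intro eq_matI) auto
  then show "MSE p (F(i := F i + V)) G = MSE p (F(i := F i)) G
      + 2 * Re (mtrace (mse_grad F G i * mat_adjoint V)) + mse_quad G i V"
    using MSE_upd[OF F i _ G, of "F i + V"] V Fi by (simp add: mse_lin_grad[OF F i V G])
  show "mse_quad G i (complex_of_real t \<cdot>\<^sub>m V) = t\<^sup>2 * mse_quad G i V" for t
    by (rule mse_quad_smult[OF i V G])
qed (rule D)

lemma grad_app_receiver:
  assumes F: "shaped F" and G: "G \<in> carrier_mat (nM p) (nK p)" and D: "D \<in> carrier_mat (nM p) (nK p)"
  shows "grad_app (\<lambda>Y. MSE p F Y) G D = 2 * Re (mtrace ((recv_cov F * G - Smat p F * Sigs p) * mat_adjoint D))"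
proof (rule grad_app_quadratic[where q = "\<lambda>V. hform (recv_cov F) (mat_adjoint V) (mat_adjoint V)"])
  show "recv_cov F * G - Smat p F * Sigs p \<in> carrier_mat (nM p) (nK p)"
    using G recv_cov_carrier[of F] by (auto intro!: carrier_matI)
  fix V :: "complex mat" assume V: "V \<in> carrier_mat (nM p) (nK p)"
  show "MSE p F (G + V) = MSE p F G + 2 * Re (mtrace ((recv_cov F * G - Smat p F * Sigs p) * mat_adjoint V))
      + hform (recv_cov F) (mat_adjoint V) (mat_adjoint V)"
    by (rule MSE_receiver_upd[OF F G V])
  show "hform (recv_cov F) (mat_adjoint (complex_of_real t \<cdot>\<^sub>m V)) (mat_adjoint (complex_of_real t \<cdot>\<^sub>m V))
      = t\<^sup>2 * hform (recv_cov F) (mat_adjoint V) (mat_adjoint V)" for t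
    using V recv_cov_carrier[of F]
    by (simp add: mat_adjoint_smult hform_smult_left[of _ "nM p" _ "nK p"] hform_smult_right[of _ "nM p" _ "nK p"] power2_eq_square)
qed (use G D in auto)

end

locale bcd_run = bf_setting +
  fixes small :: "nat \<Rightarrow> real \<Rightarrow> real \<Rightarrow> bool"
    and F :: "nat \<Rightarrow> nat \<Rightarrow> complex mat" and G :: "nat \<Rightarrow> complex mat"
  assumes run: "layered_BCD p small F G"
begin

lemma F_feasible: "feasible p (F j)"
  and F_shaped: "shaped (F j)"
  and G_carrier: "G j \<in> carrier_mat (nM p) (nK p)"
  and G_eq: "G j = Gstar p (F j)"
proof -
  have G: "G j = Gstar p (F j)" for j
    using run by (cases j) (auto simp: layered_BCD_def)
  have "feasible p (F j) \<and> G j \<in> carrier_mat (nM p) (nK p)" for j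
  proof (induction j)
    case 0
    have "feasible p (F 0)" using run by (simp add: layered_BCD_def)
    then show ?case using G[of 0] Gstar_carrier by (simp add: feasible_iff)
  next
    case (Suc j)
    have "inner_loop p (small (Suc j)) (G j) (F j) (F (Suc j))" using run by (simp add: layered_BCD_def)
    then have "feasible p (F (Suc j))" using inner_loop_descent Suc by blast
    then show ?case using G[of "Suc j"] Gstar_carrier by (simp add: feasible_iff)
  qed
  then show "feasible p (F j)" "shaped (F j)" "G j \<in> carrier_mat (nM p) (nK p)" by (auto simp: feasible_iff)
  show "G j = Gstar p (F j)" by (rule G)
qed

definition objective :: "nat \<Rightarrow> real" where
  "objective j = MSE p (F j) (G j)"

text \<open>The remaining passes and the receiver update only lower the objective, so the decrease
  of the whole outer iteration dominates that of its first pass.\<close>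

lemma first_pass:
  obtains F' where "inner_pass p (G j) (F j) F'" "objective j - MSE p F' (G j) \<le> objective j - objective (Suc j)"
proof -
  have "inner_loop p (small (Suc j)) (G j) (F j) (F (Suc j))" using run by (simp add: layered_BCD_def)
  from inner_loop_descent[OF this F_feasible G_carrier]
  obtain F' where F': "inner_pass p (G j) (F j) F'" "MSE p (F (Suc j)) (G j) \<le> MSE p F' (G j)" by blast
  have "objective (Suc j) \<le> MSE p (F (Suc j)) (G j)"
    unfolding objective_def G_eq[of "Suc j"] by (rule Gstar_minimizes[OF F_shaped G_carrier])
  then show thesis using that F' by simp
qed

lemma objective_Suc_le: "objective (Suc j) \<le> objective j"
proof -
  obtain F' where "inner_pass p (G j) (F j) F'" "objective j - MSE p F' (G j) \<le> objective j - objective (Suc j)"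
    by (rule first_pass)
  with inner_pass_descent(2)[OF F_feasible G_carrier this(1)] show ?thesis by (simp add: objective_def)
qed

lemma objective_decseq: "decseq objective"
  using objective_Suc_le by (rule decseq_SucI)

lemma objective_nonneg: "0 \<le> objective j"
proof -
  have "0 \<le> hform (1\<^sub>m (nM p)) (mat_adjoint (G j)) (mat_adjoint (G j))"
    using hform_one_self[of "mat_adjoint (G j)" "nK p" "nM p"] G_carrier[of j] by (auto intro!: sum_nonneg)
  then show ?thesis
    using MSE_ge_noise[OF F_shaped G_carrier, of j] noise_pos
    by (smt (verit) objective_def mult_nonneg_nonneg)
qed

text \<open>The error bound of the pass grows with the decrease, so the latter may be replaced by
  that of the outer iteration. The intermediate points disappear: beamformers and receiver occur
  with the index \<open>j\<close> only, and the next iterate enters only through its objective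
  value.\<close>

lemma approximately_stationary:
  assumes i: "i \<in> {1..nL p}" and Y: "Y \<in> carrier_mat (nN p i) (nJ p i)" "hform (tx_cov p i) Y Y \<le> budget p i"
  defines "d \<equiv> \<lambda>j. objective j - objective (Suc j)"
  shows "- d j - 4 * nL p * sqrt (d j * mse_quad (G j) i (Y - F j i)) \<le> mse_lin (F j) (G j) i (Y - F j i)"
proof -
  obtain F' where F': "inner_pass p (G j) (F j) F'" "objective j - MSE p F' (G j) \<le> d j"
    unfolding d_def by (rule first_pass)
  define d' where "d' = objective j - MSE p F' (G j)"
  have D: "Y - F j i \<in> carrier_mat (nN p i) (nJ p i)"
    by (rule minus_carrier_mat[OF shaped_dim(1)[OF F_shaped i]])
  have "- d j - 4 * nL p * sqrt (d j * mse_quad (G j) i (Y - F j i))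
      \<le> - d' - 4 * nL p * sqrt (d' * mse_quad (G j) i (Y - F j i))"
    using F'(2) mse_quad_nonneg[OF i D G_carrier]
    by (intro diff_mono mult_left_mono real_sqrt_le_mono mult_right_mono) (auto simp: d'_def)
  also have "\<dots> \<le> mse_lin (F j) (G j) i (Y - F j i)"
    using inner_pass_descent(3)[OF F_feasible G_carrier F'(1) i Y] by (simp add: d'_def objective_def)
  finally show ?thesis .
qed

lemma decrease_tendsto_0: "(\<lambda>j. objective j - objective (Suc j)) \<longlonglongrightarrow> 0"
proof -
  obtain L where "objective \<longlonglongrightarrow> L"
    using decseq_convergent[OF objective_decseq, of 0] objective_nonneg by blast
  from tendsto_diff[OF this LIMSEQ_Suc[OF this]] show ?thesis by simp
qed

lemma limit_point_stationary:
  assumes lim: "is_limit_point p (\<lambda>j. F (Suc j)) (\<lambda>j. G (Suc j)) Fl Gl"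
  shows "stationary_P0 p Fl Gl"
proof -
  obtain s where s: "strict_mono s"
    and Ft: "\<And>i. i \<in> {1..nL p} \<Longrightarrow> mat_tendsto (nN p i) (nJ p i) (\<lambda>n. F (Suc (s n)) i) (Fl i)"
    and Gt: "mat_tendsto (nM p) (nK p) (\<lambda>n. G (Suc (s n))) Gl"
    using lim unfolding is_limit_point_def by blast
  \<comment> \<open>The sequence of the claim starts at index \<open>1\<close>, so the subsequence
    is shifted by one.\<close>
  define k where "k n = Suc (s n)" for n
  have k: "strict_mono k" using s by (auto simp: k_def strict_mono_def)
  have Fc: "mat_conv (nN p i) (nJ p i) (\<lambda>n. F (k n) i) (Fl i)" if "i \<in> {1..nL p}" for i
    using Ft[OF that] shaped_dim(1)[OF F_shaped that] by (simp add: mat_conv_def k_def)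
  have Gc: "mat_conv (nM p) (nK p) (\<lambda>n. G (k n)) Gl"
    using Gt G_carrier by (simp add: mat_conv_def k_def)
  have Gl: "Gl \<in> carrier_mat (nM p) (nK p)" using mat_convD(2)[OF Gc] .
  have sFl: "shaped Fl" using mat_convD(2)[OF Fc] by (auto simp: shaped_def)
  have "hform (tx_cov p i) (Fl i) (Fl i) \<le> budget p i" if i: "i \<in> {1..nL p}" for i
  proof (rule LIMSEQ_le_const2)
    show "(\<lambda>n. hform (tx_cov p i) (F (k n) i) (F (k n) i)) \<longlonglongrightarrow> hform (tx_cov p i) (Fl i) (Fl i)"
      by (rule mat_conv_hform[OF tx_cov_facts(1)[OF i] Fc[OF i] Fc[OF i]])
    show "\<exists>N. \<forall>n\<ge>N. hform (tx_cov p i) (F (k n) i) (F (k n) i) \<le> budget p i"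
      using F_feasible i by (auto simp: feasible_iff)
  qed
  then have feas: "feasible p Fl" using sFl by (simp add: feasible_iff)
  have block: "0 \<le> mse_lin Fl Gl i (Y - Fl i)"
    if i: "i \<in> {1..nL p}" and Y: "Y \<in> carrier_mat (nN p i) (nJ p i)" "hform (tx_cov p i) Y Y \<le> budget p i" for i Y
  proof -
    define d where "d n = objective (k n) - objective (Suc (k n))" for n
    have d: "d \<longlonglongrightarrow> 0"
      using LIMSEQ_subseq_LIMSEQ[OF decrease_tendsto_0 k] by (simp add: o_def d_def[abs_def])
    have Dc: "mat_conv (nN p i) (nJ p i) (\<lambda>n. Y - F (k n) i) (Y - Fl i)"
      by (intro mat_conv_minus mat_conv_const Y Fc i)
    \<comment> \<open>The quadratic form converges along the subsequence, hence is bounded there,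
      while \<open>d\<close> tends to \<open>0\<close>; so the square root vanishes in the
      limit.\<close>
    have lower: "(\<lambda>n. - d n - 4 * nL p * sqrt (d n * mse_quad (G (k n)) i (Y - F (k n) i)))
        \<longlonglongrightarrow> - 0 - 4 * nL p * sqrt (0 * mse_quad Gl i (Y - Fl i))"
      by (intro tendsto_intros d mse_quad_conv Gc i Dc)
    have upper: "(\<lambda>n. mse_lin (F (k n)) (G (k n)) i (Y - F (k n) i)) \<longlonglongrightarrow> mse_lin Fl Gl i (Y - Fl i)"
      by (intro mse_lin_conv Fc Gc i Dc)
    have "- 0 - 4 * nL p * sqrt (0 * mse_quad Gl i (Y - Fl i)) \<le> mse_lin Fl Gl i (Y - Fl i)"
      by (rule LIMSEQ_le[OF lower upper]) (unfold d_def, blast intro: approximately_stationary[OF i Y])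
    then show ?thesis by simp
  qed
  have "recv_cov Fl * Gl = Smat p Fl * Sigs p"
  proof (rule mat_conv_unique)
    show "mat_conv (nM p) (nK p) (\<lambda>n. recv_cov (F (k n)) * G (k n)) (recv_cov Fl * Gl)"
      by (intro mat_conv_mult[of _ "nM p"] recv_cov_conv Fc Gc)
    have "recv_cov (F (k n)) * G (k n) = Smat p (F (k n)) * Sigs p" for n
      unfolding G_eq by (rule Gstar_normal_equation[OF F_shaped])
    then show "mat_conv (nM p) (nK p) (\<lambda>n. recv_cov (F (k n)) * G (k n)) (Smat p Fl * Sigs p)"
      by (simp only:) (intro mat_conv_mult[of _ "nK p"] Smat_conv Fc mat_conv_const Sigs_facts)
  qed
  then have normal: "recv_cov Fl * Gl - Smat p Fl * Sigs p = 0\<^sub>m (nM p) (nK p)"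
    by (simp only:) (intro eq_matI; simp del: index_mult_mat(1))
  show ?thesis
    unfolding stationary_P0_def
  proof (intro conjI allI impI feas Gl)
    fix F' and G' :: "complex mat"
    assume F': "feasible p F'" and G': "G' \<in> carrier_mat (nM p) (nK p)"
    \<comment> \<open>The feasible set is a product, so any feasible tuple tests every block
      separately and the blockwise inequalities may be added.\<close>
    have "0 \<le> (\<Sum>i\<in>{1..nL p}. grad_app (\<lambda>Y. MSE p (Fl(i := Y)) Gl) (Fl i) (F' i - Fl i))"
    proof (rule sum_nonneg)
      fix i assume i: "i \<in> {1..nL p}"
      have Y: "F' i \<in> carrier_mat (nN p i) (nJ p i)" "hform (tx_cov p i) (F' i) (F' i) \<le> budget p i"
        using F' i by (auto simp: feasible_iff shaped_def)
      show "0 \<le> grad_app (\<lambda>Y. MSE p (Fl(i := Y)) Gl) (Fl i) (F' i - Fl i)"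
        using block[OF i Y] grad_app_beamformer[OF sFl i minus_carrier_mat[OF shaped_dim(1)[OF sFl i]] Gl] by simp
    qed
    moreover have "grad_app (\<lambda>Y. MSE p Fl Y) Gl (G' - Gl) = 0"
    proof -
      have "0\<^sub>m (nM p) (nK p) * mat_adjoint (G' - Gl) = 0\<^sub>m (nM p) (nM p)"
        using Gl by (intro left_mult_zero_mat) auto
      then show ?thesis
        unfolding grad_app_receiver[OF sFl Gl minus_carrier_mat[OF Gl]] normal by (simp add: mtrace_def)
    qed
    ultimately show "0 \<le> (\<Sum>i\<in>{1..nL p}. grad_app (\<lambda>Y. MSE p (Fl(i := Y)) Gl) (Fl i) (F' i - Fl i))
        + grad_app (\<lambda>Y. MSE p Fl Y) Gl (G' - Gl)"
      by simp
  qed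
qed

section \<open>Existence of limit points\<close>

lemma G_entry_bound:
  assumes "r < nM p" "c < nK p"
  shows "cmod (G j $$ (r, c)) \<le> sqrt (objective 0 / noise p)"
proof (rule real_le_rsqrt)
  have A: "mat_adjoint (G j) \<in> carrier_mat (nK p) (nM p)" using G_carrier by simp
  have "(cmod (G j $$ (r, c)))\<^sup>2 = (cmod (mat_adjoint (G j) $$ (c, r)))\<^sup>2"
    using assms G_carrier[of j] by simp
  also have "\<dots> \<le> (\<Sum>r<nM p. (cmod (mat_adjoint (G j) $$ (c, r)))\<^sup>2)"
    using assms by (intro member_le_sum[of r "{..<nM p}" "\<lambda>r. (cmod (mat_adjoint (G j) $$ (c, r)))\<^sup>2"]) auto
  also have "\<dots> \<le> (\<Sum>c<nK p. \<Sum>r<nM p. (cmod (mat_adjoint (G j) $$ (c, r)))\<^sup>2)"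
    using assms by (intro member_le_sum[of c "{..<nK p}" "\<lambda>c. \<Sum>r<nM p. (cmod (mat_adjoint (G j) $$ (c, r)))\<^sup>2"])
      (auto intro: sum_nonneg)
  also have "\<dots> = hform (1\<^sub>m (nM p)) (mat_adjoint (G j)) (mat_adjoint (G j))"
    by (rule hform_one_self[OF A, symmetric])
  \<comment> \<open>The receiver noise alone accounts for \<open>noise p\<close> times the squared
    norm of the receiver, which the objective dominates.\<close>
  also have "\<dots> \<le> objective j / noise p"
    using MSE_ge_noise[OF F_shaped G_carrier, of j] noise_pos by (simp add: objective_def field_simps)
  also have "\<dots> \<le> objective 0 / noise p"
    using decseqD[OF objective_decseq, of 0 j] noise_pos by (intro divide_right_mono) auto
  finally show "(cmod (G j $$ (r, c)))\<^sup>2 \<le> objective 0 / noise p" .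
qed

lemma limit_point_exists: "\<exists>Fl Gl. is_limit_point p (\<lambda>j. F (Suc j)) (\<lambda>j. G (Suc j)) Fl Gl"
proof -
  have "\<forall>i\<in>{1..nL p}. \<exists>C. \<forall>j. \<forall>r<nN p i. \<forall>c<nJ p i. cmod (F j i $$ (r, c)) \<le> C"
  proof
    fix i assume i: "i \<in> {1..nL p}"
    obtain C where C: "\<forall>X\<in>carrier_mat (nN p i) (nJ p i). hform (tx_cov p i) X X \<le> budget p i \<longrightarrow>
        (\<forall>r<nN p i. \<forall>c<nJ p i. cmod (X $$ (r, c)) \<le> C)"
      using pd_hform_entry_bound[OF tx_cov_pd[OF i]] by blast
    then show "\<exists>C. \<forall>j. \<forall>r<nN p i. \<forall>c<nJ p i. cmod (F j i $$ (r, c)) \<le> C"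
      using F_feasible i by (auto simp: feasible_iff shaped_def intro!: exI[of _ C])
  qed
  then obtain C where C: "\<And>i j r c. i \<in> {1..nL p} \<Longrightarrow> r < nN p i \<Longrightarrow> c < nJ p i \<Longrightarrow> cmod (F j i $$ (r, c)) \<le> C i"
    by metis
  define IF where "IF = (SIGMA i:{1..nL p}. {..<nN p i} \<times> {..<nJ p i})"
  define IG where "IG = {..<nM p} \<times> {..<nK p}"
  \<comment> \<open>All entries of all blocks and of the receiver form one finite family of scalar
    sequences, so a single subsequence serves them all.\<close>
  define u :: "(nat \<times> nat \<times> nat) + (nat \<times> nat) \<Rightarrow> nat \<Rightarrow> complex" where
    "u a n = (case a of Inl (i, r, c) \<Rightarrow> F (Suc n) i $$ (r, c) | Inr (r, c) \<Rightarrow> G (Suc n) $$ (r, c))" for a n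
  have "\<exists>s. strict_mono s \<and> (\<forall>a\<in>IF <+> IG. convergent (\<lambda>n. u a (s n)))"
  proof (rule common_convergent_subsequence)
    show "finite (IF <+> IG)" by (auto simp: IF_def IG_def)
    fix a assume "a \<in> IF <+> IG"
    then consider i r c where "a = Inl (i, r, c)" "i \<in> {1..nL p}" "r < nN p i" "c < nJ p i"
      | r c where "a = Inr (r, c)" "r < nM p" "c < nK p"
      by (auto simp: IF_def IG_def)
    then show "bounded (range (u a))"
      unfolding bounded_iff
      by cases (auto simp: u_def intro!: C G_entry_bound exI)
  qed
  then obtain s where s: "strict_mono s" "\<And>a. a \<in> IF <+> IG \<Longrightarrow> convergent (\<lambda>n. u a (s n))" by blast
  define Fl where "Fl i = Matrix.mat (nN p i) (nJ p i) (\<lambda>(r, c). lim (\<lambda>n. u (Inl (i, r, c)) (s n)))" for i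
  define Gl where "Gl = Matrix.mat (nM p) (nK p) (\<lambda>(r, c). lim (\<lambda>n. u (Inr (r, c)) (s n)))"
  have "mat_tendsto (nN p i) (nJ p i) (\<lambda>n. F (Suc (s n)) i) (Fl i)" if "i \<in> {1..nL p}" for i
    unfolding mat_tendsto_def
  proof (intro conjI allI impI)
    show "Fl i \<in> carrier_mat (nN p i) (nJ p i)" by (simp add: Fl_def)
    fix r c assume rc: "r < nN p i" "c < nJ p i"
    then have "convergent (\<lambda>n. u (Inl (i, r, c)) (s n))" using that by (intro s(2)) (auto simp: IF_def)
    then show "(\<lambda>n. F (Suc (s n)) i $$ (r, c)) \<longlonglongrightarrow> Fl i $$ (r, c)"
      using rc by (simp add: convergent_LIMSEQ_iff Fl_def u_def)
  qed
  moreover have "mat_tendsto (nM p) (nK p) (\<lambda>n. G (Suc (s n))) Gl"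
    unfolding mat_tendsto_def
  proof (intro conjI allI impI)
    show "Gl \<in> carrier_mat (nM p) (nK p)" by (simp add: Gl_def)
    fix r c assume rc: "r < nM p" "c < nK p"
    then have "convergent (\<lambda>n. u (Inr (r, c)) (s n))" by (intro s(2)) (auto simp: IG_def)
    then show "(\<lambda>n. G (Suc (s n)) $$ (r, c)) \<longlonglongrightarrow> Gl $$ (r, c)"
      using rc by (simp add: convergent_LIMSEQ_iff Gl_def u_def)
  qed
  ultimately show ?thesis using s(1) unfolding is_limit_point_def by blast
qed

end

theorem theorem4:
  fixes p :: bf_problem
    and small :: "nat \<Rightarrow> real \<Rightarrow> real \<Rightarrow> bool"
    and F :: "nat \<Rightarrow> nat \<Rightarrow> complex mat"
    and G :: "nat \<Rightarrow> complex mat"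
  assumes "valid_problem p"
    and "\<And>i. i \<in> {1..nL p} \<Longrightarrow>
           pd_mat (nJ p i) (Kmat p i * Sigs p * mat_adjoint (Kmat p i)) \<or> pd_mat (nJ p i) (Sig p i)"
    and "layered_BCD p small F G"
  shows "decseq (\<lambda>j. MSE p (F j) (G j)) \<and>
     (\<exists>Fl Gl. is_limit_point p (\<lambda>j. F (Suc j)) (\<lambda>j. G (Suc j)) Fl Gl) \<and>
     (\<forall>Fl Gl. is_limit_point p (\<lambda>j. F (Suc j)) (\<lambda>j. G (Suc j)) Fl Gl \<longrightarrow> stationary_P0 p Fl Gl)"
proof -
  interpret bcd_run p small F G
    by unfold_locales (use assms in auto)
  show ?thesis
    using objective_decseq limit_point_exists limit_point_stationary
    unfolding objective_def[abs_def] by blast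
qed

end
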